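(* Let $H$ be an underlying laminar flow satisfying the strict non-stagnation condition $u-c>0$ uniformly throughout the fluid domain. Let $\sigma$ denote the surface tension coefficient and $g_*=g-2\Omega c$ the speed-dependent effective gravity. For $\nu$ near $0$ let $$\mathfrak B(\nu)=\frac{a(1)^3M_\zeta(1;\nu)}{M(1;\nu)},$$ where $M(\cdot;\nu)$ solves $(a^3M_\zeta)_\zeta=-\nu aM$ on $(0,1)$, $M(0;\nu)=0$, $M_\zeta(0;\nu)=a(0)^{-3}$. Assume the nondegeneracy condition $\mathfrak B''(0)<0$. Then: (1) (Smooth persistence) The Hamiltonian--Hopf resonance curve persists smoothly as the imaginary spatial eigenvalue parameter $\mathfrak q\to0$ (i.e. near this limit it is parametrized by smooth functions of $\mathfrak q$ that extend smoothly to $\mathfrak q=0$), terminating precisely at the codimension-two $0^4$ resonance point, characterized by a critical surface tension and a critical effective gravity $g_*^H$. (2) (Separation from weak effective gravity) The critical effective gravity at this codimension-two point is strictly positive, $g_*^H>0$. Consequently, the local Hamiltonian--Hopf curve (for $\mathfrak q$ sufficiently small) is bounded away from, and cannot enter, the weak-effective-gravity regime $g_*=g-2\Omega c\approx0$.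
   Context: **Setting.** Steady two-dimensional $f$-plane capillary-gravity flow: gravity $g$, rotation rate $\Omega$, wave speed $c$, depth $d>0$, relative mass flux $m<0$ (fixed), surface tension $\sigma>0$. Dimensionless parameters $\alpha=g_*d^3/m^2$, $\beta=\sigma d/m^2$. Horizontal velocity $u$, stream function $\psi$ with $\psi_z=u-c$, $\psi=m(1-\zeta)$, $\zeta\in[0,1]$ ($\zeta=0$ bed, $\zeta=1$ surface). **Laminar flow.** $\gamma\in L^2(0,1)$ dimensionless vorticity, $\Gamma(\zeta)=\int_0^\zeta\gamma$, $a(\zeta)=\sqrt{\lambda+2\Gamma(\zeta)}$ with $\lambda$ such that $H(\zeta)=\int_0^\zeta a^{-1}$ satisfies $H(1)=1$. Up to a fixed scaling $a=u-c$; uniform non-stagnation means $a(\zeta)\ge a_{\min}>0$ on $[0,1]$. **Linearized operator.** $\mathcal L(\rho,\tau,\phi,\mathfrak w)=\big(-a(1)^{-1}\tau,\ a(1)^4\beta^{-1}\phi_\zeta(1)-a(1)\alpha\beta^{-1}\rho,\ -a^{-1}\mathfrak w,\ (a^3\phi_\zeta)_\zeta\big)$ on $\{(\rho,\tau,\phi,\mathfrak w)\in\mathbb R\times\mathbb R\times H^1(0,1)\times L^2(0,1):\phi(0)=0,\phi(1)=\rho\}$ (complexified), with domain $\phi\in H^2(0,1)$, $\mathfrak w\in H^1(0,1)$, $\phi(0)=0,\phi(1)=\rho,\mathfrak w(0)=0,\mathfrak w(1)=\tau$. Eigenvalues $\kappa$ of $\mathcal L$ correspond to $\nu=\kappa^2$,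 where $-a^{-1}(a^3\phi_\zeta)_\zeta=\nu\phi$, $\phi(0)=0$, $-\frac{a(1)^3}{\beta}\phi_\zeta(1)+\frac\alpha\beta\phi(1)=\nu\phi(1)$ has a nontrivial solution; for $\nu$ near $0$ this reads $\mathfrak B(\nu)=\alpha-\beta\nu$. **Resonances.** The Hamiltonian--Hopf resonance curve is the set of $(\beta,\alpha)$ for which $\mathcal L$ has eigenvalues $\pm i\mathfrak q$, $\mathfrak q>0$, of algebraic multiplicity two, i.e. the line $s=\alpha-\beta\nu$ is tangent to $s=\mathfrak B(\nu)$ at $\nu=-\mathfrak q^2$: $\mathfrak B(\nu)=\alpha-\beta\nu$ and $\mathfrak B'(\nu)=-\beta$; here the branch near $\nu=0$ is meant. The $0^4$ resonance point is the parameter point $(\beta,\alpha)$ at which $0$ is an eigenvalue of $\mathcal L$ of algebraic multiplicity four (equivalently $\nu=0$ is a double scalar eigenvalue). *)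

theory Defs
  imports "HOL-Analysis.Analysis" "HOL-Library.Function_Algebras"
begin

section \<open>Function spaces on the unit interval\<close>

definition L2 :: "(real \<Rightarrow> 'b::{banach, second_countable_topology}) \<Rightarrow> bool" where
  "L2 f \<longleftrightarrow> set_borel_measurable lebesgue {0..1} f \<and>
           set_integrable lebesgue {0..1} (\<lambda>x. (norm (f x))\<^sup>2)"

text \<open>
  \<open>H1_deriv f g\<close>: the function \<open>f\<close> is the continuous representative of an element of
  \<open>H\<^sup>1(0,1)\<close>, and \<open>g\<close> is (a representative of) its weak derivative. Elements of \<open>H\<^sup>1\<close>
  are always given by their continuous representatives, so that boundary values make sense.
\<close>

definition H1_deriv :: "(real \<Rightarrow> 'b::{banach, second_countable_topology}) \<Rightarrow> (real \<Rightarrow> 'b) \<Rightarrow> bool"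
  where "H1_deriv f g \<longleftrightarrow> L2 g \<and> (\<forall>x\<in>{0..1}. f x = f 0 + integral {0..x} g)"

definition H1 :: "(real \<Rightarrow> 'b::{banach, second_countable_topology}) \<Rightarrow> bool" where
  "H1 f \<longleftrightarrow> (\<exists>g. H1_deriv f g)"

definition H2 :: "(real \<Rightarrow> 'b::{banach, second_countable_topology}) \<Rightarrow> bool" where
  "H2 f \<longleftrightarrow> (\<exists>g. H1_deriv f g \<and> H1 g)"

definition smooth_on_open :: "real set \<Rightarrow> (real \<Rightarrow> real) \<Rightarrow> bool" where
  "smooth_on_open S f \<longleftrightarrow> open S \<and> (\<forall>n. \<forall>x\<in>S. (deriv ^^ n) f differentiable (at x))"

section \<open>Laminar flow\<close>

definition laminar_Gamma :: "(real \<Rightarrow> real) \<Rightarrow> real \<Rightarrow> real" where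
  "laminar_Gamma \<gamma> \<zeta> = integral {0..\<zeta>} \<gamma>"

definition laminar_a :: "(real \<Rightarrow> real) \<Rightarrow> real \<Rightarrow> real \<Rightarrow> real" where
  "laminar_a \<gamma> lam \<zeta> = sqrt (lam + 2 * laminar_Gamma \<gamma> \<zeta>)"

definition laminar_H :: "(real \<Rightarrow> real) \<Rightarrow> real \<Rightarrow> real \<Rightarrow> real" where
  "laminar_H \<gamma> lam \<zeta> = integral {0..\<zeta>} (\<lambda>s. 1 / laminar_a \<gamma> lam s)"

text \<open>
  The velocity of the laminar flow relative to the wave, \<open>u - c\<close>, equals \<open>a\<close> up to the fixed
  positive factor \<open>\<bar>m\<bar> / d\<close>; uniform non-stagnation is therefore a positive lower bound for \<open>a\<close>.
  The bound also makes the radicand in \<open>laminar_a\<close> positive.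
\<close>

definition nonstagnant_laminar_flow :: "(real \<Rightarrow> real) \<Rightarrow> real \<Rightarrow> bool" where
  "nonstagnant_laminar_flow \<gamma> lam \<longleftrightarrow>
     L2 \<gamma> \<and> laminar_H \<gamma> lam 1 = 1 \<and> (\<exists>a_min>0. \<forall>\<zeta>\<in>{0..1}. a_min \<le> laminar_a \<gamma> lam \<zeta>)"

section \<open>Physical and dimensionless parameters\<close>

definition effective_gravity :: "real \<Rightarrow> real \<Rightarrow> real \<Rightarrow> real" where
  "effective_gravity g \<Omega> c = g - 2 * \<Omega> * c"

definition alpha_par :: "real \<Rightarrow> real \<Rightarrow> real \<Rightarrow> real" where
  "alpha_par d m g_star = g_star * d ^ 3 / m\<^sup>2"

definition beta_par :: "real \<Rightarrow> real \<Rightarrow> real \<Rightarrow> real" where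
  "beta_par d m \<sigma> = \<sigma> * d / m\<^sup>2"

section \<open>The linearized operator\<close>

text \<open>
  States \<open>(\<rho>, \<tau>, \<phi>, w)\<close>. Functions on the unit interval are extended by zero to the real line,
  so an element of the domain (given by continuous representatives) is represented by exactly
  one state; elements of the phase space are represented up to null sets in the last component.
\<close>

type_synonym state = "complex \<times> complex \<times> (real \<Rightarrow> complex) \<times> (real \<Rightarrow> complex)"

definition state_scale :: "complex \<Rightarrow> state \<Rightarrow> state" where
  "state_scale k = (\<lambda>(\<rho>, \<tau>, \<phi>, w). (k * \<rho>, k * \<tau>, \<lambda>x. k * \<phi> x, \<lambda>x. k * w x))"

lemma vector_space_state_scale: "vector_space state_scale"
  by unfold_locales
    (auto simp: state_scale_def algebra_simps plus_fun_def zero_prod_def fun_eq_iff)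

definition vanishes_outside :: "(real \<Rightarrow> complex) \<Rightarrow> bool" where
  "vanishes_outside f \<longleftrightarrow> (\<forall>x. x \<notin> {0..1} \<longrightarrow> f x = 0)"

definition phase_space :: "state set" where
  "phase_space = {(\<rho>, \<tau>, \<phi>, w).
     vanishes_outside \<phi> \<and> vanishes_outside w \<and> H1 \<phi> \<and> L2 w \<and> \<phi> 0 = 0 \<and> \<phi> 1 = \<rho>}"

definition L_domain :: "state set" where
  "L_domain = {(\<rho>, \<tau>, \<phi>, w).
     vanishes_outside \<phi> \<and> vanishes_outside w \<and> H2 \<phi> \<and> H1 w \<and>
     \<phi> 0 = 0 \<and> \<phi> 1 = \<rho> \<and> w 0 = 0 \<and> w 1 = \<tau>}"

text \<open>
  The graph of the unbounded operator \<open>\<L>\<close>. The function \<open>\<phi>\<^sub>\<zeta>\<close> is the continuous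
  representative of the derivative of \<open>\<phi>\<close>; the last component of the image is only determined
  almost everywhere, and every representative is admitted.
\<close>

definition L_graph :: "(real \<Rightarrow> real) \<Rightarrow> real \<Rightarrow> real \<Rightarrow> (state \<times> state) set" where
  "L_graph a \<beta> \<alpha> = {((\<rho>, \<tau>, \<phi>, w), (\<rho>', \<tau>', \<phi>', w')).
     (\<rho>, \<tau>, \<phi>, w) \<in> L_domain \<and> (\<rho>', \<tau>', \<phi>', w') \<in> phase_space \<and>
     (\<exists>\<phi>\<^sub>\<zeta>. H1_deriv \<phi> \<phi>\<^sub>\<zeta> \<and> H1 \<phi>\<^sub>\<zeta> \<and>
        \<rho>' = - \<tau> / of_real (a 1) \<and>
        \<tau>' = of_real (a 1 ^ 4 / \<beta>) * \<phi>\<^sub>\<zeta> 1 - of_real (a 1 * \<alpha> / \<beta>) * \<rho> \<and>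
        (\<forall>\<zeta>\<in>{0..1}. \<phi>' \<zeta> = - w \<zeta> / of_real (a \<zeta>)) \<and>
        H1_deriv (\<lambda>\<zeta>. of_real (a \<zeta> ^ 3) * \<phi>\<^sub>\<zeta> \<zeta>) w')}"

primrec gen_kernel :: "(state \<times> state) set \<Rightarrow> complex \<Rightarrow> nat \<Rightarrow> state set" where
  "gen_kernel A \<kappa> 0 = {0}"
| "gen_kernel A \<kappa> (Suc n) = {x. \<exists>y. (x, y) \<in> A \<and> y - state_scale \<kappa> x \<in> gen_kernel A \<kappa> n}"

text \<open>
  The cardinality of an infinite basis is 0, so a positive value of the dimension below
  also says that the generalized eigenspace is finite-dimensional.
\<close>

definition is_eigenvalue :: "(state \<times> state) set \<Rightarrow> complex \<Rightarrow> bool" where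
  "is_eigenvalue A \<kappa> \<longleftrightarrow> (\<exists>x. x \<noteq> 0 \<and> (x, state_scale \<kappa> x) \<in> A)"

definition alg_mult :: "(state \<times> state) set \<Rightarrow> complex \<Rightarrow> nat" where
  "alg_mult A \<kappa> = vector_space.dim state_scale (\<Union>n. gen_kernel A \<kappa> n)"

section \<open>Resonances\<close>

definition hamiltonian_hopf :: "(real \<Rightarrow> real) \<Rightarrow> real \<Rightarrow> real \<Rightarrow> real \<Rightarrow> bool" where
  "hamiltonian_hopf a \<beta> \<alpha> q \<longleftrightarrow>
     (\<forall>\<kappa>\<in>{\<i> * of_real q, - \<i> * of_real q}.
        is_eigenvalue (L_graph a \<beta> \<alpha>) \<kappa> \<and> alg_mult (L_graph a \<beta> \<alpha>) \<kappa> = 2)"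

definition zero4_resonance :: "(real \<Rightarrow> real) \<Rightarrow> real \<Rightarrow> real \<Rightarrow> bool" where
  "zero4_resonance a \<beta> \<alpha> \<longleftrightarrow>
     is_eigenvalue (L_graph a \<beta> \<alpha>) 0 \<and> alg_mult (L_graph a \<beta> \<alpha>) 0 = 4"

text \<open>
  \<open>shoots a \<nu> M\<close>: \<open>M\<close> solves \<open>(a\<^sup>3 M\<^sub>\<zeta>)\<^sub>\<zeta> = -\<nu> a M\<close>, \<open>M(0) = 0\<close>, \<open>M\<^sub>\<zeta>(0) = a(0)\<^sup>-\<^sup>3\<close>. As \<open>a\<close> is
  continuous, \<open>M\<close> and \<open>a\<^sup>3 M\<^sub>\<zeta>\<close> are continuously differentiable up to the boundary, and
  classical (at the end points one-sided) derivatives can be used.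
\<close>

definition shoots :: "(real \<Rightarrow> real) \<Rightarrow> real \<Rightarrow> (real \<Rightarrow> real) \<Rightarrow> bool" where
  "shoots a \<nu> M \<longleftrightarrow> (\<exists>M\<^sub>\<zeta>.
     (\<forall>\<zeta>\<in>{0..1}. (M has_real_derivative M\<^sub>\<zeta> \<zeta>) (at \<zeta> within {0..1})) \<and>
     (\<forall>\<zeta>\<in>{0..1}. ((\<lambda>s. a s ^ 3 * M\<^sub>\<zeta> s) has_real_derivative - \<nu> * a \<zeta> * M \<zeta>)
                    (at \<zeta> within {0..1})) \<and>
     M 0 = 0 \<and> M\<^sub>\<zeta> 0 = 1 / a 0 ^ 3)"

definition frakB :: "(real \<Rightarrow> real) \<Rightarrow> (real \<Rightarrow> real \<Rightarrow> real) \<Rightarrow> real \<Rightarrow> real" where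
  "frakB a M \<nu> = a 1 ^ 3 * vector_derivative (M \<nu>) (at 1 within {0..1}) / M \<nu> 1"

definition line_tangent :: "(real \<Rightarrow> real) \<Rightarrow> real \<Rightarrow> real \<Rightarrow> real \<Rightarrow> bool" where
  "line_tangent B \<beta> \<alpha> \<nu> \<longleftrightarrow> B \<nu> = \<alpha> - \<beta> * \<nu> \<and> (B has_real_derivative - \<beta>) (at \<nu>)"

end

theory Submission
  imports Defs "HOL-Complex_Analysis.Cauchy_Integral_Formula"
begin

text \<open>
  With \<open>x = - \<nu>\<close> the solution of the shooting problem is an entire power series in \<open>x\<close> whose
  coefficients are iterated integrals, so \<open>\<BB>\<close> extends to a holomorphic function near \<open>0\<close>, and
  \<open>\<kappa>\<close> is an eigenvalue of \<open>\<L>\<close> iff the characteristic function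
  \<open>a(1)\<^sup>3 M\<^sub>\<zeta>(1) - (\<alpha> + \<beta> x) M(1)\<close> vanishes at \<open>x = - \<kappa>\<^sup>2\<close>. The Taylor coefficients in \<open>\<kappa>\<close> of the
  formal eigenvector form a Jordan chain, which ends exactly where a Taylor coefficient of the
  characteristic function is nonzero; hence algebraic multiplicity equals the order of the zero in
  \<open>\<kappa>\<close>. As \<open>\<BB>''(0) < 0\<close>, that order is two at \<open>\<kappa> = \<plusminus>\<i>q\<close> (four at \<open>\<kappa> = 0\<close>) iff the line is tangent.
  Tangency at \<open>\<nu> = - q\<^sup>2\<close> means \<open>\<beta> = - \<BB>'(\<nu>)\<close> and \<open>\<alpha> = \<BB>(\<nu>) - \<nu> \<BB>'(\<nu>)\<close>, which is smooth in \<open>q\<close>, and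
  at \<open>\<nu> = 0\<close> one has \<open>\<BB>(0) = 1 / \<integral> a\<^sup>-\<^sup>3 > 0\<close> and \<open>\<BB>'(0) < 0\<close>.
\<close>

section \<open>Calculus in the Sobolev spaces\<close>

text \<open>The obstacle is to show that a Jordan chain really ends, which would normally need the
  adjoint operator and a solvability condition. Here a scalar defect takes that role: each Taylor
  coefficient of the formal eigenvector satisfies all equations of a chain link except possibly the
  boundary equation for \<tau>, and the residue there is a nonzero multiple of a Taylor coefficient
  in \<kappa> of the characteristic function. Since \<open>a\<close> is merely H1, the equation is
  treated as a first order system for M and a^3 M_\<zeta> with continuous coefficients, so that
  \<open>a\<close> is never differentiated there. The spectral parameter enters through \<kappa>^2
  only; at \<kappa> = 0 all odd coefficients vanish, which is why a double root in x gives
  multiplicity four there and two elsewhere. Complex x turns smoothness into holomorphy, and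
  inserting x = q^2 continues the curve to both sides of q = 0.\<close>

lemma L2_absolutely_integrable:
  fixes f :: "real \<Rightarrow> 'b::euclidean_space"
  assumes "L2 f"
  shows "f absolutely_integrable_on {0..1}"
proof -
  have m: "set_borel_measurable lebesgue {0..1} f"
    and i: "set_integrable lebesgue {0..1} (\<lambda>x. (norm (f x))\<^sup>2)"
    using assms by (auto simp: L2_def)
  have "set_integrable lebesgue {0..1::real} (\<lambda>x. 1::real)"
    by (simp add: set_integrable_def)
  then have "set_integrable lebesgue {0..1} (\<lambda>x. 1 + (norm (f x))\<^sup>2)"
    using i by (rule set_integral_add)
  then show ?thesis
    unfolding set_integrable_def
  proof (rule Bochner_Integration.integrable_bound)
    show "(\<lambda>x. indicator {0..1} x *\<^sub>R f x) \<in> borel_measurable lebesgue"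
      using m by (simp add: set_borel_measurable_def)
    have "t \<le> 1 + t\<^sup>2" for t :: real
      using zero_le_power2[of "t - 1 / 2"] by (simp add: power2_diff power2_eq_square[of "1/2"])
    then show "AE x in lebesgue. norm (indicator {0..1} x *\<^sub>R f x)
        \<le> norm (indicator {0..1} x *\<^sub>R (1 + (norm (f x))\<^sup>2))"
      by (intro AE_I2) (auto simp: indicator_def add_nonneg_nonneg)
  qed
qed

lemma L2_bound:
  fixes f :: "real \<Rightarrow> 'b::euclidean_space"
    and g :: "real \<Rightarrow> 'c::euclidean_space"
  assumes "L2 g" and m: "set_borel_measurable lebesgue {0..1} f"
    and b: "\<And>x. x \<in> {0..1} \<Longrightarrow> norm (f x) \<le> C * norm (g x)"
  shows "L2 f"
  unfolding L2_def
proof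
  have "set_integrable lebesgue {0..1} (\<lambda>x. C\<^sup>2 * (norm (g x))\<^sup>2)"
    using assms(1) by (auto simp: L2_def)
  then show "set_integrable lebesgue {0..1} (\<lambda>x. (norm (f x))\<^sup>2)"
    unfolding set_integrable_def
  proof (rule Bochner_Integration.integrable_bound)
    have "(\<lambda>x. (norm (indicator {0..1} x *\<^sub>R f x))\<^sup>2) \<in> borel_measurable lebesgue"
      using m unfolding set_borel_measurable_def by measurable
    also have "(\<lambda>x. (norm (indicator {0..1} x *\<^sub>R f x))\<^sup>2)
        = (\<lambda>x. indicator {0..1} x *\<^sub>R (norm (f x))\<^sup>2)"
      by (auto simp: indicator_def fun_eq_iff)
    finally show "(\<lambda>x. indicator {0..1} x *\<^sub>R (norm (f x))\<^sup>2) \<in> borel_measurable lebesgue" .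
    show "AE x in lebesgue. norm (indicator {0..1} x *\<^sub>R (norm (f x))\<^sup>2)
        \<le> norm (indicator {0..1} x *\<^sub>R (C\<^sup>2 * (norm (g x))\<^sup>2))"
      using b by (intro AE_I2) (auto simp: indicator_def power_mult_distrib[symmetric] intro!: power_mono)
  qed
qed (rule m)

lemma bounded_on_Icc:
  fixes f :: "real \<Rightarrow> 'b::real_normed_vector"
  assumes "continuous_on {a..b} f"
  shows "\<exists>C. \<forall>x\<in>{a..b}. norm (f x) \<le> C"
  using compact_imp_bounded[OF compact_continuous_image[OF assms compact_Icc]]
  by (auto simp: bounded_iff)

lemma L2_continuous:
  fixes f :: "real \<Rightarrow> 'b::euclidean_space"
  assumes "continuous_on {0..1} f"
  shows "L2 f"
proof -
  have "f absolutely_integrable_on {0..1}"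
    using assms absolutely_integrable_continuous[of 0 1 f] by (simp add: cbox_interval)
  then have m: "set_borel_measurable lebesgue {0..1} f"
    by (auto simp: set_integrable_def set_borel_measurable_def)
  obtain C where "\<And>x. x \<in> {0..1} \<Longrightarrow> norm (f x) \<le> C"
    using bounded_on_Icc[OF assms] by blast
  moreover have "L2 (\<lambda>x::real. 1::real)"
    using borel_measurable_indicator[of "{0..1::real}" lebesgue]
    by (auto simp: L2_def set_borel_measurable_def set_integrable_def)
  ultimately show ?thesis
    using m L2_bound[of "\<lambda>_. 1::real" f C] by simp
qed

lemma L2_add:
  fixes f g :: "real \<Rightarrow> 'b::euclidean_space"
  assumes "L2 f" "L2 g"
  shows "L2 (\<lambda>x. f x + g x)"
proof -
  have mf: "(\<lambda>x. indicator {0..1} x *\<^sub>R f x) \<in> borel_measurable lebesgue"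
    and mg: "(\<lambda>x. indicator {0..1} x *\<^sub>R g x) \<in> borel_measurable lebesgue"
    using assms by (auto simp: L2_def set_borel_measurable_def)
  have m: "set_borel_measurable lebesgue {0..1} (\<lambda>x. norm (f x) + norm (g x))"
    "set_borel_measurable lebesgue {0..1} (\<lambda>x. f x + g x)"
  proof -
    have "(\<lambda>x. norm (indicator {0..1} x *\<^sub>R f x) + norm (indicator {0..1} x *\<^sub>R g x))
        \<in> borel_measurable lebesgue"
      using mf mg by measurable
    then show "set_borel_measurable lebesgue {0..1} (\<lambda>x. norm (f x) + norm (g x))"
      by (simp add: set_borel_measurable_def algebra_simps)
    show "set_borel_measurable lebesgue {0..1} (\<lambda>x. f x + g x)"
      using borel_measurable_add[OF mf mg] by (simp add: set_borel_measurable_def algebra_simps)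
  qed
  have "set_integrable lebesgue {0..1} (\<lambda>x. 2 * (norm (f x))\<^sup>2 + 2 * (norm (g x))\<^sup>2)"
    using assms by (intro set_integral_add) (auto simp: L2_def)
  then have "set_integrable lebesgue {0..1} (\<lambda>x. (norm (norm (f x) + norm (g x)))\<^sup>2)"
    unfolding set_integrable_def
  proof (rule Bochner_Integration.integrable_bound)
    have "(\<lambda>x. (indicator {0..1} x *\<^sub>R (norm (f x) + norm (g x)))\<^sup>2) \<in> borel_measurable lebesgue"
      using m(1) unfolding set_borel_measurable_def by measurable
    also have "(\<lambda>x. (indicator {0..1} x *\<^sub>R (norm (f x) + norm (g x)))\<^sup>2)
       = (\<lambda>x. indicator {0..1} x *\<^sub>R (norm (norm (f x) + norm (g x)))\<^sup>2)"
      by (auto simp: indicator_def fun_eq_iff)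
    finally show "(\<lambda>x. indicator {0..1} x *\<^sub>R (norm (norm (f x) + norm (g x)))\<^sup>2)
       \<in> borel_measurable lebesgue" .
    have "(s + t)\<^sup>2 \<le> 2 * s\<^sup>2 + 2 * t\<^sup>2" for s t :: real
      using zero_le_power2[of "s - t"] by (simp add: power2_eq_square algebra_simps)
    then show "AE x in lebesgue. norm (indicator {0..1} x *\<^sub>R (norm (norm (f x) + norm (g x)))\<^sup>2)
        \<le> norm (indicator {0..1} x *\<^sub>R (2 * (norm (f x))\<^sup>2 + 2 * (norm (g x))\<^sup>2))"
      by (intro AE_I2) (auto simp: indicator_def)
  qed
  then have "L2 (\<lambda>x. norm (f x) + norm (g x))"
    using m by (simp add: L2_def)
  from L2_bound[OF this m(2), of 1] show ?thesis
    by (simp add: norm_triangle_ineq)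
qed

text \<open>This lemma and the next serve the two terms of the product rule: the continuous factor
  is the scalar here and the vector there.\<close>

lemma L2_bounded_scaleR:
  fixes g :: "real \<Rightarrow> 'b::euclidean_space" and f :: "real \<Rightarrow> real"
  assumes "L2 g" "continuous_on {0..1} f"
  shows "L2 (\<lambda>x. f x *\<^sub>R g x)"
proof -
  obtain C where C: "\<And>x. x \<in> {0..1} \<Longrightarrow> norm (f x) \<le> C"
    using bounded_on_Icc[OF assms(2)] by blast
  have "(\<lambda>x. indicator {0..1} x *\<^sub>R f x) \<in> borel_measurable lebesgue"
    "(\<lambda>x. indicator {0..1} x *\<^sub>R g x) \<in> borel_measurable lebesgue"
    using assms(1) L2_continuous[OF assms(2)] by (auto simp: L2_def set_borel_measurable_def)
  then have "(\<lambda>x. (indicator {0..1} x *\<^sub>R f x) *\<^sub>R (indicator {0..1} x *\<^sub>R g x)) \<in> borel_measurable lebesgue"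
    by measurable
  also have "(\<lambda>x. (indicator {0..1} x *\<^sub>R f x) *\<^sub>R (indicator {0..1} x *\<^sub>R g x))
     = (\<lambda>x. indicator {0..1} x *\<^sub>R (f x *\<^sub>R g x))"
    by (auto simp: indicator_def fun_eq_iff)
  finally show ?thesis
    using C by (intro L2_bound[OF assms(1), of _ C])
      (auto simp: set_borel_measurable_def intro!: mult_right_mono)
qed

lemma L2_scaleR_bounded:
  fixes g :: "real \<Rightarrow> 'b::euclidean_space" and f :: "real \<Rightarrow> real"
  assumes "L2 f" "continuous_on {0..1} g"
  shows "L2 (\<lambda>x. f x *\<^sub>R g x)"
proof -
  obtain C where C: "\<And>x. x \<in> {0..1} \<Longrightarrow> norm (g x) \<le> C"
    using bounded_on_Icc[OF assms(2)] by blast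
  have "(\<lambda>x. indicator {0..1} x *\<^sub>R f x) \<in> borel_measurable lebesgue"
    "(\<lambda>x. indicator {0..1} x *\<^sub>R g x) \<in> borel_measurable lebesgue"
    using assms(1) L2_continuous[OF assms(2)] by (auto simp: L2_def set_borel_measurable_def)
  then have "(\<lambda>x. (indicator {0..1} x *\<^sub>R f x) *\<^sub>R (indicator {0..1} x *\<^sub>R g x)) \<in> borel_measurable lebesgue"
    by measurable
  also have "(\<lambda>x. (indicator {0..1} x *\<^sub>R f x) *\<^sub>R (indicator {0..1} x *\<^sub>R g x))
     = (\<lambda>x. indicator {0..1} x *\<^sub>R (f x *\<^sub>R g x))"
    by (auto simp: indicator_def fun_eq_iff)
  finally show ?thesis
    using C by (intro L2_bound[OF assms(1), of _ C])
      (auto simp: set_borel_measurable_def mult.commute[of C] intro!: mult_left_mono)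
qed

lemma L2_cmult:
  fixes f :: "real \<Rightarrow> complex"
  assumes "L2 f"
  shows "L2 (\<lambda>x. k * f x)"
proof (rule L2_bound[OF assms, of _ "norm k"])
  have "(\<lambda>x. indicator {0..1} x *\<^sub>R f x) \<in> borel_measurable lebesgue"
    using assms by (auto simp: L2_def set_borel_measurable_def)
  then have "(\<lambda>x. k * (indicator {0..1} x *\<^sub>R f x)) \<in> borel_measurable lebesgue"
    by measurable
  then show "set_borel_measurable lebesgue {0..1} (\<lambda>x. k * f x)"
    by (simp add: set_borel_measurable_def)
qed (simp add: norm_mult)

lemma L2_integrable_on:
  fixes f :: "real \<Rightarrow> 'b::euclidean_space"
  assumes "L2 f" and "0 \<le> x" "y \<le> 1"
  shows "f integrable_on {x..y}"
proof -
  have "f integrable_on {0..1}"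
    using L2_absolutely_integrable[OF assms(1)] by (rule set_lebesgue_integral_eq_integral(1))
  then show ?thesis
    by (rule integrable_on_subinterval) (use assms in auto)
qed

lemma H1_deriv_L2: "H1_deriv f g \<Longrightarrow> L2 g"
  and H1_deriv_eq: "H1_deriv f g \<Longrightarrow> x \<in> {0..1} \<Longrightarrow> f x = f 0 + integral {0..x} g"
  unfolding H1_deriv_def by blast+

lemma H1_deriv_continuous:
  fixes f g :: "real \<Rightarrow> 'b::euclidean_space"
  assumes "H1_deriv f g"
  shows "continuous_on {0..1} f"
proof -
  have "g integrable_on {0..1}"
    using L2_integrable_on[OF H1_deriv_L2[OF assms]] by simp
  then have "continuous_on {0..1} (\<lambda>x. f 0 + integral {0..x} g)"
    by (intro continuous_intros indefinite_integral_continuous_1)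
  then show ?thesis
    by (rule continuous_on_eq) (rule H1_deriv_eq[OF assms, symmetric])
qed

lemma H1_deriv_add:
  fixes f g f' g' :: "real \<Rightarrow> 'b::euclidean_space"
  assumes "H1_deriv f g" "H1_deriv f' g'"
  shows "H1_deriv (\<lambda>x. f x + f' x) (\<lambda>x. g x + g' x)"
proof -
  have i: "g integrable_on {0..x}" "g' integrable_on {0..x}" if "x \<in> {0..1}" for x
    using assms[THEN H1_deriv_L2] that by (auto intro: L2_integrable_on)
  show ?thesis
    unfolding H1_deriv_def
  proof (intro conjI ballI L2_add)
    fix x :: real assume x: "x \<in> {0..1}"
    have "f x = f 0 + integral {0..x} g" "f' x = f' 0 + integral {0..x} g'"
      using assms[THEN H1_deriv_eq] x by blast+
    then show "f x + f' x = f 0 + f' 0 + integral {0..x} (\<lambda>x. g x + g' x)"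
      by (simp add: Henstock_Kurzweil_Integration.integral_add[OF i[OF x]])
  qed (use assms[THEN H1_deriv_L2] in auto)
qed

lemma H1_deriv_cmult:
  fixes f :: "real \<Rightarrow> complex"
  assumes "H1_deriv f g"
  shows "H1_deriv (\<lambda>x. k * f x) (\<lambda>x. k * g x)"
  unfolding H1_deriv_def
proof (intro conjI ballI)
  show "L2 (\<lambda>x. k * g x)"
    by (rule L2_cmult[OF H1_deriv_L2[OF assms]])
  fix x :: real assume "x \<in> {0..1}"
  from H1_deriv_eq[OF assms this]
  have "k * f x = k * (f 0 + integral {0..x} g)"
    by metis
  then show "k * f x = k * f 0 + integral {0..x} (\<lambda>x. k * g x)"
    by (simp add: algebra_simps)
qed

lemma H1_deriv_of_C1:
  fixes f g :: "real \<Rightarrow> 'b::euclidean_space"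
  assumes d: "\<And>x. x \<in> {0..1} \<Longrightarrow> (f has_vector_derivative g x) (at x within {0..1})"
    and c: "continuous_on {0..1} g"
  shows "H1_deriv f g"
  unfolding H1_deriv_def
proof (intro conjI ballI L2_continuous[OF c])
  fix x :: real assume x: "x \<in> {0..1}"
  have "(g has_integral (f x - f 0)) {0..x}"
    using x by (intro fundamental_theorem_of_calculus)
      (auto intro: has_vector_derivative_within_subset[OF d])
  then show "f x = f 0 + integral {0..x} g"
    by (simp add: integral_unique)
qed

text \<open>A continuous representative of the weak derivative makes the integral identity
  classically differentiable. This is the passage from the unbounded operator to an ordinary
  differential equation.\<close>

lemma H1_deriv_imp_C1:
  fixes f g :: "real \<Rightarrow> 'b::euclidean_space"
  assumes "H1_deriv f g" and c: "continuous_on {0..1} g" and x: "x \<in> {0..1}"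
  shows "(f has_vector_derivative g x) (at x within {0..1})"
proof -
  have "((\<lambda>x. f 0 + integral {0..x} g) has_vector_derivative 0 + g x) (at x within {0..1})"
    by (rule has_vector_derivative_add[OF has_vector_derivative_const
          integral_has_vector_derivative[OF c x]])
  then have "((\<lambda>x. f 0 + integral {0..x} g) has_vector_derivative g x) (at x within {0..1})"
    by simp
  then show ?thesis
    by (rule has_vector_derivative_transform[OF x, rotated])
      (rule H1_deriv_eq[OF assms(1)])
qed

text \<open>
  Replaces almost-everywhere differentiation in the product and chain rules: the local
  estimates are additive over intervals and are summed up by interval induction.
\<close>

lemma eq_indefinite_integral_if_local:
  fixes F G :: "real \<Rightarrow> 'b::banach" and k :: "real \<Rightarrow> real"
  assumes G: "G integrable_on {0..1}" and k: "k integrable_on {0..1}"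
    and loc: "\<And>x \<epsilon>. x \<in> {0..1} \<Longrightarrow> \<epsilon> > 0 \<Longrightarrow> \<exists>r>0. \<forall>y z. 0 \<le> y \<and> y \<le> x \<and> x \<le> z \<and> z \<le> 1 \<and> z - y < r
      \<longrightarrow> norm (F z - F y - integral {y..z} G) \<le> \<epsilon> * integral {y..z} k"
    and t: "t \<in> {0..1}"
  shows "F t = F 0 + integral {0..t} G"
proof -
  have bound: "norm (F t - F 0 - integral {0..t} G) \<le> \<epsilon> * integral {0..t} k" if e: "\<epsilon> > 0" for \<epsilon>
  proof -
    define P where "P y z \<longleftrightarrow> (0 \<le> y \<and> z \<le> 1 \<longrightarrow>
      norm (F z - F y - integral {y..z} G) \<le> \<epsilon> * integral {y..z} k)" for y z
    from t have "0 \<le> t" by simp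
    then have "P 0 t"
    proof (induction rule: Bolzano)
      case (trans u v w)
      show ?case unfolding P_def
      proof
        assume b: "0 \<le> u \<and> w \<le> 1"
        have Gi: "G integrable_on {u..w}" and ki: "k integrable_on {u..w}"
          using b by (auto intro: integrable_on_subinterval[OF G] integrable_on_subinterval[OF k])
        have G2: "integral {u..w} G = integral {u..v} G + integral {v..w} G"
          using trans by (intro Henstock_Kurzweil_Integration.integral_combine[symmetric] Gi) auto
        have k2: "integral {u..w} k = integral {u..v} k + integral {v..w} k"
          using trans by (intro Henstock_Kurzweil_Integration.integral_combine[symmetric] ki) auto
        have 1: "norm (F v - F u - integral {u..v} G) \<le> \<epsilon> * integral {u..v} k"
          and 2: "norm (F w - F v - integral {v..w} G) \<le> \<epsilon> * integral {v..w} k"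
          using trans b by (auto simp: P_def)
        have "F w - F u - integral {u..w} G
          = (F v - F u - integral {u..v} G) + (F w - F v - integral {v..w} G)"
          by (simp add: G2)
        then have "norm (F w - F u - integral {u..w} G)
          \<le> norm (F v - F u - integral {u..v} G) + norm (F w - F v - integral {v..w} G)"
          by (metis norm_triangle_ineq)
        then show "norm (F w - F u - integral {u..w} G) \<le> \<epsilon> * integral {u..w} k"
          using 1 2 by (simp add: k2 algebra_simps)
      qed
    next
      case (local x)
      then have "x \<in> {0..1}" using t by auto
      from loc[OF this e] show ?case unfolding P_def by blast
    qed
    then show ?thesis using t by (simp add: P_def)
  qed
  \<comment> \<open>\<open>I\<close> dominates the integral of \<open>k\<close>, and the summand 1
    keeps it positive, so that e / I is an admissible \<epsilon>.\<close>
  define I where "I = \<bar>integral {0..t} k\<bar> + 1"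
  have I: "I > 0" by (simp add: I_def)
  have "norm (F t - F 0 - integral {0..t} G) \<le> 0"
  proof (rule field_le_epsilon)
    fix e :: real assume e: "e > 0"
    have "norm (F t - F 0 - integral {0..t} G) \<le> (e / I) * integral {0..t} k"
      using bound[of "e / I"] e I by simp
    also have "\<dots> \<le> (e / I) * I"
      using e I by (intro mult_left_mono) (auto simp: I_def)
    finally show "norm (F t - F 0 - integral {0..t} G) \<le> 0 + e"
      using I by simp
  qed
  then show ?thesis by (simp add: algebra_simps)
qed

section \<open>Product and chain rules for weak derivatives\<close>

lemma L2_norm_integrable_on:
  fixes f :: "real \<Rightarrow> 'b::euclidean_space"
  assumes "L2 f" and "0 \<le> x" "y \<le> 1"
  shows "(\<lambda>s. norm (f s)) integrable_on {x..y}"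
proof -
  have "(\<lambda>s. norm (f s)) integrable_on {0..1}"
    using L2_absolutely_integrable[OF assms(1)] by (auto simp: absolutely_integrable_on_def)
  then show ?thesis
    by (rule integrable_on_subinterval) (use assms in auto)
qed

lemma continuous_on_Icc_oscillation:
  fixes f :: "real \<Rightarrow> 'b::real_normed_vector"
  assumes "continuous_on {a..b} f" "x \<in> {a..b}" "\<epsilon> > 0"
  shows "\<exists>r>0. \<forall>u\<in>{a..b}. \<forall>v\<in>{a..b}. \<bar>u - x\<bar> < r \<longrightarrow> \<bar>v - x\<bar> < r \<longrightarrow> norm (f u - f v) \<le> \<epsilon>"
proof -
  have "\<epsilon> / 2 > 0" using assms by simp
  then obtain r where r: "r > 0" "\<And>u. u \<in> {a..b} \<Longrightarrow> dist u x < r \<Longrightarrow> dist (f u) (f x) < \<epsilon> / 2"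
    using assms unfolding continuous_on_iff by meson
  have "norm (f u - f v) \<le> \<epsilon>"
    if "u \<in> {a..b}" "v \<in> {a..b}" "\<bar>u - x\<bar> < r" "\<bar>v - x\<bar> < r" for u v
  proof -
    have "dist (f u) (f x) < \<epsilon> / 2" "dist (f v) (f x) < \<epsilon> / 2"
      using r(2) that by (auto simp: dist_real_def)
    then have "dist (f u) (f v) < \<epsilon>"
      by (metis dist_commute dist_triangle_half_r)
    then show ?thesis
      by (simp add: dist_norm)
  qed
  then show ?thesis using r(1) by blast
qed

lemma H1_deriv_diff:
  fixes f g :: "real \<Rightarrow> 'b::euclidean_space"
  assumes "H1_deriv f g" "0 \<le> y" "y \<le> z" "z \<le> 1"
  shows "f z - f y = integral {y..z} g"
proof -
  have "f z = f 0 + integral {0..z} g" "f y = f 0 + integral {0..y} g"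
    using assms H1_deriv_eq[OF assms(1)] by (meson atLeastAtMost_iff order_trans)+
  moreover have "integral {0..z} g = integral {0..y} g + integral {y..z} g"
    using assms by (intro Henstock_Kurzweil_Integration.integral_combine[symmetric]
        L2_integrable_on[OF H1_deriv_L2[OF assms(1)]]) auto
  ultimately show ?thesis by (simp add: algebra_simps)
qed

lemma H1_deriv_scaleR:
  fixes f g :: "real \<Rightarrow> real" and F G :: "real \<Rightarrow> 'b::euclidean_space"
  assumes f: "H1_deriv f g" and F: "H1_deriv F G"
  shows "H1_deriv (\<lambda>x. f x *\<^sub>R F x) (\<lambda>x. g x *\<^sub>R F x + f x *\<^sub>R G x)"
proof -
  note cf = H1_deriv_continuous[OF f] and cF = H1_deriv_continuous[OF F]
  note Lg = H1_deriv_L2[OF f] and LG = H1_deriv_L2[OF F]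
  have L: "L2 (\<lambda>x. g x *\<^sub>R F x)" "L2 (\<lambda>x. f x *\<^sub>R G x)"
    by (rule L2_scaleR_bounded[OF Lg cF], rule L2_bounded_scaleR[OF LG cf])
  have L2: "L2 (\<lambda>x. g x *\<^sub>R F x + f x *\<^sub>R G x)"
    by (rule L2_add[OF L])
  show ?thesis
    unfolding H1_deriv_def
  proof (intro conjI L2 ballI)
    fix t :: real assume t: "t \<in> {0..1}"
    show "f t *\<^sub>R F t = f 0 *\<^sub>R F 0 + integral {0..t} (\<lambda>x. g x *\<^sub>R F x + f x *\<^sub>R G x)"
    proof (rule eq_indefinite_integral_if_local[where k = "\<lambda>s. norm (g s) + norm (G s)", OF _ _ _ t])
      show "(\<lambda>x. g x *\<^sub>R F x + f x *\<^sub>R G x) integrable_on {0..1}"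
        using L2_integrable_on[OF L2] by simp
      show "(\<lambda>s. norm (g s) + norm (G s)) integrable_on {0..1}"
        using L2_norm_integrable_on[OF Lg] L2_norm_integrable_on[OF LG]
        by (intro integrable_add) auto
      fix x \<epsilon> :: real assume x: "x \<in> {0..1}" and e: "\<epsilon> > 0"
      obtain r1 where r1: "r1 > 0" "\<And>u v. u \<in> {0..1} \<Longrightarrow> v \<in> {0..1} \<Longrightarrow> \<bar>u - x\<bar> < r1 \<Longrightarrow>
          \<bar>v - x\<bar> < r1 \<Longrightarrow> norm (f u - f v) \<le> \<epsilon>"
        using continuous_on_Icc_oscillation[OF cf x e] by blast
      obtain r2 where r2: "r2 > 0" "\<And>u v. u \<in> {0..1} \<Longrightarrow> v \<in> {0..1} \<Longrightarrow> \<bar>u - x\<bar> < r2 \<Longrightarrow>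
          \<bar>v - x\<bar> < r2 \<Longrightarrow> norm (F u - F v) \<le> \<epsilon>"
        using continuous_on_Icc_oscillation[OF cF x e] by blast
      have "norm (f z *\<^sub>R F z - f y *\<^sub>R F y - integral {y..z} (\<lambda>x. g x *\<^sub>R F x + f x *\<^sub>R G x))
          \<le> \<epsilon> * integral {y..z} (\<lambda>s. norm (g s) + norm (G s))"
        if yz: "0 \<le> y" "y \<le> x" "x \<le> z" "z \<le> 1" "z - y < min r1 r2" for y z
      proof -
        have yz': "y \<le> z" using yz by simp
        have gi: "g integrable_on {y..z}" and Gi: "G integrable_on {y..z}"
          using yz L2_integrable_on[OF Lg] L2_integrable_on[OF LG] by auto
        have i: "(\<lambda>s. g s *\<^sub>R F z + f y *\<^sub>R G s) integrable_on {y..z}"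
          using gi Gi by (intro integrable_add integrable_on_scaleR_left integrable_cmul)
        have j: "(\<lambda>x. g x *\<^sub>R F x + f x *\<^sub>R G x) integrable_on {y..z}"
          using yz L2_integrable_on[OF L2] by simp
        \<comment> \<open>\<open>F\<close> is frozen at the right end point and \<open>f\<close> at
          the left one. The increments are then exact integrals of the weak derivatives, and the
          error against the true integrand is governed by the oscillation of \<open>f\<close> and
          \<open>F\<close> near x.\<close>
        have "f z *\<^sub>R F z - f y *\<^sub>R F y = (f z - f y) *\<^sub>R F z + f y *\<^sub>R (F z - F y)"
          by (simp add: algebra_simps)
        also have "\<dots> = integral {y..z} g *\<^sub>R F z + f y *\<^sub>R integral {y..z} G"
          using yz yz' by (simp add: H1_deriv_diff[OF f] H1_deriv_diff[OF F])
        also have "\<dots> = integral {y..z} (\<lambda>s. g s *\<^sub>R F z + f y *\<^sub>R G s)"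
          using gi Gi by (subst Henstock_Kurzweil_Integration.integral_add)
            (auto intro!: integrable_on_scaleR_left integrable_cmul
              integral_unique[OF has_integral_scaleR_left[OF integrable_integral], symmetric])
        finally have "f z *\<^sub>R F z - f y *\<^sub>R F y - integral {y..z} (\<lambda>x. g x *\<^sub>R F x + f x *\<^sub>R G x)
          = integral {y..z} (\<lambda>s. (g s *\<^sub>R F z + f y *\<^sub>R G s) - (g s *\<^sub>R F s + f s *\<^sub>R G s))"
          by (simp add: Henstock_Kurzweil_Integration.integral_diff[OF i j])
        moreover have "norm (integral {y..z} (\<lambda>s. (g s *\<^sub>R F z + f y *\<^sub>R G s) - (g s *\<^sub>R F s + f s *\<^sub>R G s)))
          \<le> integral {y..z} (\<lambda>s. \<epsilon> * (norm (g s) + norm (G s)))"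
        proof (rule integral_norm_bound_integral)
          show "(\<lambda>s. (g s *\<^sub>R F z + f y *\<^sub>R G s) - (g s *\<^sub>R F s + f s *\<^sub>R G s)) integrable_on {y..z}"
            by (rule integrable_diff[OF i j])
          show "(\<lambda>s. \<epsilon> * (norm (g s) + norm (G s))) integrable_on {y..z}"
            using L2_norm_integrable_on[OF Lg] L2_norm_integrable_on[OF LG] yz
            by (intro integrable_on_mult_right integrable_add) auto
          fix s assume s: "s \<in> {y..z}"
          have "norm (F z - F s) \<le> \<epsilon>" "norm (f y - f s) \<le> \<epsilon>"
            using s yz by (intro r1(2) r2(2); auto simp: abs_if)+
          then have "norm (g s *\<^sub>R (F z - F s)) \<le> norm (g s) * \<epsilon>"
            "norm ((f y - f s) *\<^sub>R G s) \<le> \<epsilon> * norm (G s)"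
            by (auto intro: mult_left_mono mult_right_mono)
          moreover have "(g s *\<^sub>R F z + f y *\<^sub>R G s) - (g s *\<^sub>R F s + f s *\<^sub>R G s)
            = g s *\<^sub>R (F z - F s) + (f y - f s) *\<^sub>R G s"
            by (simp add: algebra_simps)
          ultimately show "norm ((g s *\<^sub>R F z + f y *\<^sub>R G s) - (g s *\<^sub>R F s + f s *\<^sub>R G s))
            \<le> \<epsilon> * (norm (g s) + norm (G s))"
            using norm_triangle_ineq[of "g s *\<^sub>R (F z - F s)" "(f y - f s) *\<^sub>R G s"]
            by (simp add: algebra_simps)
        qed
        ultimately show ?thesis by simp
      qed
      then show "\<exists>r>0. \<forall>y z. 0 \<le> y \<and> y \<le> x \<and> x \<le> z \<and> z \<le> 1 \<and> z - y < r \<longrightarrow>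
        norm (f z *\<^sub>R F z - f y *\<^sub>R F y - integral {y..z} (\<lambda>x. g x *\<^sub>R F x + f x *\<^sub>R G x))
          \<le> \<epsilon> * integral {y..z} (\<lambda>s. norm (g s) + norm (G s))"
        using r1(1) r2(1) by (intro exI[of _ "min r1 r2"]) auto
    qed
  qed
qed

text \<open>Used for the inverse cube of \<open>a\<close> and for the square root of the radicand in
  \<open>laminar_a\<close>. Both have a continuous derivative on the positive half line, which is
  where \<open>h\<close> takes its values.\<close>

lemma H1_deriv_compose_C1:
  fixes h g \<Phi> \<Phi>' :: "real \<Rightarrow> real"
  assumes h: "H1_deriv h g" and pos: "\<And>x. x \<in> {0..1} \<Longrightarrow> h x > 0"
    and d: "\<And>u. u > 0 \<Longrightarrow> (\<Phi> has_real_derivative \<Phi>' u) (at u)"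
    and c: "continuous_on {0<..} \<Phi>'"
  shows "H1_deriv (\<lambda>x. \<Phi> (h x)) (\<lambda>x. \<Phi>' (h x) *\<^sub>R g x)"
proof -
  note ch = H1_deriv_continuous[OF h] and Lg = H1_deriv_L2[OF h]
  have c': "continuous_on {0..1} (\<lambda>x. \<Phi>' (h x))"
    by (rule continuous_on_compose2[OF c ch]) (use pos in auto)
  have L2: "L2 (\<lambda>x. \<Phi>' (h x) *\<^sub>R g x)"
    by (rule L2_bounded_scaleR[OF Lg c'])
  show ?thesis
    unfolding H1_deriv_def
  proof (intro conjI L2 ballI)
    fix t :: real assume t: "t \<in> {0..1}"
    show "\<Phi> (h t) = \<Phi> (h 0) + integral {0..t} (\<lambda>x. \<Phi>' (h x) *\<^sub>R g x)"
    proof (rule eq_indefinite_integral_if_local[where k = "\<lambda>s. norm (g s)", OF _ _ _ t])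
      show "(\<lambda>x. \<Phi>' (h x) *\<^sub>R g x) integrable_on {0..1}"
        using L2_integrable_on[OF L2] by simp
      show "(\<lambda>s. norm (g s)) integrable_on {0..1}"
        using L2_norm_integrable_on[OF Lg] by simp
      fix x \<epsilon> :: real assume x: "x \<in> {0..1}" and e: "\<epsilon> > 0"
      have "isCont \<Phi>' (h x)"
        using c pos[OF x] by (simp add: continuous_on_eq_continuous_at)
      moreover have "\<epsilon> / 2 > 0" using e by simp
      ultimately obtain r0 where r0: "r0 > 0" "\<And>u. \<bar>u - h x\<bar> < r0 \<Longrightarrow> \<bar>\<Phi>' u - \<Phi>' (h x)\<bar> < \<epsilon> / 2"
        unfolding continuous_at_eps_delta dist_real_def by meson
      have "min (r0 / 2) (h x / 2) > 0" using r0 pos[OF x] by simp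
      from continuous_on_Icc_oscillation[OF ch x this]
      obtain r where r: "r > 0" "\<And>u v. u \<in> {0..1} \<Longrightarrow> v \<in> {0..1} \<Longrightarrow> \<bar>u - x\<bar> < r \<Longrightarrow>
          \<bar>v - x\<bar> < r \<Longrightarrow> norm (h u - h v) \<le> min (r0 / 2) (h x / 2)"
        by blast
      have near: "\<bar>h u - h x\<bar> < r0" if "u \<in> {0..1}" "\<bar>u - x\<bar> < r" for u
        using r(2)[OF that(1) x that(2)] r(1) r0(1) by simp
      have "norm (\<Phi> (h z) - \<Phi> (h y) - integral {y..z} (\<lambda>x. \<Phi>' (h x) *\<^sub>R g x))
          \<le> \<epsilon> * integral {y..z} (\<lambda>s. norm (g s))"
        if yz: "0 \<le> y" "y \<le> x" "x \<le> z" "z \<le> 1" "z - y < r" for y z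
      proof -
        have yz': "y \<le> z" using yz by simp
        have gi: "g integrable_on {y..z}"
          using yz L2_integrable_on[OF Lg] by auto
        have j: "(\<lambda>x. \<Phi>' (h x) *\<^sub>R g x) integrable_on {y..z}"
          using yz L2_integrable_on[OF L2] by simp
        have nz: "\<bar>h z - h x\<bar> < r0" and ny: "\<bar>h y - h x\<bar> < r0"
          using yz by (intro near; auto simp: abs_if)+
        \<comment> \<open>The mean value theorem makes the increment of \<Phi> the exact integral of
          the constant \<Phi>' \<xi> times \<open>g\<close>. Since \<xi> lies between
          \<open>h y\<close> and \<open>h z\<close>, it stays where \<Phi>' varies little. If these
          values coincide, any \<xi> close to \<open>h x\<close> serves.\<close>
        have "\<exists>\<xi>. \<bar>\<xi> - h x\<bar> < r0 \<and> \<Phi> (h z) - \<Phi> (h y) = \<Phi>' \<xi> * (h z - h y)"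
        proof (cases "h z" "h y" rule: linorder_cases)
          case less
          have "0 < w" if "h z \<le> w" for w
            using that pos[of z] yz by simp
          then have "\<exists>w>h z. w < h y \<and> \<Phi> (h y) - \<Phi> (h z) = (h y - h z) * \<Phi>' w"
            using less d by (intro MVT2) auto
          then obtain \<xi> where "h z < \<xi>" "\<xi> < h y" "\<Phi> (h y) - \<Phi> (h z) = (h y - h z) * \<Phi>' \<xi>"
            by blast
          then show ?thesis using nz ny by (intro exI[of _ \<xi>]) (auto simp: algebra_simps abs_if split: if_splits)
        next
          case equal
          then show ?thesis using nz by auto
        next
          case greater
          have "0 < w" if "h y \<le> w" for w
            using that pos[of y] yz by simp
          then have "\<exists>w>h y. w < h z \<and> \<Phi> (h z) - \<Phi> (h y) = (h z - h y) * \<Phi>' w"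
            using greater d by (intro MVT2) auto
          then obtain \<xi> where "h y < \<xi>" "\<xi> < h z" "\<Phi> (h z) - \<Phi> (h y) = (h z - h y) * \<Phi>' \<xi>"
            by blast
          then show ?thesis using nz ny by (intro exI[of _ \<xi>]) (auto simp: algebra_simps abs_if split: if_splits)
        qed
        then obtain \<xi> where xi: "\<bar>\<xi> - h x\<bar> < r0" "\<Phi> (h z) - \<Phi> (h y) = \<Phi>' \<xi> * (h z - h y)"
          by blast
        have i: "(\<lambda>s. \<Phi>' \<xi> * g s) integrable_on {y..z}"
          using gi by (rule integrable_on_mult_right)
        have "\<Phi> (h z) - \<Phi> (h y) - integral {y..z} (\<lambda>x. \<Phi>' (h x) *\<^sub>R g x)
          = integral {y..z} (\<lambda>s. \<Phi>' \<xi> * g s - \<Phi>' (h s) *\<^sub>R g s)"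
          using yz yz' by (subst Henstock_Kurzweil_Integration.integral_diff[OF i j])
            (simp add: xi(2) H1_deriv_diff[OF h])
        moreover have "norm (integral {y..z} (\<lambda>s. \<Phi>' \<xi> * g s - \<Phi>' (h s) *\<^sub>R g s))
          \<le> integral {y..z} (\<lambda>s. \<epsilon> * norm (g s))"
        proof (rule integral_norm_bound_integral)
          show "(\<lambda>s. \<Phi>' \<xi> * g s - \<Phi>' (h s) *\<^sub>R g s) integrable_on {y..z}"
            by (rule integrable_diff[OF i j])
          show "(\<lambda>s. \<epsilon> * norm (g s)) integrable_on {y..z}"
            using L2_norm_integrable_on[OF Lg] yz by (intro integrable_on_mult_right) auto
          fix s assume s: "s \<in> {y..z}"
          have "\<bar>h s - h x\<bar> < r0"
            using yz s by (intro near; auto simp: abs_if)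
          then have "\<bar>\<Phi>' \<xi> - \<Phi>' (h s)\<bar> \<le> \<epsilon>"
            using r0(2)[of "h s"] r0(2)[OF xi(1)] by linarith
          then have "\<bar>\<Phi>' \<xi> - \<Phi>' (h s)\<bar> * \<bar>g s\<bar> \<le> \<epsilon> * \<bar>g s\<bar>"
            by (rule mult_right_mono) simp
          then show "norm (\<Phi>' \<xi> * g s - \<Phi>' (h s) *\<^sub>R g s) \<le> \<epsilon> * norm (g s)"
            by (simp add: abs_mult[symmetric] algebra_simps)
        qed
        ultimately show ?thesis by simp
      qed
      then show "\<exists>r>0. \<forall>y z. 0 \<le> y \<and> y \<le> x \<and> x \<le> z \<and> z \<le> 1 \<and> z - y < r \<longrightarrow>
        norm (\<Phi> (h z) - \<Phi> (h y) - integral {y..z} (\<lambda>x. \<Phi>' (h x) *\<^sub>R g x))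
          \<le> \<epsilon> * integral {y..z} (\<lambda>s. norm (g s))"
        using r(1) by (intro exI[of _ r]) auto
    qed
  qed
qed

section \<open>Congruence and closure properties of the Sobolev classes\<close>

lemma L2_cong:
  fixes f g :: "real \<Rightarrow> 'b::euclidean_space"
  assumes "\<And>x. x \<in> {0..1} \<Longrightarrow> f x = g x"
  shows "L2 f \<longleftrightarrow> L2 g"
proof -
  have "(\<lambda>x. indicator {0..1} x *\<^sub>R f x) = (\<lambda>x. indicator {0..1} x *\<^sub>R g x)"
    "(\<lambda>x. indicator {0..1} x *\<^sub>R (norm (f x))\<^sup>2) = (\<lambda>x. indicator {0..1} x *\<^sub>R (norm (g x))\<^sup>2)"
    using assms by (auto simp: indicator_def fun_eq_iff)
  then show ?thesis
    by (simp add: L2_def set_borel_measurable_def set_integrable_def)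
qed

lemma H1_deriv_cong:
  fixes f f' g g' :: "real \<Rightarrow> 'b::euclidean_space"
  assumes "\<And>x. x \<in> {0..1} \<Longrightarrow> f x = f' x" "\<And>x. x \<in> {0..1} \<Longrightarrow> g x = g' x"
  shows "H1_deriv f g \<longleftrightarrow> H1_deriv f' g'"
proof -
  have "integral {0..x} g = integral {0..x} g'" if "x \<in> {0..1}" for x
    using that by (intro Henstock_Kurzweil_Integration.integral_cong assms(2)) auto
  moreover have "f 0 = f' 0" by (rule assms(1)) simp
  ultimately show ?thesis
    unfolding H1_deriv_def using L2_cong[of g g'] assms by metis
qed

lemma H1_cong:
  fixes f g :: "real \<Rightarrow> 'b::euclidean_space"
  assumes "\<And>x. x \<in> {0..1} \<Longrightarrow> f x = g x"
  shows "H1 f \<longleftrightarrow> H1 g"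
  unfolding H1_def by (rule ex_cong1) (rule H1_deriv_cong[OF assms refl])

lemma H1_continuous:
  fixes f :: "real \<Rightarrow> 'b::euclidean_space"
  shows "H1 f \<Longrightarrow> continuous_on {0..1} f"
  using H1_deriv_continuous by (auto simp: H1_def)

lemma H1_add: "H1 f \<Longrightarrow> H1 g \<Longrightarrow> H1 (\<lambda>x. f x + g x)"
  for f g :: "real \<Rightarrow> 'b::euclidean_space"
  unfolding H1_def using H1_deriv_add by blast

lemma H1_cmult: "H1 f \<Longrightarrow> H1 (\<lambda>x. k * f x)"
  for f :: "real \<Rightarrow> complex"
  unfolding H1_def using H1_deriv_cmult by blast

lemma H1_scaleR: "H1 f \<Longrightarrow> H1 g \<Longrightarrow> H1 (\<lambda>x. f x *\<^sub>R g x)"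
  for f :: "real \<Rightarrow> real" and g :: "real \<Rightarrow> 'b::euclidean_space"
  unfolding H1_def using H1_deriv_scaleR by blast

lemma H1_deriv_zero: "H1_deriv (\<lambda>_. 0) (\<lambda>_. 0 :: 'b::euclidean_space)"
  by (rule H1_deriv_of_C1) auto

lemma H1_zero: "H1 (\<lambda>_. 0 :: 'b::euclidean_space)"
  unfolding H1_def using H1_deriv_zero by blast

lemma H2_zero: "H2 (\<lambda>_. 0 :: 'b::euclidean_space)"
  unfolding H2_def using H1_deriv_zero H1_zero by blast

lemma H2_add_cmult:
  fixes f g :: "real \<Rightarrow> complex"
  assumes "H2 f" "H2 g"
  shows "H2 (\<lambda>x. f x + k * g x)"
proof -
  obtain f' g' where "H1_deriv f f'" "H1 f'" "H1_deriv g g'" "H1 g'"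
    using assms by (auto simp: H2_def)
  then have "H1_deriv (\<lambda>x. f x + k * g x) (\<lambda>x. f' x + k * g' x)" "H1 (\<lambda>x. f' x + k * g' x)"
    by (auto intro!: H1_deriv_add H1_deriv_cmult H1_add H1_cmult)
  then show ?thesis unfolding H2_def by blast
qed

lemma H2_imp_H1: "H2 f \<Longrightarrow> H1 f"
  by (auto simp: H1_def H2_def)

lemma vector_derivative_unique_Icc:
  fixes f :: "real \<Rightarrow> 'b::real_normed_vector"
  assumes "a < b" "z \<in> {a..b}"
    and "(f has_vector_derivative f') (at z within {a..b})" "(f has_vector_derivative f'') (at z within {a..b})"
  shows "f' = f''"
  using vector_derivative_unique_within_closed_interval[of a b z f f' f''] assms by simp

lemma real_axis_derivative:
  assumes "(f has_field_derivative f') (at (of_real t))"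
  shows "((\<lambda>s. Re (f (of_real s))) has_real_derivative Re f') (at t)"
    and "((\<lambda>s. Im (f (of_real s))) has_real_derivative Im f') (at t)"
proof -
  have "((\<lambda>s. f (of_real s)) has_vector_derivative f') (at t)"
    by (rule has_vector_derivative_real_field[OF assms])
  then show "((\<lambda>s. Re (f (of_real s))) has_real_derivative Re f') (at t)"
    "((\<lambda>s. Im (f (of_real s))) has_real_derivative Im f') (at t)"
    using bounded_linear.has_vector_derivative[OF bounded_linear_Re]
      bounded_linear.has_vector_derivative[OF bounded_linear_Im]
    by (auto simp: has_real_derivative_iff_has_vector_derivative)
qed

text \<open>All complex derivatives exist and restrict to the real derivatives of the restriction,
  so every order of smoothness is obtained at once.\<close>

lemma smooth_on_open_Re_holomorphic:
  assumes f: "f holomorphic_on ball 0 r"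
  shows "smooth_on_open {-r<..<r} (\<lambda>t. Re (f (of_real t)))"
proof -
  let ?g = "\<lambda>t. Re (f (of_real t))"
  have d: "((\<lambda>s. Re ((deriv ^^ n) f (of_real s))) has_real_derivative Re ((deriv ^^ Suc n) f (of_real t))) (at t)"
    if "t \<in> {-r<..<r}" for n t
  proof -
    have "complex_of_real t \<in> ball 0 r" using that by (auto simp: abs_if)
    then have "((deriv ^^ n) f has_field_derivative (deriv ^^ Suc n) f (of_real t)) (at (of_real t))"
      using holomorphic_derivI[OF holomorphic_higher_deriv[OF f open_ball, of n] open_ball, of "of_real t"]
      by simp
    then show ?thesis by (rule real_axis_derivative(1))
  qed
  have eq: "(deriv ^^ n) ?g t = Re ((deriv ^^ n) f (of_real t))" if "t \<in> {-r<..<r}" for n t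
    using that
  proof (induction n arbitrary: t)
    case (Suc n)
    have "\<forall>\<^sub>F s in nhds t. (deriv ^^ n) ?g s = Re ((deriv ^^ n) f (of_real s))"
      using eventually_nhds_in_open[OF open_greaterThanLessThan Suc.prems] Suc.IH
      by (auto elim!: eventually_mono)
    then have "deriv ((deriv ^^ n) ?g) t = deriv (\<lambda>s. Re ((deriv ^^ n) f (of_real s))) t"
      by (intro deriv_cong_ev) auto
    also have "\<dots> = Re ((deriv ^^ Suc n) f (of_real t))"
      by (rule DERIV_imp_deriv[OF d[OF Suc.prems]])
    finally show ?case by simp
  qed simp
  have "(deriv ^^ n) ?g differentiable (at t)" if t: "t \<in> {-r<..<r}" for n t
  proof -
    have "((deriv ^^ n) ?g has_real_derivative Re ((deriv ^^ Suc n) f (of_real t))) (at t)"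
      by (rule has_field_derivative_transform_within_open[OF d[OF t] open_greaterThanLessThan t])
        (rule eq[symmetric])
    then show ?thesis
      using real_differentiable_def by blast
  qed
  then show ?thesis
    by (simp add: smooth_on_open_def)
qed

lemma integral_pos_if_continuous:
  fixes f :: "real \<Rightarrow> real"
  assumes c: "continuous_on {u..v} f" and n: "\<And>x. x \<in> {u..v} \<Longrightarrow> f x \<ge> 0"
    and w: "w \<in> {u..v}" "f w > 0" and "u < v"
  shows "integral {u..v} f > 0"
proof -
  have "integral {u..v} f \<ge> 0"
    by (intro Henstock_Kurzweil_Integration.integral_nonneg integrable_continuous_interval c n)
  moreover have "integral {u..v} f \<noteq> 0"
    using integral_eq_0_iff[OF c \<open>u < v\<close>] n w by (metis less_irrefl)
  ultimately show ?thesis by simp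
qed

section \<open>Jordan chains\<close>

interpretation st: vector_space state_scale
  by (rule vector_space_state_scale)

text \<open>The third component of \<open>F\<close> measures how far a pair is from lying in the
  graph. The span of \<open>e 0\<close>, ..., \<open>e m\<close> is mapped into itself, and a
  generalized kernel cannot leave it, because the next link would carry a nonzero multiple of
  \<delta>. The hypothesis \<open>inj0\<close> says that \<open>F\<close> is single-valued among
  images in \<open>V\<close>; without the restriction to \<open>V\<close> this would fail for images
  that are fixed only up to null sets.\<close>

lemma dim_gen_kernel_chain:
  fixes F :: "(state \<times> state \<times> complex) set" and e :: "nat \<Rightarrow> state"
  assumes lin: "\<And>x y r x' y' r' k. (x, y, r) \<in> F \<Longrightarrow> (x', y', r') \<in> F \<Longrightarrow>
      (x + state_scale k x', y + state_scale k y', r + k * r') \<in> F"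
    and V: "st.subspace V" and inj0: "\<And>y r. (0, y, r) \<in> F \<Longrightarrow> y \<in> V \<Longrightarrow> y = 0 \<and> r = 0"
    and eV: "\<And>j. j \<le> m \<Longrightarrow> e j \<in> V" and e0: "e 0 \<noteq> 0"
    and chain_0: "(e 0, state_scale \<kappa> (e 0), 0) \<in> F"
    and chain_Suc: "\<And>j. j < m \<Longrightarrow> (e (Suc j), state_scale \<kappa> (e (Suc j)) + e j, 0) \<in> F"
    and chain_last: "(e (Suc m), state_scale \<kappa> (e (Suc m)) + e m, \<delta>) \<in> F" and \<delta>: "\<delta> \<noteq> 0"
    and ker: "\<And>z r. (z, state_scale \<kappa> z, r) \<in> F \<Longrightarrow> \<exists>c. z = state_scale c (e 0)"
  shows "st.dim (\<Union>n. gen_kernel {(x, y). (x, y, 0) \<in> F} \<kappa> n) = Suc m"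
proof -
  define W where "W j = st.span (e ` {..<j})" for j
  have W_Suc: "x \<in> W (Suc j) \<longleftrightarrow> (\<exists>c. x - state_scale c (e j) \<in> W j)" for x j
    unfolding W_def lessThan_Suc image_insert by (rule st.span_breakdown_eq)
  have W_sub: "st.subspace (W j)" for j
    by (simp add: W_def)
  have W_mono: "W i \<subseteq> W j" if "i \<le> j" for i j
    unfolding W_def using that by (intro st.span_mono) auto
  have e_W: "e i \<in> W j" if "i < j" for i j
    unfolding W_def using that by (intro st.span_base) auto
  have W_V: "W (Suc m) \<subseteq> V"
    unfolding W_def using eV by (intro st.span_minimal V) auto
  have zero: "(0, 0, 0) \<in> F"
    using lin[OF chain_0 chain_0, of "-1"] by simp
  have scale: "(state_scale k x, state_scale k y, k * r) \<in> F" if "(x, y, r) \<in> F" for k x y r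
    using lin[OF zero that, of k] by simp
  note distrib = st.scale_right_distrib st.scale_left_distrib st.scale_right_diff_distrib
    st.scale_left_diff_distrib
  have comm: "state_scale k (state_scale \<kappa> x) = state_scale \<kappa> (state_scale k x)" for k x
    by (simp add: mult.commute)
  \<comment> \<open>The operator minus \<kappa> lowers the index of each chain vector by one; hence
    it maps \<open>W (Suc j)\<close> onto \<open>W j\<close>.\<close>
  have lift: "\<exists>x\<in>W (Suc j). (x, state_scale \<kappa> x + y, 0) \<in> F" if "y \<in> W j" "j \<le> m" for y j
    using that
  proof (induction j arbitrary: y)
    case 0
    then show ?case
      using zero st.subspace_0[OF W_sub] by (intro bexI[of _ 0]) (auto simp: W_def)
  next
    case (Suc j)
    then obtain c where c: "y - state_scale c (e j) \<in> W j"
      using W_Suc by blast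
    from Suc.IH[OF this] Suc.prems obtain x where x: "x \<in> W (Suc j)"
      "(x, state_scale \<kappa> x + (y - state_scale c (e j)), 0) \<in> F"
      using Suc_leD by blast
    have "j < m" using Suc by simp
    from lin[OF x(2) chain_Suc[OF this], of c]
    have "(x + state_scale c (e (Suc j)), state_scale \<kappa> (x + state_scale c (e (Suc j))) + y, 0) \<in> F"
      by (simp add: distrib comm algebra_simps)
    moreover have "x + state_scale c (e (Suc j)) \<in> W (Suc (Suc j))"
      using x(1) W_mono[of "Suc j" "Suc (Suc j)"] e_W[of "Suc j" "Suc (Suc j)"]
      by (intro st.subspace_add[OF W_sub] st.subspace_scale[OF W_sub]) auto
    ultimately show ?case by blast
  qed
  \<comment> \<open>The companion of \<open>lift\<close>: the same map sends
    \<open>W (Suc j)\<close> into \<open>W j\<close>.\<close>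
  have drop: "\<exists>y\<in>W j. (x, state_scale \<kappa> x + y, 0) \<in> F" if "x \<in> W (Suc j)" "j \<le> m" for x j
    using that
  proof (induction j arbitrary: x)
    case 0
    then obtain c where "x = state_scale c (e 0)"
      using W_Suc[of x 0] by (auto simp: W_def)
    then show ?case
      using scale[OF chain_0, of c] st.subspace_0[OF W_sub[of 0]]
      by (intro bexI[of _ 0]) (auto simp: mult.commute)
  next
    case (Suc j)
    then obtain c where "x - state_scale c (e (Suc j)) \<in> W (Suc j)"
      using W_Suc by blast
    from Suc.IH[OF this] Suc.prems obtain y where y: "y \<in> W j"
      "(x - state_scale c (e (Suc j)), state_scale \<kappa> (x - state_scale c (e (Suc j))) + y, 0) \<in> F"
      using Suc_leD by blast
    have "j < m" using Suc by simp
    from lin[OF y(2) chain_Suc[OF this], of c]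
    have "(x, state_scale \<kappa> x + (y + state_scale c (e j)), 0) \<in> F"
      by (simp add: distrib comm algebra_simps)
    moreover have "y + state_scale c (e j) \<in> W (Suc j)"
      using y(1) W_mono[of j "Suc j"] e_W[of j "Suc j"]
      by (intro st.subspace_add[OF W_sub] st.subspace_scale[OF W_sub]) auto
    ultimately show ?case by blast
  qed
  \<comment> \<open>Applying the operator minus \<kappa> pushes a linear dependence down the chain,
    until it contradicts that \<open>e 0\<close> is nonzero.\<close>
  have new: "e j \<notin> W j" if "j \<le> m" for j
    using that
  proof (induction j)
    case 0
    then show ?case using e0 by (simp add: W_def)
  next
    case (Suc j)
    show ?case
    proof
      assume "e (Suc j) \<in> W (Suc j)"
      with drop Suc obtain y where y: "y \<in> W j" "(e (Suc j), state_scale \<kappa> (e (Suc j)) + y, 0) \<in> F"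
        by fastforce
      have jm: "j < m" using Suc by simp
      from lin[OF chain_Suc[OF this] y(2), of "-1"]
      have "(0, e j - y, 0) \<in> F"
        by (simp add: distrib)
      moreover have "y \<in> V"
        using y(1) W_mono[of j "Suc m"] W_V jm by auto
      then have "e j - y \<in> V"
        using eV[of j] jm by (intro st.subspace_diff[OF V]) auto
      ultimately have "e j = y"
        using inj0 by (metis right_minus_eq)
      then show False using y(1) Suc by simp
    qed
  qed
  have indep: "st.independent (e ` {..<j}) \<and> card (e ` {..<j}) = j" if "j \<le> Suc m" for j
    using that
  proof (induction j)
    case (Suc j)
    then have n: "e j \<notin> st.span (e ` {..<j})"
      using new[of j] by (simp add: W_def)
    have n': "e j \<notin> e ` {..<j}"
      by (rule notI) (rule notE[OF n st.span_base])
    have IH: "st.independent (e ` {..<j})" "card (e ` {..<j}) = j"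
      using Suc by simp_all
    have "st.independent (insert (e j) (e ` {..<j}))"
      by (rule st.independent_insertI[OF n IH(1)])
    moreover have "card (insert (e j) (e ` {..<j})) = Suc j"
      by (simp only: card_insert_disjoint[OF finite_imageI[OF finite_lessThan] n'] IH(2))
    ultimately show ?case
      unfolding lessThan_Suc image_insert by blast
  qed (simp add: st.independent_empty)
  define A where "A = {(x, y). (x, y, 0) \<in> F}"
  have upper: "gen_kernel A \<kappa> n \<subseteq> W (Suc m)" for n
  proof (induction n)
    case 0
    then show ?case using st.subspace_0[OF W_sub] by simp
  next
    case (Suc n)
    show ?case
    proof
      fix x assume "x \<in> gen_kernel A \<kappa> (Suc n)"
      then obtain y where y: "(x, y, 0) \<in> F" "y - state_scale \<kappa> x \<in> W (Suc m)"
        using Suc by (auto simp: A_def)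
      then obtain c where "y - state_scale \<kappa> x - state_scale c (e m) \<in> W m"
        using W_Suc by blast
      from lift[OF this order_refl] obtain x' where x': "x' \<in> W (Suc m)"
        "(x', state_scale \<kappa> x' + (y - state_scale \<kappa> x - state_scale c (e m)), 0) \<in> F"
        by blast
      \<comment> \<open>The component along \<open>e m\<close> is the only one that cannot be lifted
        inside the span, so it is removed with \<open>e (Suc m)\<close>. What remains is a kernel
        element whose defect is - c times \<delta>. Kernel elements are multiples of
        \<open>e 0\<close>, whose defect is zero, and therefore c = 0.\<close>
      define z where "z = x - x' - state_scale c (e (Suc m))"
      from lin[OF lin[OF y(1) x'(2), of "-1"] chain_last, of "- c"]
      have z: "(z, state_scale \<kappa> z, - (c * \<delta>)) \<in> F"
        by (simp add: z_def distrib comm algebra_simps)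
      from ker[OF this] obtain d where d: "z = state_scale d (e 0)"
        by blast
      from lin[OF z scale[OF chain_0, of d], of "-1"]
      have "(0, 0, - (c * \<delta>)) \<in> F"
        by (simp add: d mult.commute)
      with inj0[OF this] st.subspace_0[OF V] \<delta> have "c = 0"
        by simp
      then have "x = x' + state_scale d (e 0)"
        using d by (simp add: z_def algebra_simps)
      moreover have "x' + state_scale d (e 0) \<in> W (Suc m)"
        by (intro st.subspace_add[OF W_sub x'(1)] st.subspace_scale[OF W_sub] e_W) simp
      ultimately show "x \<in> W (Suc m)"
        by (simp only:)
    qed
  qed
  have lower: "e j \<in> gen_kernel A \<kappa> (Suc j)" if "j \<le> m" for j
    using that
  proof (induction j)
    case 0
    have "(e 0, state_scale \<kappa> (e 0)) \<in> A"
      using chain_0 by (simp add: A_def)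
    moreover have "state_scale \<kappa> (e 0) - state_scale \<kappa> (e 0) \<in> gen_kernel A \<kappa> 0"
      by simp
    ultimately show ?case
      unfolding gen_kernel.simps(2) mem_Collect_eq by blast
  next
    case (Suc j)
    have "(e (Suc j), state_scale \<kappa> (e (Suc j)) + e j) \<in> A"
      using chain_Suc[of j] Suc.prems by (simp add: A_def)
    moreover have "state_scale \<kappa> (e (Suc j)) + e j - state_scale \<kappa> (e (Suc j)) \<in> gen_kernel A \<kappa> (Suc j)"
      using Suc by (simp del: gen_kernel.simps)
    ultimately show ?case
      unfolding gen_kernel.simps(2)[of A \<kappa> "Suc j"] mem_Collect_eq by blast
  qed
  show ?thesis
    unfolding A_def[symmetric]
  proof (rule st.dim_unique)
    show "e ` {..<Suc m} \<subseteq> (\<Union>n. gen_kernel A \<kappa> n)"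
    proof (rule image_subsetI)
      fix j assume "j \<in> {..<Suc m}"
      then have "e j \<in> gen_kernel A \<kappa> (Suc j)"
        by (intro lower) simp
      then show "e j \<in> (\<Union>n. gen_kernel A \<kappa> n)"
        by (rule UN_I[OF UNIV_I])
    qed
    show "(\<Union>n. gen_kernel A \<kappa> n) \<subseteq> st.span (e ` {..<Suc m})"
      unfolding W_def[symmetric] by (rule UN_least) (rule upper)
  qed (use indep[of "Suc m"] in blast)+
qed

section \<open>States, the domain, and the relation with defect\<close>

lemma state_add_scale:
  "(\<rho>, \<tau>, \<phi>, w) + state_scale k (\<rho>', \<tau>', \<phi>', w')
    = (\<rho> + k * \<rho>', \<tau> + k * \<tau>', (\<lambda>x. \<phi> x + k * \<phi>' x), (\<lambda>x. w x + k * w' x))"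
  by (simp add: state_scale_def plus_fun_def)

lemma subspaceI_add_scale:
  assumes "0 \<in> S" "\<And>x y k. x \<in> S \<Longrightarrow> y \<in> S \<Longrightarrow> x + state_scale k y \<in> S"
  shows "st.subspace S"
  using assms(2)[of _ _ 1] assms(2)[OF assms(1)] assms(1) by (auto simp: st.subspace_def)

lemma L_domain_add_scale: "x \<in> L_domain \<Longrightarrow> y \<in> L_domain \<Longrightarrow> x + state_scale k y \<in> L_domain"
  by (cases x, cases y)
    (auto simp: L_domain_def state_add_scale vanishes_outside_def H2_add_cmult intro!: H1_add H1_cmult)

lemma phase_space_add_scale:
  "x \<in> phase_space \<Longrightarrow> y \<in> phase_space \<Longrightarrow> x + state_scale k y \<in> phase_space"
  by (cases x, cases y)
    (auto simp: phase_space_def state_add_scale vanishes_outside_def intro!: H1_add H1_cmult L2_add L2_cmult)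

lemma subspace_L_domain: "st.subspace L_domain"
  by (rule subspaceI_add_scale[OF _ L_domain_add_scale])
    (auto simp: L_domain_def zero_prod_def zero_fun_def vanishes_outside_def H1_zero H2_zero)

lemma L_domain_subset_phase_space: "L_domain \<subseteq> phase_space"
  by (auto simp: L_domain_def phase_space_def H2_imp_H1 L2_continuous H1_continuous)

text \<open>The graph of \<open>\<L>\<close> with an error term \<open>r\<close> admitted in the second component.\<close>

definition defect_graph :: "(real \<Rightarrow> real) \<Rightarrow> real \<Rightarrow> real \<Rightarrow> (state \<times> state \<times> complex) set" where
  "defect_graph a \<beta> \<alpha> = {((\<rho>, \<tau>, \<phi>, w), (\<rho>', \<tau>', \<phi>', w'), r).
     (\<rho>, \<tau>, \<phi>, w) \<in> L_domain \<and> (\<rho>', \<tau>', \<phi>', w') \<in> phase_space \<and>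
     (\<exists>\<phi>\<^sub>\<zeta>. H1_deriv \<phi> \<phi>\<^sub>\<zeta> \<and> H1 \<phi>\<^sub>\<zeta> \<and>
        \<rho>' = - \<tau> / of_real (a 1) \<and>
        \<tau>' = of_real (a 1 ^ 4 / \<beta>) * \<phi>\<^sub>\<zeta> 1 - of_real (a 1 * \<alpha> / \<beta>) * \<rho> + r \<and>
        (\<forall>\<zeta>\<in>{0..1}. \<phi>' \<zeta> = - w \<zeta> / of_real (a \<zeta>)) \<and>
        H1_deriv (\<lambda>\<zeta>. of_real (a \<zeta> ^ 3) * \<phi>\<^sub>\<zeta> \<zeta>) w')}"

lemma L_graph_eq: "L_graph a \<beta> \<alpha> = {(x, y). (x, y, 0) \<in> defect_graph a \<beta> \<alpha>}"
  by (auto simp: L_graph_def defect_graph_def)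

lemma defect_graph_add_scale:
  assumes "(x, y, r) \<in> defect_graph a \<beta> \<alpha>" "(x', y', r') \<in> defect_graph a \<beta> \<alpha>"
  shows "(x + state_scale k x', y + state_scale k y', r + k * r') \<in> defect_graph a \<beta> \<alpha>"
proof -
  obtain \<rho> \<tau> \<phi> w where x: "x = (\<rho>, \<tau>, \<phi>, w)" by (cases x)
  obtain \<rho>' \<tau>' \<phi>' w' where x': "x' = (\<rho>', \<tau>', \<phi>', w')" by (cases x')
  obtain \<rho>1 \<tau>1 \<phi>1 w1 where y: "y = (\<rho>1, \<tau>1, \<phi>1, w1)" by (cases y)
  obtain \<rho>1' \<tau>1' \<phi>1' w1' where y': "y' = (\<rho>1', \<tau>1', \<phi>1', w1')" by (cases y')
  obtain d where d: "H1_deriv \<phi> d" "H1 d" "\<rho>1 = - \<tau> / of_real (a 1)"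
    "\<tau>1 = of_real (a 1 ^ 4 / \<beta>) * d 1 - of_real (a 1 * \<alpha> / \<beta>) * \<rho> + r"
    "\<forall>\<zeta>\<in>{0..1}. \<phi>1 \<zeta> = - w \<zeta> / of_real (a \<zeta>)"
    "H1_deriv (\<lambda>\<zeta>. of_real (a \<zeta> ^ 3) * d \<zeta>) w1"
    using assms(1) by (auto simp: defect_graph_def x y)
  obtain d' where d': "H1_deriv \<phi>' d'" "H1 d'" "\<rho>1' = - \<tau>' / of_real (a 1)"
    "\<tau>1' = of_real (a 1 ^ 4 / \<beta>) * d' 1 - of_real (a 1 * \<alpha> / \<beta>) * \<rho>' + r'"
    "\<forall>\<zeta>\<in>{0..1}. \<phi>1' \<zeta> = - w' \<zeta> / of_real (a \<zeta>)"
    "H1_deriv (\<lambda>\<zeta>. of_real (a \<zeta> ^ 3) * d' \<zeta>) w1'"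
    using assms(2) by (auto simp: defect_graph_def x' y')
  have "x + state_scale k x' \<in> L_domain" "y + state_scale k y' \<in> phase_space"
    using assms by (auto simp: defect_graph_def intro!: L_domain_add_scale phase_space_add_scale)
  moreover have "H1_deriv (\<lambda>x. \<phi> x + k * \<phi>' x) (\<lambda>x. d x + k * d' x)" "H1 (\<lambda>x. d x + k * d' x)"
    using d d' by (auto intro!: H1_deriv_add H1_deriv_cmult H1_add H1_cmult)
  moreover have "\<rho>1 + k * \<rho>1' = - (\<tau> + k * \<tau>') / of_real (a 1)"
    by (simp only: d d' add_divide_distrib minus_add_distrib) simp
  moreover have "\<tau>1 + k * \<tau>1' = of_real (a 1 ^ 4 / \<beta>) * (d 1 + k * d' 1)
      - of_real (a 1 * \<alpha> / \<beta>) * (\<rho> + k * \<rho>') + (r + k * r')"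
    unfolding d(4) d'(4) by (simp only: ring_distribs mult_ac) simp
  moreover have "\<forall>\<zeta>\<in>{0..1}. \<phi>1 \<zeta> + k * \<phi>1' \<zeta> = - (w \<zeta> + k * w' \<zeta>) / of_real (a \<zeta>)"
    using d(5) d'(5) by (simp add: diff_divide_distrib)
  moreover have "H1_deriv (\<lambda>\<zeta>. of_real (a \<zeta> ^ 3) * (d \<zeta> + k * d' \<zeta>)) (\<lambda>\<zeta>. w1 \<zeta> + k * w1' \<zeta>)"
    using H1_deriv_add[OF d(6) H1_deriv_cmult[OF d'(6), of k]]
    by (simp add: algebra_simps)
  ultimately show ?thesis
    unfolding x x' y y' state_add_scale defect_graph_def by blast
qed

text \<open>States vanish off the unit interval, whereas the series solutions are given by formulas
  on the whole line.\<close>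

definition cut :: "(real \<Rightarrow> complex) \<Rightarrow> real \<Rightarrow> complex" where
  "cut f z = (if z \<in> {0..1} then f z else 0)"

lemma cut_simps: "z \<in> {0..1} \<Longrightarrow> cut f z = f z" "vanishes_outside (cut f)"
  by (auto simp: cut_def vanishes_outside_def)

lemma eq_cutI: "vanishes_outside f \<Longrightarrow> (\<And>z. z \<in> {0..1} \<Longrightarrow> f z = g z) \<Longrightarrow> f = cut g"
  by (auto simp: cut_def vanishes_outside_def fun_eq_iff)

section \<open>Power series for the shooting problem\<close>

text \<open>All spectral statements see the laminar flow through these two properties. H1 is the
  regularity that an L2 vorticity provides; continuity and positivity on a compact interval bound
  both \<open>a\<close> and \<open>1 / a ^ 3\<close>.\<close>

locale profile =
  fixes a :: "real \<Rightarrow> real"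
  assumes H1_a: "H1 a" and a_pos: "\<And>x. x \<in> {0..1} \<Longrightarrow> a x > 0"
begin

lemma cont_a: "continuous_on {0..1} a"
  using H1_a H1_deriv_continuous by (auto simp: H1_def)

lemma cont_inv_a3: "continuous_on {0..1} (\<lambda>x. 1 / a x ^ 3)"
  using a_pos by (intro continuous_intros cont_a) (auto simp: less_le)

text \<open>
  Coefficients of the expansions \<open>M = \<Sum>\<^sub>k x\<^sup>k M_coeff k\<close> and \<open>a\<^sup>3 M\<^sub>\<zeta> = \<Sum>\<^sub>k x\<^sup>k N_coeff k\<close> in \<open>x = - \<nu>\<close>.
\<close>

primrec N_coeff :: "nat \<Rightarrow> real \<Rightarrow> real" where
  "N_coeff 0 = (\<lambda>_. 1)"
| "N_coeff (Suc k) = (\<lambda>z. integral {0..z} (\<lambda>s. a s * integral {0..s} (\<lambda>t. 1 / a t ^ 3 * N_coeff k t)))"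

definition M_coeff :: "nat \<Rightarrow> real \<Rightarrow> real" where
  "M_coeff k z = integral {0..z} (\<lambda>t. 1 / a t ^ 3 * N_coeff k t)"

lemma N_coeff_Suc: "N_coeff (Suc k) z = integral {0..z} (\<lambda>s. a s * M_coeff k s)"
  by (simp add: M_coeff_def)

declare N_coeff.simps(2) [simp del]

lemma cont_M_coeff_if: "continuous_on {0..1} (N_coeff k) \<Longrightarrow> continuous_on {0..1} (M_coeff k)"
  unfolding M_coeff_def
  by (intro indefinite_integral_continuous_1 integrable_continuous_interval continuous_on_mult cont_inv_a3)

lemma cont_N_coeff: "continuous_on {0..1} (N_coeff k)"
proof (induction k)
  case (Suc k)
  have "continuous_on {0..1} (\<lambda>z. integral {0..z} (\<lambda>s. a s * M_coeff k s))"
    by (intro indefinite_integral_continuous_1 integrable_continuous_interval continuous_on_mult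
        cont_a cont_M_coeff_if Suc)
  then show ?case by (simp add: N_coeff_Suc[abs_def])
qed simp

lemma cont_M_coeff: "continuous_on {0..1} (M_coeff k)"
  by (intro cont_M_coeff_if cont_N_coeff)

lemma integrable_on_01:
  fixes f :: "real \<Rightarrow> 'b::banach"
  assumes "continuous_on {0..1} f" "0 \<le> x" "y \<le> 1"
  shows "f integrable_on {x..y}"
  using assms by (intro integrable_continuous_interval continuous_on_subset[OF assms(1)]) auto

text \<open>Expanding in x = - \<nu> makes all integral kernels positive; the estimates that follow
  can therefore multiply inequalities directly.\<close>

lemma coeff_nonneg: "z \<in> {0..1} \<Longrightarrow> 0 \<le> N_coeff k z" "z \<in> {0..1} \<Longrightarrow> 0 \<le> M_coeff k z"
proof -
  have m: "0 \<le> M_coeff k z" if "\<And>t. t \<in> {0..1} \<Longrightarrow> 0 \<le> N_coeff k t" "z \<in> {0..1}" for k z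
    unfolding M_coeff_def using that a_pos
    by (intro Henstock_Kurzweil_Integration.integral_nonneg integrable_on_01 continuous_on_mult
        cont_inv_a3 cont_N_coeff) (auto simp: less_imp_le)
  have n: "0 \<le> N_coeff k z" if "z \<in> {0..1}" for k z
    using that
  proof (induction k arbitrary: z)
    case (Suc k)
    have "0 \<le> a s * M_coeff k s" if "s \<in> {0..1}" for s
      using m[OF Suc.IH] that a_pos[OF that] by (simp add: less_imp_le)
    then show ?case
      unfolding N_coeff_Suc using Suc.prems
      by (intro Henstock_Kurzweil_Integration.integral_nonneg integrable_on_01 continuous_on_mult
          cont_a cont_M_coeff) auto
  qed simp
  show "z \<in> {0..1} \<Longrightarrow> 0 \<le> N_coeff k z" "z \<in> {0..1} \<Longrightarrow> 0 \<le> M_coeff k z"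
    using n m by blast+
qed

text \<open>Each step of the recursion integrates twice. One integration is estimated crudely by z
  \<le> 1, the other yields the next factor of k!, and this is already enough for series that are
  entire in x.\<close>

lemma coeff_bounds:
  obtains K where "K > 0" "\<And>k z. z \<in> {0..1} \<Longrightarrow> N_coeff k z \<le> K ^ k / fact k"
    "\<And>k z. z \<in> {0..1} \<Longrightarrow> M_coeff k z \<le> K ^ Suc k / fact k"
proof -
  obtain L1 L2 where L1: "\<And>z. z \<in> {0..1} \<Longrightarrow> \<bar>a z\<bar> \<le> L1"
    and L2: "\<And>z. z \<in> {0..1} \<Longrightarrow> \<bar>1 / a z ^ 3\<bar> \<le> L2"
    using bounded_on_Icc[OF cont_a] bounded_on_Icc[OF cont_inv_a3] by fastforce
  \<comment> \<open>L \<ge> 1 lets the odd power L^(2k+1) be absorbed into K^(k+1) with K =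
    L^2.\<close>
  define L where "L = max 1 (max L1 L2)"
  have L: "L \<ge> 1" "\<And>z. z \<in> {0..1} \<Longrightarrow> a z \<le> L" "\<And>z. z \<in> {0..1} \<Longrightarrow> 1 / a z ^ 3 \<le> L"
  proof -
    show "L \<ge> 1" by (simp add: L_def)
    show "a z \<le> L" if "z \<in> {0..1}" for z
      using L1[OF that] by (auto simp: L_def max_def abs_if split: if_splits)
    show "1 / a z ^ 3 \<le> L" if "z \<in> {0..1}" for z
      using order_trans[OF abs_ge_self L2[OF that]] by (auto simp: L_def max_def)
  qed
  have m: "M_coeff k z \<le> L ^ (2 * k + 1) * z ^ k / fact k"
    if n: "\<And>t. t \<in> {0..1} \<Longrightarrow> N_coeff k t \<le> L ^ (2 * k) * t ^ k / fact k" and z: "z \<in> {0..1}" for k z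
  proof -
    have "M_coeff k z \<le> integral {0..z} (\<lambda>_. L ^ (2 * k + 1) * z ^ k / fact k)"
      unfolding M_coeff_def
    proof (rule integral_le)
      show "(\<lambda>t. 1 / a t ^ 3 * N_coeff k t) integrable_on {0..z}"
        using z by (intro integrable_on_01 continuous_on_mult cont_inv_a3 cont_N_coeff) auto
      fix t assume t: "t \<in> {0..z}"
      then have t': "t \<in> {0..1}" using z by auto
      have "1 / a t ^ 3 * N_coeff k t \<le> L * (L ^ (2 * k) * t ^ k / fact k)"
        using L t' a_pos[OF t'] n[OF t'] coeff_nonneg(1)[OF t'] by (intro mult_mono) auto
      also have "\<dots> \<le> L * (L ^ (2 * k) * z ^ k / fact k)"
        using t L(1) by (intro mult_left_mono divide_right_mono power_mono) auto
      finally show "1 / a t ^ 3 * N_coeff k t \<le> L ^ (2 * k + 1) * z ^ k / fact k" by simp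
    qed (rule integrable_const_ivl)
    also have "\<dots> = z * (L ^ (2 * k + 1) * z ^ k / fact k)"
      using z by simp
    also have "\<dots> \<le> 1 * (L ^ (2 * k + 1) * z ^ k / fact k)"
      using z L(1) by (intro mult_right_mono) auto
    finally show ?thesis by simp
  qed
  have n: "N_coeff k z \<le> L ^ (2 * k) * z ^ k / fact k" if "z \<in> {0..1}" for k z
    using that
  proof (induction k arbitrary: z)
    case (Suc k)
    define C where "C = L ^ (2 * Suc k) / fact k"
    have hi: "((\<lambda>s. C * s ^ k) has_integral (C * z ^ Suc k / Suc k - C * 0 ^ Suc k / Suc k)) {0..z}"
    proof (rule fundamental_theorem_of_calculus)
      show "0 \<le> z" using Suc.prems by simp
      fix s assume "s \<in> {0..z}"
      have "((\<lambda>s. C * s ^ Suc k / Suc k) has_real_derivative C * (real (Suc k) * s ^ k) / Suc k) (at s within {0..z})"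
        by (auto intro!: derivative_eq_intros simp del: power_Suc of_nat_Suc)
      then show "((\<lambda>s. C * s ^ Suc k / Suc k) has_vector_derivative C * s ^ k) (at s within {0..z})"
        by (simp add: has_real_derivative_iff_has_vector_derivative[symmetric] del: power_Suc of_nat_Suc)
    qed
    have "N_coeff (Suc k) z \<le> C * z ^ Suc k / Suc k - C * 0 ^ Suc k / Suc k"
      unfolding N_coeff_Suc
    proof (rule has_integral_le[OF integrable_integral hi])
      show "(\<lambda>s. a s * M_coeff k s) integrable_on {0..z}"
        using Suc.prems by (intro integrable_on_01 continuous_on_mult cont_a cont_M_coeff) auto
      fix s assume "s \<in> {0..z}"
      then have s: "s \<in> {0..1}" using Suc.prems by auto
      have "a s * M_coeff k s \<le> L * (L ^ (2 * k + 1) * s ^ k / fact k)"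
        using L s a_pos[OF s] m[OF Suc.IH s] coeff_nonneg(2)[OF s] by (intro mult_mono) auto
      then show "a s * M_coeff k s \<le> C * s ^ k" by (simp add: C_def)
    qed
    also have "\<dots> = L ^ (2 * Suc k) * z ^ Suc k / fact (Suc k)"
      by (simp add: C_def field_simps)
    finally show ?case .
  qed simp
  show ?thesis
  proof (rule that[of "L\<^sup>2"])
    show "0 < L\<^sup>2" using L(1) by simp
    fix k :: nat and z :: real assume z: "z \<in> {0..1}"
    have zk: "z ^ k \<le> 1" using z by (simp add: power_le_one)
    have 0: "0 \<le> L ^ i" for i using L(1) by simp
    have "L ^ (2 * k) * z ^ k / fact k \<le> L ^ (2 * k) / fact k"
      using mult_left_le[OF zk 0[of "2 * k"]] by (simp add: divide_right_mono)
    then show "N_coeff k z \<le> (L\<^sup>2) ^ k / fact k"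
      using n[OF z, of k] by (simp add: power_mult)
    have "L ^ (2 * k + 1) * z ^ k / fact k \<le> L ^ (2 * k + 1) / fact k"
      using mult_left_le[OF zk 0[of "2 * k + 1"]] by (simp add: divide_right_mono)
    also have "\<dots> \<le> L ^ (2 * Suc k) / fact k"
      using L(1) by (intro divide_right_mono power_increasing) auto
    also have "\<dots> = (L\<^sup>2) ^ Suc k / fact k"
      by (simp only: power_mult)
    finally show "M_coeff k z \<le> (L\<^sup>2) ^ Suc k / fact k"
      using m[OF n z, of k] by simp
  qed
qed

section \<open>Convergence of the series in the spectral parameter\<close>

definition geometric :: "(nat \<Rightarrow> complex) \<Rightarrow> bool" where
  "geometric c \<longleftrightarrow> (\<exists>C R. \<forall>k. norm (c k) \<le> C * R ^ k)"

definition M_series :: "(nat \<Rightarrow> complex) \<Rightarrow> real \<Rightarrow> complex" where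
  "M_series c z = (\<Sum>k. c k * of_real (M_coeff k z))"

definition N_series :: "(nat \<Rightarrow> complex) \<Rightarrow> real \<Rightarrow> complex" where
  "N_series c z = (\<Sum>k. c k * of_real (N_coeff k z))"

text \<open>Geometric growth of the coefficients is harmless against the factorial decay, and the
  majorant is an exponential series; its factor 1 + K covers the exponents k and k + 1. The class
  \<open>geometric\<close> contains the coefficients of x^k and all their derivatives in x and is
  closed under shifts, so one convergence proof serves M and all its parameter derivatives.\<close>

lemma geometric_majorant:
  assumes "geometric c"
  obtains B where "summable B" "\<And>k z. z \<in> {0..1} \<Longrightarrow> norm (c k * of_real (N_coeff k z)) \<le> B k"
    "\<And>k z. z \<in> {0..1} \<Longrightarrow> norm (c k * of_real (M_coeff k z)) \<le> B k"
proof -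
  obtain C R where CR: "\<And>k. norm (c k) \<le> C * R ^ k"
    using assms by (auto simp: geometric_def)
  obtain K where K: "K > 0" "\<And>k z. z \<in> {0..1} \<Longrightarrow> N_coeff k z \<le> K ^ k / fact k"
    "\<And>k z. z \<in> {0..1} \<Longrightarrow> M_coeff k z \<le> K ^ Suc k / fact k"
    using coeff_bounds by blast
  define B where "B k = C * (1 + K) * (inverse (fact k) * (R * K) ^ k)" for k
  have CR0: "0 \<le> C * R ^ k" for k
    using order_trans[OF norm_ge_zero CR] .
  show ?thesis
  proof (rule that)
    show "summable B"
      unfolding B_def by (intro summable_mult summable_exp)
    fix k :: nat and z :: real assume z: "z \<in> {0..1}"
    have p: "0 \<le> K ^ k / fact k" using K(1) by simp
    have n: "\<bar>N_coeff k z\<bar> \<le> (1 + K) * (K ^ k / fact k)"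
      using K(2)[OF z, of k] coeff_nonneg(1)[OF z, of k] mult_nonneg_nonneg[OF less_imp_le[OF K(1)] p]
      unfolding distrib_right by linarith
    have m: "\<bar>M_coeff k z\<bar> \<le> (1 + K) * (K ^ k / fact k)"
      using K(3)[OF z, of k] coeff_nonneg(2)[OF z, of k] p
      unfolding distrib_right by simp
    have B: "C * R ^ k * ((1 + K) * (K ^ k / fact k)) = B k"
      by (simp add: B_def power_mult_distrib divide_inverse algebra_simps)
    show "norm (c k * of_real (N_coeff k z)) \<le> B k" "norm (c k * of_real (M_coeff k z)) \<le> B k"
      unfolding norm_mult norm_of_real B[symmetric] using CR[of k] CR0[of k] n m
      by (intro mult_mono CR n m; simp)+
  qed
qed

lemma summable_series:
  assumes "geometric c" "z \<in> {0..1}"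
  shows "summable (\<lambda>k. c k * of_real (M_coeff k z))" "summable (\<lambda>k. c k * of_real (N_coeff k z))"
proof -
  obtain B where B: "summable B" "\<And>k z. z \<in> {0..1} \<Longrightarrow> norm (c k * of_real (N_coeff k z)) \<le> B k"
    "\<And>k z. z \<in> {0..1} \<Longrightarrow> norm (c k * of_real (M_coeff k z)) \<le> B k"
    using geometric_majorant[OF assms(1)] by blast
  show "summable (\<lambda>k. c k * of_real (M_coeff k z))" "summable (\<lambda>k. c k * of_real (N_coeff k z))"
    by (rule summable_comparison_test'[OF B(1)], rule B(3)[OF assms(2)],
        rule summable_comparison_test'[OF B(1)], rule B(2)[OF assms(2)])
qed

lemma uniform_limit_series:
  assumes "geometric c"
  shows "uniform_limit {0..1} (\<lambda>n z. \<Sum>k<n. c k * of_real (N_coeff k z)) (N_series c) sequentially"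
    and "uniform_limit {0..1} (\<lambda>n z. \<Sum>k<n. c k * of_real (M_coeff k z)) (M_series c) sequentially"
proof -
  obtain B where B: "summable B" "\<And>k z. z \<in> {0..1} \<Longrightarrow> norm (c k * of_real (N_coeff k z)) \<le> B k"
    "\<And>k z. z \<in> {0..1} \<Longrightarrow> norm (c k * of_real (M_coeff k z)) \<le> B k"
    using geometric_majorant[OF assms(1)] by blast
  show "uniform_limit {0..1} (\<lambda>n z. \<Sum>k<n. c k * of_real (N_coeff k z)) (N_series c) sequentially"
    and "uniform_limit {0..1} (\<lambda>n z. \<Sum>k<n. c k * of_real (M_coeff k z)) (M_series c) sequentially"
    unfolding N_series_def[abs_def] M_series_def[abs_def]
    by (intro Weierstrass_m_test[OF _ B(1)] B(2,3); assumption)+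
qed

lemma cont_N_series: "geometric c \<Longrightarrow> continuous_on {0..1} (N_series c)"
  by (rule uniform_limit_theorem[OF _ uniform_limit_series(1)])
    (auto intro!: continuous_intros always_eventually cont_N_coeff)

lemma cont_M_series: "geometric c \<Longrightarrow> continuous_on {0..1} (M_series c)"
  by (rule uniform_limit_theorem[OF _ uniform_limit_series(2)])
    (auto intro!: continuous_intros always_eventually cont_M_coeff)

text \<open>Uniform convergence and a bounded weight permit integration term by term. With the
  weights \<open>1 / a ^ 3\<close> and \<open>a\<close> the coefficient recursions become the two
  equations of the first order system.\<close>

lemma has_integral_termwise:
  fixes f g :: "nat \<Rightarrow> real \<Rightarrow> real" and c :: "nat \<Rightarrow> complex"
  assumes ul: "uniform_limit {0..1} (\<lambda>n z. \<Sum>k<n. c k * of_real (f k z)) F sequentially"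
    and f: "\<And>k. continuous_on {0..1} (f k)" and w: "continuous_on {0..1} w"
    and g: "\<And>k z. z \<in> {0..1} \<Longrightarrow> g k z = integral {0..z} (\<lambda>s. w s * f k s)" and z: "z \<in> {0..1}"
  shows "(\<lambda>k. c k * of_real (g k z)) sums integral {0..z} (\<lambda>s. w s *\<^sub>R F s)"
proof -
  have sub: "{0..z} \<subseteq> {0..1}" using z by auto
  have "bounded (w ` {0..1})"
    using compact_imp_bounded[OF compact_continuous_image[OF w compact_Icc]] .
  moreover have "bounded (F ` {0..1})"
  proof -
    have "continuous_on {0..1} F"
      by (rule uniform_limit_theorem[OF _ ul]) (auto intro!: continuous_intros always_eventually f)
    then show ?thesis
      using compact_imp_bounded[OF compact_continuous_image[OF _ compact_Icc]] by blast
  qed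
  ultimately have "uniform_limit {0..1} (\<lambda>n z. w z *\<^sub>R (\<Sum>k<n. c k * of_real (f k z))) (\<lambda>z. w z *\<^sub>R F z) sequentially"
    by (intro bounded_bilinear.bounded_uniform_limit[OF bounded_bilinear_scaleR] uniform_limit_const ul)
  then have ul': "uniform_limit {0..z} (\<lambda>n z. w z *\<^sub>R (\<Sum>k<n. c k * of_real (f k z))) (\<lambda>z. w z *\<^sub>R F z) sequentially"
    by (rule uniform_limit_on_subset[OF _ sub])
  obtain I J where I: "\<And>n. ((\<lambda>z. w z *\<^sub>R (\<Sum>k<n. c k * of_real (f k z))) has_integral I n) {0..z}"
    and J: "((\<lambda>z. w z *\<^sub>R F z) has_integral J) {0..z}" and IJ: "I \<longlonglongrightarrow> J"
  proof (rule uniform_limit_integral[OF ul'])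
    show "continuous_on {0..z} (\<lambda>z. w z *\<^sub>R (\<Sum>k<n. c k * of_real (f k z)))" for n
      by (intro continuous_intros continuous_on_subset[OF f sub] continuous_on_subset[OF w sub])
  qed auto
  have "I n = (\<Sum>k<n. c k * of_real (g k z))" for n
  proof (rule has_integral_unique[OF I])
    have "((\<lambda>s. w s * f k s) has_integral g k z) {0..z}" for k
      unfolding g[OF z] using z
      by (intro integrable_integral integrable_on_01 continuous_on_mult w f) auto
    then have "((\<lambda>s. complex_of_real (w s * f k s)) has_integral of_real (g k z)) {0..z}" for k
      by (rule has_integral_of_real)
    then have "((\<lambda>s. \<Sum>k<n. c k * of_real (w s * f k s)) has_integral (\<Sum>k<n. c k * of_real (g k z))) {0..z}"
      by (intro has_integral_sum has_integral_mult_right) auto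
    then show "((\<lambda>z. w z *\<^sub>R (\<Sum>k<n. c k * of_real (f k z))) has_integral (\<Sum>k<n. c k * of_real (g k z))) {0..z}"
      by (simp add: scaleR_conv_of_real sum_distrib_left mult_ac)
  qed
  then have "(\<lambda>n. \<Sum>k<n. c k * of_real (g k z)) \<longlonglongrightarrow> J"
    using IJ by presburger
  then show ?thesis
    using integral_unique[OF J] by (simp add: sums_def)
qed

lemma geometric_shift:
  assumes "geometric c"
  shows "geometric (\<lambda>k. c (Suc k))"
proof -
  obtain C R where "\<And>k. norm (c k) \<le> C * R ^ k"
    using assms by (auto simp: geometric_def)
  then have "norm (c (Suc k)) \<le> (C * R) * R ^ k" for k
    by (metis mult.assoc power_Suc)
  then show ?thesis unfolding geometric_def by blast
qed

lemma M_series_integral: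
  assumes "geometric c" "z \<in> {0..1}"
  shows "M_series c z = integral {0..z} (\<lambda>s. (1 / a s ^ 3) *\<^sub>R N_series c s)"
  unfolding M_series_def
  by (rule sums_unique[symmetric], rule has_integral_termwise[OF uniform_limit_series(1)[OF assms(1)] cont_N_coeff cont_inv_a3 _ assms(2)])
     (simp add: M_coeff_def)

text \<open>The recursion produces every \<open>N_coeff\<close> but the constant one at index 0,
  which contributes \<open>c 0\<close>. The rest is an M-series with shifted coefficients; for
  powers of x the shift is multiplication by x, which is how the spectral parameter enters the
  equation.\<close>

lemma N_series_integral:
  assumes "geometric c" "z \<in> {0..1}"
  shows "N_series c z = c 0 + integral {0..z} (\<lambda>s. a s *\<^sub>R M_series (\<lambda>k. c (Suc k)) s)"
proof -
  have "(\<lambda>k. c (Suc k) * of_real (N_coeff (Suc k) z)) sums integral {0..z} (\<lambda>s. a s *\<^sub>R M_series (\<lambda>k. c (Suc k)) s)"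
    by (rule has_integral_termwise[OF uniform_limit_series(2)[OF geometric_shift[OF assms(1)]] cont_M_coeff cont_a _ assms(2)])
      (simp add: N_coeff_Suc)
  then have "(\<lambda>k. c k * of_real (N_coeff k z)) sums (integral {0..z} (\<lambda>s. a s *\<^sub>R M_series (\<lambda>k. c (Suc k)) s) + c 0 * of_real (N_coeff 0 z))"
    by (subst (asm) sums_Suc_iff)
  then show ?thesis
    by (simp add: N_series_def sums_iff add.commute)
qed

lemma M_series_deriv:
  assumes "geometric c" "z \<in> {0..1}"
  shows "(M_series c has_vector_derivative (1 / a z ^ 3) *\<^sub>R N_series c z) (at z within {0..1})"
  by (rule has_vector_derivative_transform[OF assms(2) M_series_integral[OF assms(1)]
        integral_has_vector_derivative[OF continuous_on_scaleR[OF cont_inv_a3 cont_N_series[OF assms(1)]] assms(2)]])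

lemma N_series_deriv:
  assumes "geometric c" "z \<in> {0..1}"
  shows "(N_series c has_vector_derivative a z *\<^sub>R M_series (\<lambda>k. c (Suc k)) z) (at z within {0..1})"
proof -
  have "((\<lambda>z. c 0 + integral {0..z} (\<lambda>s. a s *\<^sub>R M_series (\<lambda>k. c (Suc k)) s)) has_vector_derivative
      0 + a z *\<^sub>R M_series (\<lambda>k. c (Suc k)) z) (at z within {0..1})"
    by (rule has_vector_derivative_add[OF has_vector_derivative_const
          integral_has_vector_derivative[OF continuous_on_scaleR[OF cont_a cont_M_series[OF geometric_shift[OF assms(1)]]] assms(2)]])
  then have "((\<lambda>z. c 0 + integral {0..z} (\<lambda>s. a s *\<^sub>R M_series (\<lambda>k. c (Suc k)) s)) has_vector_derivative
      a z *\<^sub>R M_series (\<lambda>k. c (Suc k)) z) (at z within {0..1})"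
    by simp
  then show ?thesis
    by (rule has_vector_derivative_transform[OF assms(2), rotated]) (rule N_series_integral[OF assms(1)])
qed

text \<open>Gronwall argument: the energy |\<phi>|^2 + |N|^2, damped by exp(- B t), is nonincreasing
  and starts at zero.\<close>

lemma ivp_zero:
  fixes \<phi> N :: "real \<Rightarrow> complex"
  assumes \<phi>: "\<And>z. z \<in> {0..1} \<Longrightarrow> (\<phi> has_vector_derivative (1 / a z ^ 3) *\<^sub>R N z) (at z within {0..1})"
    and N: "\<And>z. z \<in> {0..1} \<Longrightarrow> (N has_vector_derivative a z *\<^sub>R (x * \<phi> z)) (at z within {0..1})"
    and 0: "\<phi> 0 = 0" "N 0 = 0" and z: "z \<in> {0..1}"
  shows "\<phi> z = 0 \<and> N z = 0"
proof -
  obtain L1 L2 where L1: "\<And>z. z \<in> {0..1} \<Longrightarrow> \<bar>a z\<bar> \<le> L1"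
    and L2: "\<And>z. z \<in> {0..1} \<Longrightarrow> \<bar>1 / a z ^ 3\<bar> \<le> L2"
    using bounded_on_Icc[OF cont_a] bounded_on_Icc[OF cont_inv_a3] by fastforce
  \<comment> \<open>The derivative of the energy is at most 2 |\<phi>| |N| (L2 + L1 |x|), and 2
    |\<phi>| |N| is at most the energy.\<close>
  define B where "B = L2 + L1 * norm x"
  define E where "E t = \<phi> t \<bullet> \<phi> t + N t \<bullet> N t" for t
  define F where "F t = E t * exp (- B * t)" for t
  have c\<phi>: "continuous_on {0..1} \<phi>" and cN: "continuous_on {0..1} N"
    unfolding continuous_on_eq_continuous_within
    by (blast intro: has_vector_derivative_continuous \<phi> N)+
  have cF: "continuous_on {0..1} F"
    unfolding F_def E_def by (intro continuous_intros c\<phi> cN)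
  have "F z \<le> F 0"
  proof (rule DERIV_nonpos_imp_decreasing_open[of 0 z F])
    show "0 \<le> z" using z by simp
    show "continuous_on {0..z} F"
      using z by (intro continuous_on_subset[OF cF]) auto
    fix t assume t: "0 < t" "t < z"
    then have t01: "t \<in> {0..1}" using z by auto
    have at: "at t within {0..1} = at t"
      using t z by (intro at_within_interior) auto
    have d\<phi>: "(\<phi> has_vector_derivative (1 / a t ^ 3) *\<^sub>R N t) (at t)"
      and dN: "(N has_vector_derivative a t *\<^sub>R (x * \<phi> t)) (at t)"
      using \<phi>[OF t01] N[OF t01] by (simp_all add: at)
    define E' where "E' = 2 * (\<phi> t \<bullet> ((1 / a t ^ 3) *\<^sub>R N t)) + 2 * (N t \<bullet> (a t *\<^sub>R (x * \<phi> t)))"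
    have "(E has_real_derivative E') (at t)"
      unfolding E_def[abs_def] E'_def has_real_derivative_iff_has_vector_derivative
      using has_vector_derivative_add[OF
          bounded_bilinear.has_vector_derivative[OF bounded_bilinear_inner d\<phi> d\<phi>]
          bounded_bilinear.has_vector_derivative[OF bounded_bilinear_inner dN dN]]
      by (simp add: inner_commute)
    then have dF: "(F has_real_derivative E' * exp (- B * t) + E t * (exp (- B * t) * (- B))) (at t)"
      unfolding F_def[abs_def] by (auto intro!: derivative_eq_intros)
    have pn: "2 * (norm (\<phi> t) * norm (N t)) \<le> E t"
      using zero_le_power2[of "norm (\<phi> t) - norm (N t)"]
      by (simp add: E_def power2_norm_eq_inner[symmetric] power2_diff)
    have "\<phi> t \<bullet> ((1 / a t ^ 3) *\<^sub>R N t) \<le> norm (\<phi> t) * (L2 * norm (N t))"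
      using norm_cauchy_schwarz[of "\<phi> t" "(1 / a t ^ 3) *\<^sub>R N t"] L2[OF t01]
      by (smt (verit) mult_left_mono mult_right_mono norm_ge_zero norm_scaleR)
    moreover have "N t \<bullet> (a t *\<^sub>R (x * \<phi> t)) \<le> norm (N t) * (L1 * norm (x * \<phi> t))"
      using norm_cauchy_schwarz[of "N t" "a t *\<^sub>R (x * \<phi> t)"] L1[OF t01]
      by (smt (verit) mult_left_mono mult_right_mono norm_ge_zero norm_scaleR)
    ultimately have "E' \<le> B * (2 * (norm (\<phi> t) * norm (N t)))"
      unfolding E'_def B_def by (simp add: norm_mult algebra_simps)
    also have "\<dots> \<le> B * E t"
    proof (rule mult_left_mono[OF pn])
      have "0 \<le> L1" "0 \<le> L2" using L1[OF t01] L2[OF t01] by linarith+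
      then show "0 \<le> B" by (simp add: B_def)
    qed
    finally have "E' * exp (- B * t) + E t * (exp (- B * t) * (- B)) \<le> 0"
      by (simp add: algebra_simps)
    with dF show "\<exists>y. (F has_real_derivative y) (at t) \<and> y \<le> 0" by blast
  qed
  then have "E z * exp (- B * z) \<le> 0"
    by (simp add: F_def E_def 0)
  then have "E z \<le> 0"
    by (simp add: mult_le_0_iff)
  then show ?thesis
    unfolding E_def by (metis add_nonneg_eq_0_iff inner_eq_zero_iff inner_ge_zero order_antisym
        add_nonneg_nonneg)
qed

text \<open>
  The \<open>j\<close>-th Taylor coefficient of \<open>x \<mapsto> x\<^sup>k\<close>, so that \<open>M_taylor x j\<close> below is \<open>\<partial>\<^sub>x\<^sup>j M / j!\<close>.
\<close>

definition pow_taylor :: "complex \<Rightarrow> nat \<Rightarrow> nat \<Rightarrow> complex" where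
  "pow_taylor x j k = of_nat (k choose j) * x ^ (k - j)"

lemma geometric_pow_taylor: "geometric (pow_taylor x j)"
proof -
  have "norm (pow_taylor x j k) \<le> 1 * (2 * (1 + norm x)) ^ k" for k
  proof (cases "j \<le> k")
    case True
    have "norm x ^ (k - j) \<le> (1 + norm x) ^ (k - j)"
      by (intro power_mono) auto
    also have "\<dots> \<le> (1 + norm x) ^ k"
      by (intro power_increasing) auto
    finally have 1: "norm x ^ (k - j) \<le> (1 + norm x) ^ k" .
    have "real (k choose j) \<le> 2 ^ k"
      using binomial_le_pow2[of k j] by (metis of_nat_le_iff of_nat_numeral of_nat_power)
    then show ?thesis
      unfolding pow_taylor_def power_mult_distrib norm_mult norm_power norm_of_nat using 1
      by (simp add: mult_mono)
  next
    case False
    then show ?thesis by (simp add: pow_taylor_def binomial_eq_0)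
  qed
  then show ?thesis unfolding geometric_def by blast
qed

lemma pow_taylor_Suc_0: "pow_taylor x 0 (Suc k) = x * pow_taylor x 0 k"
  by (simp add: pow_taylor_def)

text \<open>Leibniz rule for the product of x and x^k. Its extra term makes each Taylor coefficient
  a source in the equation of the next one, as in a Jordan chain.\<close>

lemma pow_taylor_Suc_Suc: "pow_taylor x (Suc j) (Suc k) = x * pow_taylor x (Suc j) k + pow_taylor x j k"
proof (cases "j < k")
  case True
  then have "x ^ (k - j) = x * x ^ (k - Suc j)"
    by (metis Suc_diff_Suc power_Suc)
  then show ?thesis by (simp add: pow_taylor_def algebra_simps)
next
  case False
  then show ?thesis by (simp add: pow_taylor_def binomial_eq_0)
qed

definition M_taylor :: "complex \<Rightarrow> nat \<Rightarrow> real \<Rightarrow> complex" where "M_taylor x j = M_series (pow_taylor x j)"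
definition N_taylor :: "complex \<Rightarrow> nat \<Rightarrow> real \<Rightarrow> complex" where "N_taylor x j = N_series (pow_taylor x j)"

lemma M_taylor_deriv: "z \<in> {0..1} \<Longrightarrow>
    (M_taylor x j has_vector_derivative (1 / a z ^ 3) *\<^sub>R N_taylor x j z) (at z within {0..1})"
  unfolding M_taylor_def N_taylor_def by (rule M_series_deriv[OF geometric_pow_taylor])

lemma N_taylor_0_deriv:
  assumes "z \<in> {0..1}"
  shows "(N_taylor x 0 has_vector_derivative a z *\<^sub>R (x * M_taylor x 0 z)) (at z within {0..1})"
proof -
  have "M_series (\<lambda>k. pow_taylor x 0 (Suc k)) z = x * M_series (pow_taylor x 0) z"
    unfolding M_series_def pow_taylor_Suc_0 mult.assoc
    by (rule suminf_mult[OF summable_series(1)[OF geometric_pow_taylor assms]])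
  then show ?thesis
    using N_series_deriv[OF geometric_pow_taylor[of x 0] assms] by (simp add: M_taylor_def N_taylor_def)
qed

lemma N_taylor_Suc_deriv:
  assumes "z \<in> {0..1}"
  shows "(N_taylor x (Suc j) has_vector_derivative a z *\<^sub>R (x * M_taylor x (Suc j) z + M_taylor x j z)) (at z within {0..1})"
proof -
  note s = summable_series(1)[OF geometric_pow_taylor assms]
  have "M_series (\<lambda>k. pow_taylor x (Suc j) (Suc k)) z = x * M_series (pow_taylor x (Suc j)) z + M_series (pow_taylor x j) z"
    unfolding M_series_def pow_taylor_Suc_Suc distrib_right mult.assoc
    by (simp add: suminf_add[symmetric] suminf_mult summable_mult s)
  then show ?thesis
    using N_series_deriv[OF geometric_pow_taylor[of x "Suc j"] assms] by (simp add: M_taylor_def N_taylor_def)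
qed

lemma M_taylor_at_0: "M_taylor x j 0 = 0"
  using M_series_integral[OF geometric_pow_taylor, of 0 x j] by (simp add: M_taylor_def)

lemma N_taylor_at_0: "N_taylor x j 0 = (if j = 0 then 1 else 0)"
  using N_series_integral[OF geometric_pow_taylor, of 0 x j] by (simp add: N_taylor_def pow_taylor_def binomial_eq_0)

text \<open>The first j terms vanish, so an index shift gives an ordinary power series that may be
  differentiated termwise. The factor \<open>Suc j\<close> comes from the normalization by
  j!.\<close>

lemma taylor_series_deriv:
  fixes w :: "nat \<Rightarrow> complex"
  assumes "\<And>x j. summable (\<lambda>k. pow_taylor x j k * w k)"
  shows "((\<lambda>x. \<Sum>k. pow_taylor x j k * w k) has_field_derivative of_nat (Suc j) * (\<Sum>k. pow_taylor x (Suc j) k * w k)) (at x)"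
proof -
  define c where "c i = of_nat (i + j choose j) * w (i + j)" for i
  have shift: "(\<Sum>k. pow_taylor x j' k * w k) = (\<Sum>k. pow_taylor x j' (k + j') * w (k + j'))" for x j'
    using suminf_split_initial_segment[OF assms[of x j'], of j']
    by (simp add: pow_taylor_def binomial_eq_0)
  have eq: "(\<Sum>k. pow_taylor y j k * w k) = (\<Sum>i. c i * y ^ i)" for y
    unfolding shift by (simp add: pow_taylor_def c_def mult_ac)
  have "summable (\<lambda>i. c i * y ^ i)" for y
    using summable_ignore_initial_segment[OF assms[of y j], of j]
    by (simp add: pow_taylor_def c_def mult_ac)
  then have "((\<lambda>y. \<Sum>i. c i * y ^ i) has_field_derivative (\<Sum>i. diffs c i * x ^ i)) (at x)"
    by (rule termdiffs_strong_converges_everywhere)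
  moreover have "(\<Sum>i. diffs c i * x ^ i) = of_nat (Suc j) * (\<Sum>k. pow_taylor x (Suc j) k * w k)"
  proof -
    \<comment> \<open>Both sides equal (i + j + 1)! / (i! j!).\<close>
    have ch: "Suc j * (Suc (i + j) choose Suc j) = Suc i * (Suc (i + j) choose j)" for i
      using Suc_times_binomial[of j "i + j"] binomial_absorb_comp[of "Suc (i + j)" j]
      by (simp add: Suc_diff_le del: binomial_Suc_Suc mult_Suc)
    have "diffs c i * x ^ i = of_nat (Suc j) * (pow_taylor x (Suc j) (i + Suc j) * w (i + Suc j))" for i
    proof -
      have "diffs c i * x ^ i = of_nat (Suc i * (Suc i + j choose j)) * w (Suc i + j) * x ^ i"
        by (simp only: diffs_def c_def of_nat_mult mult.assoc)
      also have "\<dots> = of_nat (Suc j * (i + Suc j choose Suc j)) * w (i + Suc j) * x ^ i"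
        unfolding add_Suc_right add_Suc ch ..
      finally show ?thesis
        by (simp add: pow_taylor_def mult_ac del: of_nat_Suc binomial_Suc_Suc mult_Suc)
    qed
    moreover have "summable (\<lambda>i. pow_taylor x (Suc j) (i + Suc j) * w (i + Suc j))"
      using summable_ignore_initial_segment[OF assms] .
    ultimately show ?thesis
      unfolding shift[of x "Suc j"] by (simp add: suminf_mult del: of_nat_Suc)
  qed
  ultimately show ?thesis
    unfolding eq by simp
qed

lemma M_taylor_param_deriv:
  assumes "z \<in> {0..1}"
  shows "((\<lambda>x. M_taylor x j z) has_field_derivative of_nat (Suc j) * M_taylor x (Suc j) z) (at x)"
  unfolding M_taylor_def M_series_def
  by (intro taylor_series_deriv summable_series(1)[OF geometric_pow_taylor assms])

lemma N_taylor_param_deriv: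
  assumes "z \<in> {0..1}"
  shows "((\<lambda>x. N_taylor x j z) has_field_derivative of_nat (Suc j) * N_taylor x (Suc j) z) (at x)"
  unfolding N_taylor_def N_series_def
  by (intro taylor_series_deriv summable_series(2)[OF geometric_pow_taylor assms])

text \<open>Subtracting the series solution with the same initial data leaves a problem with zero
  data. The lemma has two uses: formal eigenvectors are unique up to a factor, and a given shooting
  solution coincides with the series.\<close>

lemma ivp_solution:
  fixes \<phi> N :: "real \<Rightarrow> complex"
  assumes \<phi>: "\<And>z. z \<in> {0..1} \<Longrightarrow> (\<phi> has_vector_derivative (1 / a z ^ 3) *\<^sub>R N z) (at z within {0..1})"
    and N: "\<And>z. z \<in> {0..1} \<Longrightarrow> (N has_vector_derivative a z *\<^sub>R (x * \<phi> z)) (at z within {0..1})"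
    and 0: "\<phi> 0 = 0" and z: "z \<in> {0..1}"
  shows "\<phi> z = N 0 * M_taylor x 0 z \<and> N z = N 0 * N_taylor x 0 z"
proof -
  have "\<phi> z - N 0 * M_taylor x 0 z = 0 \<and> N z - N 0 * N_taylor x 0 z = 0"
  proof (rule ivp_zero[OF _ _ _ _ z])
    fix t :: real assume t: "t \<in> {0..1}"
    show "((\<lambda>z. \<phi> z - N 0 * M_taylor x 0 z) has_vector_derivative
        (1 / a t ^ 3) *\<^sub>R (N t - N 0 * N_taylor x 0 t)) (at t within {0..1})"
      using has_vector_derivative_diff[OF \<phi>[OF t]
          has_vector_derivative_mult_right[OF M_taylor_deriv[OF t], of "N 0" x 0]]
      by (simp add: algebra_simps)
    show "((\<lambda>z. N z - N 0 * N_taylor x 0 z) has_vector_derivative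
        a t *\<^sub>R (x * (\<phi> t - N 0 * M_taylor x 0 t))) (at t within {0..1})"
      using has_vector_derivative_diff[OF N[OF t]
          has_vector_derivative_mult_right[OF N_taylor_0_deriv[OF t], of "N 0" x]]
      by (simp add: algebra_simps)
  qed (simp_all add: 0 M_taylor_at_0 N_taylor_at_0)
  then show ?thesis by simp
qed

section \<open>Algebraic multiplicities\<close>

text \<open>Membership in the domain asks for \<phi>_\<zeta> in H1. Here \<phi>_\<zeta> is a^(-3)
  times a continuously differentiable function, so the regularity of \<open>a\<close> has to pass to
  its inverse cube.\<close>

lemma H1_inv_a3: "H1 (\<lambda>x. 1 / a x ^ 3)"
proof -
  obtain g where g: "H1_deriv a g"
    using H1_a by (auto simp: H1_def)
  have "H1_deriv (\<lambda>x. 1 / a x ^ 3) (\<lambda>x. (- 3 / a x ^ 4) *\<^sub>R g x)"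
  proof (rule H1_deriv_compose_C1[OF g a_pos, where \<Phi> = "\<lambda>u. 1 / u ^ 3" and \<Phi>' = "\<lambda>u. - 3 / u ^ 4"])
    fix u :: real assume "u > 0"
    then show "((\<lambda>u. 1 / u ^ 3) has_real_derivative - 3 / u ^ 4) (at u)"
      by (auto intro!: derivative_eq_intros simp: field_simps power_numeral_reduce)
  qed (auto intro!: continuous_intros)
  then show ?thesis by (auto simp: H1_def)
qed

text \<open>\<open>P\<close> stands for a^3 E' and \<open>Q\<close> for (a^3 E')' / a. With both as
  arguments the relation is linear in the triple, so chain links can be formed as linear
  combinations of Taylor coefficients.\<close>

definition solves :: "(real \<Rightarrow> complex) \<Rightarrow> (real \<Rightarrow> complex) \<Rightarrow> (real \<Rightarrow> complex) \<Rightarrow> bool" where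
  "solves E P Q \<longleftrightarrow> E 0 = 0 \<and> continuous_on {0..1} Q \<and>
     (\<forall>z\<in>{0..1}. (E has_vector_derivative (1 / a z ^ 3) *\<^sub>R P z) (at z within {0..1})) \<and>
     (\<forall>z\<in>{0..1}. (P has_vector_derivative a z *\<^sub>R Q z) (at z within {0..1}))"

lemma solves_zero: "solves (\<lambda>_. 0) (\<lambda>_. 0) (\<lambda>_. 0)"
  by (simp add: solves_def)

lemma solves_add: "solves E P Q \<Longrightarrow> solves E' P' Q' \<Longrightarrow>
    solves (\<lambda>z. E z + E' z) (\<lambda>z. P z + P' z) (\<lambda>z. Q z + Q' z)"
  by (auto simp: solves_def scaleR_add_right intro!: continuous_on_add has_vector_derivative_add)

lemma solves_cmult: "solves E P Q \<Longrightarrow> solves (\<lambda>z. k * E z) (\<lambda>z. k * P z) (\<lambda>z. k * Q z)"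
  by (auto simp: solves_def mult_scaleR_right[symmetric] simp del: mult_scaleR_right
      intro!: continuous_on_mult has_vector_derivative_mult_right)

lemma solves_continuous: "solves E P Q \<Longrightarrow> continuous_on {0..1} E \<and> continuous_on {0..1} P"
  unfolding solves_def continuous_on_eq_continuous_within
  by (blast intro: has_vector_derivative_continuous)

lemma cont_M_taylor: "continuous_on {0..1} (M_taylor x j)"
  unfolding M_taylor_def by (rule cont_M_series[OF geometric_pow_taylor])

lemma solves_M_taylor_0: "solves (M_taylor x 0) (N_taylor x 0) (\<lambda>z. x * M_taylor x 0 z)"
  by (auto simp: solves_def M_taylor_at_0 intro!: continuous_intros cont_M_taylor M_taylor_deriv N_taylor_0_deriv)

lemma solves_M_taylor_Suc: "solves (M_taylor x (Suc j)) (N_taylor x (Suc j)) (\<lambda>z. x * M_taylor x (Suc j) z + M_taylor x j z)"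
  by (auto simp: solves_def M_taylor_at_0 intro!: continuous_intros cont_M_taylor M_taylor_deriv N_taylor_Suc_deriv)

lemma solves_H1_deriv:
  assumes "solves E P Q"
  shows "H1_deriv E (\<lambda>z. (1 / a z ^ 3) *\<^sub>R P z)" "H1_deriv P (\<lambda>z. a z *\<^sub>R Q z)"
    "H1 (\<lambda>z. (1 / a z ^ 3) *\<^sub>R P z)"
proof -
  have c: "continuous_on {0..1} P" "continuous_on {0..1} Q"
    using solves_continuous[OF assms] assms unfolding solves_def by blast+
  show "H1_deriv E (\<lambda>z. (1 / a z ^ 3) *\<^sub>R P z)"
    by (rule H1_deriv_of_C1[OF _ continuous_on_scaleR[OF cont_inv_a3 c(1)]])
      (use assms in \<open>simp add: solves_def\<close>)
  show P: "H1_deriv P (\<lambda>z. a z *\<^sub>R Q z)"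
    by (rule H1_deriv_of_C1[OF _ continuous_on_scaleR[OF cont_a c(2)]])
      (use assms in \<open>simp add: solves_def\<close>)
  show "H1 (\<lambda>z. (1 / a z ^ 3) *\<^sub>R P z)"
    by (rule H1_scaleR[OF H1_inv_a3]) (use P in \<open>auto simp: H1_def\<close>)
qed

text \<open>
  The state of a Jordan chain whose third component is \<open>E\<close> and whose predecessor has third
  component \<open>E'\<close>; then \<open>- w / a = \<kappa> E + E'\<close>.
\<close>

definition chain_state :: "complex \<Rightarrow> (real \<Rightarrow> complex) \<Rightarrow> (real \<Rightarrow> complex) \<Rightarrow> state" where
  "chain_state \<kappa> E E' = (E 1, - (of_real (a 1) * (\<kappa> * E 1 + E' 1)), cut E,
     cut (\<lambda>z. - (of_real (a z) * (\<kappa> * E z + E' z))))"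

lemma chain_state_in_L_domain:
  assumes "solves E P Q" "solves E' P' Q'"
  shows "chain_state \<kappa> E E' \<in> L_domain"
proof -
  have "H1_deriv (cut E) (\<lambda>z. (1 / a z ^ 3) *\<^sub>R P z)"
    using solves_H1_deriv(1)[OF assms(1)] by (subst H1_deriv_cong[OF cut_simps(1) refl])
  then have "H2 (cut E)"
    using solves_H1_deriv(3)[OF assms(1)] by (auto simp: H2_def)
  moreover have "H1 (cut (\<lambda>z. - (of_real (a z) * (\<kappa> * E z + E' z))))"
  proof -
    have "H1 E" "H1 E'"
      using solves_H1_deriv(1) assms by (auto simp: H1_def)
    then have "H1 (\<lambda>z. a z *\<^sub>R ((- \<kappa>) * E z + (- 1) * E' z))"
      by (intro H1_scaleR H1_a H1_add H1_cmult)
    then show ?thesis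
      by (subst H1_cong[OF cut_simps(1)]) (simp_all add: scaleR_conv_of_real algebra_simps)
  qed
  moreover have "E 0 = 0" "E' 0 = 0"
    using assms by (auto simp: solves_def)
  ultimately show ?thesis
    by (simp add: L_domain_def chain_state_def cut_simps)
qed

text \<open>In a chain with successive third components \<open>E\<close>, \<open>E1\<close>,
  \<open>E2\<close>, the third equation gives w = - a (\<kappa> E + E1), and likewise for the
  predecessor. Inserting both into the fourth equation yields (a^3 E')' = - a (\<kappa>^2 E + 2
  \<kappa> E1 + E2). The only equation left is the boundary one for \<tau>, and \<open>r\<close> is
  its residue.\<close>

lemma chain_step:
  assumes E: "solves E P (\<lambda>z. - (\<kappa>\<^sup>2 * E z + 2 * \<kappa> * E1 z + E2 z))"
    and E1: "solves E1 P1 Q1" and E2: "solves E2 P2 Q2" and \<beta>: "\<beta> \<noteq> 0"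
    and r: "r = - (of_real (a 1) / of_real \<beta>) *
      (P 1 - of_real \<alpha> * E 1 + of_real \<beta> * (\<kappa>\<^sup>2 * E 1 + 2 * \<kappa> * E1 1 + E2 1))"
  shows "(chain_state \<kappa> E E1, state_scale \<kappa> (chain_state \<kappa> E E1) + chain_state \<kappa> E1 E2, r)
    \<in> defect_graph a \<beta> \<alpha>"
proof -
  let ?d = "\<lambda>z. (1 / a z ^ 3) *\<^sub>R P z"
  have d1: "chain_state \<kappa> E E1 \<in> L_domain" and d2: "chain_state \<kappa> E1 E2 \<in> L_domain"
    using chain_state_in_L_domain E E1 E2 by blast+
  have y: "state_scale \<kappa> (chain_state \<kappa> E E1) + chain_state \<kappa> E1 E2 \<in> phase_space"
    using subspace_L_domain L_domain_subset_phase_space d1 d2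
    by (meson st.subspace_add st.subspace_scale subsetD)
  have a0: "a z \<noteq> 0" if "z \<in> {0..1}" for z
    using a_pos[OF that] by simp
  have "H1_deriv (cut E) ?d"
    using solves_H1_deriv(1)[OF E] by (subst H1_deriv_cong[OF cut_simps(1) refl])
  moreover have "H1 ?d"
    by (rule solves_H1_deriv(3)[OF E])
  moreover have "H1_deriv (\<lambda>\<zeta>. of_real (a \<zeta> ^ 3) * ?d \<zeta>)
     (\<lambda>z. \<kappa> * cut (\<lambda>z. - (of_real (a z) * (\<kappa> * E z + E1 z))) z
       + cut (\<lambda>z. - (of_real (a z) * (\<kappa> * E1 z + E2 z))) z)"
    using solves_H1_deriv(2)[OF E]
    by (rule H1_deriv_cong[THEN iffD1, rotated 2])
      (use a0 in \<open>simp_all add: cut_simps scaleR_conv_of_real algebra_simps power2_eq_square\<close>)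
  moreover have "\<kappa> * - (of_real (a 1) * (\<kappa> * E 1 + E1 1)) + - (of_real (a 1) * (\<kappa> * E1 1 + E2 1))
     = of_real (a 1 ^ 4 / \<beta>) * ?d 1 - of_real (a 1 * \<alpha> / \<beta>) * E 1 + r"
  proof -
    have "of_real (a 1 ^ 4 / \<beta>) * ?d 1 = of_real (a 1) / of_real \<beta> * P 1"
      using a0[of 1] by (simp add: scaleR_conv_of_real power_numeral_reduce)
    then show ?thesis
      using \<beta> unfolding r by (simp add: field_simps power2_eq_square)
  qed
  ultimately show ?thesis
    using d1 y a0
    by (auto simp: defect_graph_def chain_state_def state_scale_def plus_fun_def cut_simps
        scaleR_conv_of_real intro!: exI[of _ ?d])
qed

text \<open>The graph determines w' only up to null sets. A continuous representative makes N = a^3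
  \<phi>_\<zeta> classically differentiable, and the boundary equation is then expressed by N(1),
  because a^4 \<phi>_\<zeta> = a N.\<close>

lemma defect_graph_ode:
  assumes "((\<rho>, \<tau>, \<phi>, w), (\<rho>', \<tau>', \<phi>', w'), r) \<in> defect_graph a \<beta> \<alpha>"
    and c: "continuous_on {0..1} w'"
  shows "\<exists>N. (\<forall>z\<in>{0..1}. (\<phi> has_vector_derivative (1 / a z ^ 3) *\<^sub>R N z) (at z within {0..1})) \<and>
    (\<forall>z\<in>{0..1}. (N has_vector_derivative w' z) (at z within {0..1})) \<and>
    \<tau>' = of_real (a 1 / \<beta>) * N 1 - of_real (a 1 * \<alpha> / \<beta>) * \<rho> + r"
proof -
  obtain d where d: "H1_deriv \<phi> d" "H1 d"
    "\<tau>' = of_real (a 1 ^ 4 / \<beta>) * d 1 - of_real (a 1 * \<alpha> / \<beta>) * \<rho> + r"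
    "H1_deriv (\<lambda>\<zeta>. of_real (a \<zeta> ^ 3) * d \<zeta>) w'"
    using assms(1) by (auto simp: defect_graph_def)
  show ?thesis
  proof (intro exI[of _ "\<lambda>\<zeta>. of_real (a \<zeta> ^ 3) * d \<zeta>"] conjI ballI)
    fix z :: real assume z: "z \<in> {0..1}"
    show "(\<phi> has_vector_derivative (1 / a z ^ 3) *\<^sub>R (of_real (a z ^ 3) * d z)) (at z within {0..1})"
      using H1_deriv_imp_C1[OF d(1) H1_continuous[OF d(2)] z] a_pos[OF z]
      by (simp add: scaleR_conv_of_real)
    show "((\<lambda>\<zeta>. of_real (a \<zeta> ^ 3) * d \<zeta>) has_vector_derivative w' z) (at z within {0..1})"
      by (rule H1_deriv_imp_C1[OF d(4) c z])
  next
    show "\<tau>' = of_real (a 1 / \<beta>) * (of_real (a 1 ^ 3) * d 1) - of_real (a 1 * \<alpha> / \<beta>) * \<rho> + r"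
      by (simp add: d(3) power_numeral_reduce)
  qed
qed

text \<open>For an image in the domain w' is continuous, so it vanishes everywhere and not just
  almost everywhere. Its boundary value is \<tau>', hence \<tau>' = 0, and the boundary equation
  leaves r = 0 as the only possibility.\<close>

lemma defect_graph_inj0:
  assumes "(0, y, r) \<in> defect_graph a \<beta> \<alpha>" "y \<in> L_domain"
  shows "y = 0 \<and> r = 0"
proof -
  obtain \<rho>' \<tau>' \<phi>' w' where y: "y = (\<rho>', \<tau>', \<phi>', w')" by (cases y)
  have c: "continuous_on {0..1} w'"
    using assms(2) H1_continuous by (auto simp: y L_domain_def)
  have g: "((0, 0, \<lambda>_. 0, \<lambda>_. 0), (\<rho>', \<tau>', \<phi>', w'), r) \<in> defect_graph a \<beta> \<alpha>"
    using assms(1) by (simp add: y zero_prod_def zero_fun_def)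
  obtain N where N: "\<And>z. z \<in> {0..1} \<Longrightarrow> ((\<lambda>_. 0) has_vector_derivative (1 / a z ^ 3) *\<^sub>R N z) (at z within {0..1})"
    "\<And>z. z \<in> {0..1} \<Longrightarrow> (N has_vector_derivative w' z) (at z within {0..1})"
    "\<tau>' = of_real (a 1 / \<beta>) * N 1 - of_real (a 1 * \<alpha> / \<beta>) * 0 + r"
    using defect_graph_ode[OF g c] by blast
  have N0: "N z = 0" if z: "z \<in> {0..1}" for z
  proof -
    have "(1 / a z ^ 3) *\<^sub>R N z = 0"
      by (rule vector_derivative_unique_Icc[OF _ z N(1)[OF z] has_vector_derivative_const]) simp
    then show ?thesis using a_pos[OF z] by simp
  qed
  have w0: "w' z = 0" if z: "z \<in> {0..1}" for z
  proof -
    have "((\<lambda>_. 0) has_vector_derivative w' z) (at z within {0..1})"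
      by (rule has_vector_derivative_transform[OF z _ N(2)[OF z]]) (simp add: N0)
    then show ?thesis
      by (intro vector_derivative_unique_Icc[OF _ z _ has_vector_derivative_const]) simp_all
  qed
  have v: "vanishes_outside w'" "vanishes_outside \<phi>'" and \<tau>': "w' 1 = \<tau>'"
    using assms(2) by (auto simp: y L_domain_def)
  have "\<tau>' = 0" using w0[of 1] \<tau>' by simp
  moreover have "\<rho>' = 0" "\<And>z. z \<in> {0..1} \<Longrightarrow> \<phi>' z = 0"
    using g by (auto simp: defect_graph_def)
  moreover have "N 1 = 0" by (simp add: N0)
  ultimately show ?thesis
    using v w0 N(3) by (auto simp: y zero_prod_def zero_fun_def fun_eq_iff vanishes_outside_def)
qed

text \<open>The free defect absorbs the boundary equation at the surface. Only the initial value
  problem from the bed remains, and its solutions with \<phi>(0) = 0 are multiples of one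
  function.\<close>

lemma defect_graph_kernel:
  assumes "(x, state_scale \<kappa> x, r) \<in> defect_graph a \<beta> \<alpha>"
  shows "\<exists>c. x = state_scale c (chain_state \<kappa> (M_taylor (- \<kappa>\<^sup>2) 0) (\<lambda>_. 0))"
proof -
  obtain \<rho> \<tau> \<phi> w where x: "x = (\<rho>, \<tau>, \<phi>, w)" by (cases x)
  have xL: "(\<rho>, \<tau>, \<phi>, w) \<in> L_domain"
    using assms by (auto simp: x defect_graph_def state_scale_def)
  then have D: "vanishes_outside \<phi>" "vanishes_outside w" "\<phi> 0 = 0" "\<phi> 1 = \<rho>" "w 1 = \<tau>" "H1 w"
    by (auto simp: L_domain_def)
  have g: "((\<rho>, \<tau>, \<phi>, w), (\<kappa> * \<rho>, \<kappa> * \<tau>, \<lambda>z. \<kappa> * \<phi> z, \<lambda>z. \<kappa> * w z), r) \<in> defect_graph a \<beta> \<alpha>"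
    using assms by (simp add: x state_scale_def)
  have w: "w z = - (of_real (a z) * (\<kappa> * \<phi> z))" if "z \<in> {0..1}" for z
  proof -
    have "\<kappa> * \<phi> z = - w z / of_real (a z)"
      using g that by (auto simp: defect_graph_def)
    then show ?thesis using a_pos[OF that] by (simp add: field_simps)
  qed
  have c: "continuous_on {0..1} (\<lambda>z. \<kappa> * w z)"
    by (rule continuous_on_mult_left[OF H1_continuous[OF D(6)]])
  obtain N where N: "\<And>z. z \<in> {0..1} \<Longrightarrow> (\<phi> has_vector_derivative (1 / a z ^ 3) *\<^sub>R N z) (at z within {0..1})"
    "\<And>z. z \<in> {0..1} \<Longrightarrow> (N has_vector_derivative \<kappa> * w z) (at z within {0..1})"
    using defect_graph_ode[OF g c] by blast
  have N': "(N has_vector_derivative a z *\<^sub>R (- \<kappa>\<^sup>2 * \<phi> z)) (at z within {0..1})" if "z \<in> {0..1}" for z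
    using N(2)[OF that] by (simp add: w[OF that] scaleR_conv_of_real power2_eq_square algebra_simps)
  have \<phi>: "\<phi> z = N 0 * M_taylor (- \<kappa>\<^sup>2) 0 z" if "z \<in> {0..1}" for z
    using ivp_solution[OF N(1) N' D(3) that] by blast
  have "\<phi> = cut (\<lambda>z. N 0 * M_taylor (- \<kappa>\<^sup>2) 0 z)"
    by (rule eq_cutI[OF D(1) \<phi>])
  moreover have "w = cut (\<lambda>z. - (of_real (a z) * (\<kappa> * (N 0 * M_taylor (- \<kappa>\<^sup>2) 0 z))))"
    by (rule eq_cutI[OF D(2)]) (simp add: w \<phi>)
  moreover have "\<rho> = N 0 * M_taylor (- \<kappa>\<^sup>2) 0 1" "\<tau> = - (of_real (a 1) * (\<kappa> * (N 0 * M_taylor (- \<kappa>\<^sup>2) 0 1)))"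
    using D(4,5) \<phi>[of 1] w[of 1] by auto
  ultimately have "x = state_scale (N 0) (chain_state \<kappa> (M_taylor (- \<kappa>\<^sup>2) 0) (\<lambda>_. 0))"
    by (auto simp: x state_scale_def chain_state_def cut_def fun_eq_iff)
  then show ?thesis ..
qed

lemma chain_state_nonzero: "chain_state \<kappa> (M_taylor x 0) (\<lambda>_. 0) \<noteq> 0"
proof
  assume "chain_state \<kappa> (M_taylor x 0) (\<lambda>_. 0) = 0"
  then have "cut (M_taylor x 0) = (\<lambda>_. 0)"
    by (simp add: chain_state_def zero_prod_def zero_fun_def)
  then have z: "M_taylor x 0 z = 0" if "z \<in> {0..1}" for z
    using cut_simps(1)[OF that, of "M_taylor x 0"] by simp
  \<comment> \<open>If M vanished identically, so would its slope at 0, which is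
    \<open>1 / a 0 ^ 3\<close>.\<close>
  have "((\<lambda>_. 0) has_vector_derivative (1 / a 0 ^ 3) *\<^sub>R N_taylor x 0 0) (at 0 within {0..1})"
    by (rule has_vector_derivative_transform[OF _ _ M_taylor_deriv]) (simp_all add: z)
  then have "(1 / a 0 ^ 3) *\<^sub>R N_taylor x 0 0 = 0"
    by (intro vector_derivative_unique_Icc[OF _ _ _ has_vector_derivative_const]) simp_all
  then show False using a_pos[of 0] by (simp add: N_taylor_at_0)
qed

text \<open>
  \<open>E\<close> is shifted by two: \<open>E (j + 2)\<close> is the \<open>j\<close>-th Taylor coefficient in \<open>\<kappa>\<close> of the eigenfunction
  and the zero functions \<open>E 0\<close>, \<open>E 1\<close> are its missing predecessors.
\<close>

lemma alg_mult_chain: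
  fixes E P :: "nat \<Rightarrow> real \<Rightarrow> complex"
  assumes \<beta>: "\<beta> \<noteq> 0"
    and E0: "E 0 = (\<lambda>_. 0)" and E1: "E 1 = (\<lambda>_. 0)" and E2: "E 2 = M_taylor (- \<kappa>\<^sup>2) 0"
    and sol: "\<And>j. j \<le> Suc m \<Longrightarrow>
      solves (E (j + 2)) (P j) (\<lambda>z. - (\<kappa>\<^sup>2 * E (j + 2) z + 2 * \<kappa> * E (j + 1) z + E j z))"
    and d: "\<And>j. d j = P j 1 - of_real \<alpha> * E (j + 2) 1
      + of_real \<beta> * (\<kappa>\<^sup>2 * E (j + 2) 1 + 2 * \<kappa> * E (j + 1) 1 + E j 1)"
    and d0: "\<And>j. j \<le> m \<Longrightarrow> d j = 0" and d1: "d (Suc m) \<noteq> 0"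
  shows "alg_mult (L_graph a \<beta> \<alpha>) \<kappa> = Suc m"
proof -
  have sol': "\<exists>P Q. solves (E i) P Q" if "i \<le> m + 3" for i
  proof -
    consider "i = 0" | "i = 1" | j where "i = j + 2"
      by (metis One_nat_def add.commute add_2_eq_Suc not0_implies_Suc)
    then show ?thesis
    proof cases
      case 3
      then show ?thesis using sol[of j] that by auto
    qed (use solves_zero E0 E1 in metis)+
  qed
  define e where "e j = chain_state \<kappa> (E (j + 2)) (E (j + 1))" for j
  have eL: "e j \<in> L_domain" if "j \<le> Suc m" for j
    unfolding e_def using sol'[of "j + 2"] sol'[of "j + 1"] that chain_state_in_L_domain
    by fastforce
  have step: "(e j, state_scale \<kappa> (e j) + chain_state \<kappa> (E (j + 1)) (E j),
      - (of_real (a 1) / of_real \<beta>) * d j) \<in> defect_graph a \<beta> \<alpha>" if j: "j \<le> Suc m" for j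
  proof -
    obtain P1 Q1 P2 Q2 where "solves (E (j + 1)) P1 Q1" "solves (E j) P2 Q2"
      using sol'[of "j + 1"] sol'[of j] j by fastforce
    from chain_step[OF sol[OF j] this \<beta> refl] show ?thesis
      unfolding e_def d .
  qed
  \<comment> \<open>The zero functions at indices 0 and 1 form the zero state, so the link with j =
    0 is the eigenvector equation.\<close>
  have e0': "chain_state \<kappa> (E 1) (E 0) = 0"
    unfolding E0 E1 by (simp add: chain_state_def cut_def zero_prod_def zero_fun_def fun_eq_iff)
  show ?thesis
    unfolding alg_mult_def L_graph_eq
  proof (rule dim_gen_kernel_chain[where e = e and V = L_domain and \<delta> = "- (of_real (a 1) / of_real \<beta>) * d (Suc m)"])
    show "(e 0, state_scale \<kappa> (e 0), 0) \<in> defect_graph a \<beta> \<alpha>"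
      using step[of 0] d0[of 0] e0' by simp
    show "(e (Suc j), state_scale \<kappa> (e (Suc j)) + e j, 0) \<in> defect_graph a \<beta> \<alpha>" if "j < m" for j
      using step[of "Suc j"] d0[of "Suc j"] that by (simp add: e_def)
    show "(e (Suc m), state_scale \<kappa> (e (Suc m)) + e m, - (of_real (a 1) / of_real \<beta>) * d (Suc m))
        \<in> defect_graph a \<beta> \<alpha>"
      using step[of "Suc m"] by (simp add: e_def)
    show "- (of_real (a 1) / of_real \<beta>) * d (Suc m) \<noteq> 0"
      using a_pos[of 1] \<beta> d1 by simp
    have e0: "e 0 = chain_state \<kappa> (M_taylor (- \<kappa>\<^sup>2) 0) (\<lambda>_. 0)"
      using E1 E2 by (simp add: e_def numeral_2_eq_2)
    show "e 0 \<noteq> 0"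
      unfolding e0 by (rule chain_state_nonzero)
    show "\<exists>c. z = state_scale c (e 0)" if "(z, state_scale \<kappa> z, r) \<in> defect_graph a \<beta> \<alpha>" for z r
      unfolding e0 by (rule defect_graph_kernel[OF that])
  qed (use eL subspace_L_domain defect_graph_add_scale defect_graph_inj0 in \<open>auto\<close>)
qed

text \<open>Taylor coefficients at \<open>x\<close> of the characteristic function \<open>a(1)\<^sup>3 M\<^sub>\<zeta>(1) - (\<alpha> + \<beta> x) M(1)\<close>.\<close>

definition char_coeff :: "real \<Rightarrow> real \<Rightarrow> complex \<Rightarrow> nat \<Rightarrow> complex" where
  "char_coeff \<beta> \<alpha> x j = N_taylor x j 1 - (of_real \<alpha> + of_real \<beta> * x) * M_taylor x j 1
     - (if j = 0 then 0 else of_real \<beta> * M_taylor x (j - 1) 1)"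

text \<open>The formal eigenvector always exists, and its defect is a nonzero multiple of the
  characteristic function. A true eigenvector is a multiple of it without defect; by subtraction the
  defect alone would be assigned to the zero state, so it must vanish.\<close>

lemma eigenvalue_iff:
  assumes \<beta>: "\<beta> \<noteq> 0"
  shows "is_eigenvalue (L_graph a \<beta> \<alpha>) \<kappa> \<longleftrightarrow> char_coeff \<beta> \<alpha> (- \<kappa>\<^sup>2) 0 = 0"
proof -
  let ?e = "chain_state \<kappa> (M_taylor (- \<kappa>\<^sup>2) 0) (\<lambda>_. 0)"
  have "chain_state \<kappa> (\<lambda>_. 0) (\<lambda>_. 0) = 0"
    by (simp add: chain_state_def cut_def zero_prod_def zero_fun_def fun_eq_iff)
  moreover have s: "solves (M_taylor (- \<kappa>\<^sup>2) 0) (N_taylor (- \<kappa>\<^sup>2) 0) (\<lambda>z. - (\<kappa>\<^sup>2 * M_taylor (- \<kappa>\<^sup>2) 0 z + 2 * \<kappa> * 0 + 0))"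
    using solves_M_taylor_0[of "- \<kappa>\<^sup>2"] by simp
  ultimately have e: "(?e, state_scale \<kappa> ?e, - (of_real (a 1) / of_real \<beta>) * char_coeff \<beta> \<alpha> (- \<kappa>\<^sup>2) 0)
      \<in> defect_graph a \<beta> \<alpha>"
    using chain_step[OF s solves_zero solves_zero \<beta> refl, of \<alpha>]
    by (simp add: char_coeff_def algebra_simps)
  show ?thesis
  proof
    assume "char_coeff \<beta> \<alpha> (- \<kappa>\<^sup>2) 0 = 0"
    then have "(?e, state_scale \<kappa> ?e) \<in> L_graph a \<beta> \<alpha>"
      using e by (simp add: L_graph_eq)
    then show "is_eigenvalue (L_graph a \<beta> \<alpha>) \<kappa>"
      unfolding is_eigenvalue_def using chain_state_nonzero by blast
  next
    assume "is_eigenvalue (L_graph a \<beta> \<alpha>) \<kappa>"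
    then obtain x where x: "x \<noteq> 0" "(x, state_scale \<kappa> x, 0) \<in> defect_graph a \<beta> \<alpha>"
      by (auto simp: is_eigenvalue_def L_graph_eq)
    obtain c where c: "x = state_scale c ?e"
      using defect_graph_kernel[OF x(2)] by blast
    have "c \<noteq> 0" using x(1) c by (metis st.scale_zero_left)
    have "(0, 0, - (c * (- (of_real (a 1) / of_real \<beta>) * char_coeff \<beta> \<alpha> (- \<kappa>\<^sup>2) 0))) \<in> defect_graph a \<beta> \<alpha>"
      using defect_graph_add_scale[OF x(2) e, of "- c"] by (simp add: c mult.commute)
    from defect_graph_inj0[OF this] have "c * (- (of_real (a 1) / of_real \<beta>) * char_coeff \<beta> \<alpha> (- \<kappa>\<^sup>2) 0) = 0"
      using st.subspace_0[OF subspace_L_domain] by simp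
    then show "char_coeff \<beta> \<alpha> (- \<kappa>\<^sup>2) 0 = 0"
      using \<open>c \<noteq> 0\<close> a_pos[of 1] \<beta> by simp
  qed
qed

lemma solves_cong: "solves E P Q \<Longrightarrow> E = E' \<Longrightarrow> P = P' \<Longrightarrow> Q = Q' \<Longrightarrow> solves E' P' Q'"
  by simp

lemma solves_M_taylor_1: "solves (M_taylor x 1) (N_taylor x 1) (\<lambda>z. x * M_taylor x 1 z + M_taylor x 0 z)"
  and solves_M_taylor_2: "solves (M_taylor x 2) (N_taylor x 2) (\<lambda>z. x * M_taylor x 2 z + M_taylor x 1 z)"
  using solves_M_taylor_Suc[of x 0] solves_M_taylor_Suc[of x 1] by (simp_all add: numeral_2_eq_2)

text \<open>
  In the next four lemmas the lists come from expanding \<open>M\<close> at \<open>- (\<kappa> + h)\<^sup>2 = x - 2 \<kappa> h - h\<^sup>2\<close> in powers of \<open>h\<close>.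
\<close>

lemma alg_mult_nonzero_simple:
  assumes "\<beta> \<noteq> 0" "\<kappa> \<noteq> 0"
    and c: "char_coeff \<beta> \<alpha> (- \<kappa>\<^sup>2) 0 = 0" "char_coeff \<beta> \<alpha> (- \<kappa>\<^sup>2) 1 \<noteq> 0"
  shows "alg_mult (L_graph a \<beta> \<alpha>) \<kappa> = 1"
proof -
  let ?x = "- \<kappa>\<^sup>2"
  let ?E = "\<lambda>j. [\<lambda>_. 0, \<lambda>_. 0, M_taylor ?x 0, \<lambda>z. - 2 * \<kappa> * M_taylor ?x 1 z] ! j"
  let ?P = "\<lambda>j. [N_taylor ?x 0, \<lambda>z. - 2 * \<kappa> * N_taylor ?x 1 z] ! j"
  have "alg_mult (L_graph a \<beta> \<alpha>) \<kappa> = Suc 0"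
  proof (rule alg_mult_chain[where E = ?E and P = ?P, OF assms(1) _ _ _ _ refl])
    fix j assume "j \<le> Suc 0"
    then consider "j = 0" | "j = 1" by linarith
    then show "solves (?E (j + 2)) (?P j) (\<lambda>z. - (\<kappa>\<^sup>2 * ?E (j + 2) z + 2 * \<kappa> * ?E (j + 1) z + ?E j z))"
    proof cases
      case 1
      then show ?thesis using solves_M_taylor_0[of ?x] by simp
    next
      case 2
      then show ?thesis
        by (intro solves_cong[OF solves_cmult[OF solves_M_taylor_1[of ?x], of "- 2 * \<kappa>"]])
          (auto simp: fun_eq_iff algebra_simps)
    qed
  next
    fix j :: nat assume "j \<le> 0"
    then show "?P j 1 - of_real \<alpha> * ?E (j + 2) 1
      + of_real \<beta> * (\<kappa>\<^sup>2 * ?E (j + 2) 1 + 2 * \<kappa> * ?E (j + 1) 1 + ?E j 1) = 0"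
      using c(1) by (simp add: char_coeff_def algebra_simps)
  next
    have "?P (Suc 0) 1 - of_real \<alpha> * ?E (Suc 0 + 2) 1
      + of_real \<beta> * (\<kappa>\<^sup>2 * ?E (Suc 0 + 2) 1 + 2 * \<kappa> * ?E (Suc 0 + 1) 1 + ?E (Suc 0) 1)
      = - 2 * \<kappa> * char_coeff \<beta> \<alpha> ?x 1"
      by (simp add: char_coeff_def algebra_simps)
    also have "\<dots> \<noteq> 0" using c(2) assms(2) by simp
    finally show "?P (Suc 0) 1 - of_real \<alpha> * ?E (Suc 0 + 2) 1
      + of_real \<beta> * (\<kappa>\<^sup>2 * ?E (Suc 0 + 2) 1 + 2 * \<kappa> * ?E (Suc 0 + 1) 1 + ?E (Suc 0) 1) \<noteq> 0" .
  qed simp_all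
  then show ?thesis by simp
qed

lemma alg_mult_nonzero_double:
  assumes "\<beta> \<noteq> 0" "\<kappa> \<noteq> 0"
    and c: "char_coeff \<beta> \<alpha> (- \<kappa>\<^sup>2) 0 = 0" "char_coeff \<beta> \<alpha> (- \<kappa>\<^sup>2) 1 = 0"
      "char_coeff \<beta> \<alpha> (- \<kappa>\<^sup>2) 2 \<noteq> 0"
  shows "alg_mult (L_graph a \<beta> \<alpha>) \<kappa> = 2"
proof -
  let ?x = "- \<kappa>\<^sup>2"
  let ?E = "\<lambda>j. [\<lambda>_. 0, \<lambda>_. 0, M_taylor ?x 0, \<lambda>z. - 2 * \<kappa> * M_taylor ?x 1 z,
    \<lambda>z. - 1 * M_taylor ?x 1 z + 4 * \<kappa>\<^sup>2 * M_taylor ?x 2 z] ! j"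
  let ?P = "\<lambda>j. [N_taylor ?x 0, \<lambda>z. - 2 * \<kappa> * N_taylor ?x 1 z, \<lambda>z. - 1 * N_taylor ?x 1 z + 4 * \<kappa>\<^sup>2 * N_taylor ?x 2 z] ! j"
  let ?d = "\<lambda>j. ?P j 1 - of_real \<alpha> * ?E (j + 2) 1
      + of_real \<beta> * (\<kappa>\<^sup>2 * ?E (j + 2) 1 + 2 * \<kappa> * ?E (j + 1) 1 + ?E j 1)"
  \<comment> \<open>These are the coefficients of 1, h and h^2 in the characteristic function at -
    (\<kappa> + h)^2. Once the first two coefficients in x vanish, the third one enters with the
    nonzero factor 4 \<kappa>^2.\<close>
  have d: "?d 0 = char_coeff \<beta> \<alpha> ?x 0" "?d 1 = - 2 * \<kappa> * char_coeff \<beta> \<alpha> ?x 1"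
    "?d 2 = - char_coeff \<beta> \<alpha> ?x 1 + 4 * \<kappa>\<^sup>2 * char_coeff \<beta> \<alpha> ?x 2"
    by (simp_all add: char_coeff_def algebra_simps power2_eq_square)
  have "alg_mult (L_graph a \<beta> \<alpha>) \<kappa> = Suc 1"
  proof (rule alg_mult_chain[where E = ?E and P = ?P, OF assms(1) _ _ _ _ refl])
    fix j :: nat assume "j \<le> Suc 1"
    then consider "j = 0" | "j = 1" | "j = 2" by linarith
    then show "solves (?E (j + 2)) (?P j) (\<lambda>z. - (\<kappa>\<^sup>2 * ?E (j + 2) z + 2 * \<kappa> * ?E (j + 1) z + ?E j z))"
    proof cases
      case 1
      then show ?thesis using solves_M_taylor_0[of ?x] by simp
    next
      case 2
      then show ?thesis
        by (intro solves_cong[OF solves_cmult[OF solves_M_taylor_1[of ?x], of "- 2 * \<kappa>"]])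
          (auto simp: fun_eq_iff algebra_simps)
    next
      case 3
      then show ?thesis
        by (intro solves_cong[OF solves_add[OF solves_cmult[OF solves_M_taylor_1[of ?x], of "- 1"]
              solves_cmult[OF solves_M_taylor_2[of ?x], of "4 * \<kappa>\<^sup>2"]]])
          (auto simp: fun_eq_iff algebra_simps power2_eq_square)
    qed
  next
    fix j :: nat assume "j \<le> 1"
    then consider "j = 0" | "j = 1" by linarith
    then show "?d j = 0" using c d by cases simp_all
  next
    show "?d (Suc 1) \<noteq> 0"
      using c d(3) assms(2) unfolding Suc_1 by simp
  qed simp_all
  then show ?thesis by simp
qed

lemma alg_mult_zero_double:
  assumes "\<beta> \<noteq> 0" and c: "char_coeff \<beta> \<alpha> 0 0 = 0" "char_coeff \<beta> \<alpha> 0 1 \<noteq> 0"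
  shows "alg_mult (L_graph a \<beta> \<alpha>) 0 = 2"
proof -
  let ?E = "\<lambda>j. [\<lambda>_. 0, \<lambda>_. 0, M_taylor 0 0, \<lambda>_. 0, \<lambda>z. - 1 * M_taylor 0 1 z] ! j"
  let ?P = "\<lambda>j. [N_taylor 0 0, \<lambda>_. 0, \<lambda>z. - 1 * N_taylor 0 1 z] ! j"
  let ?d = "\<lambda>j. ?P j 1 - of_real \<alpha> * ?E (j + 2) 1
      + of_real \<beta> * (0\<^sup>2 * ?E (j + 2) 1 + 2 * 0 * ?E (j + 1) 1 + ?E j 1)"
  \<comment> \<open>At \<kappa> = 0 the substituted argument is - h^2. The odd defects vanish, so a
    simple root in x already gives a chain of length two.\<close>
  have d: "?d 0 = char_coeff \<beta> \<alpha> 0 0" "?d 1 = 0" "?d 2 = - char_coeff \<beta> \<alpha> 0 1"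
    by (simp_all add: char_coeff_def algebra_simps)
  have "alg_mult (L_graph a \<beta> \<alpha>) 0 = Suc 1"
  proof (rule alg_mult_chain[where E = ?E and P = ?P, OF assms(1) _ _ _ _ refl])
    fix j :: nat assume "j \<le> Suc 1"
    then consider "j = 0" | "j = 1" | "j = 2" by linarith
    then show "solves (?E (j + 2)) (?P j) (\<lambda>z. - (0\<^sup>2 * ?E (j + 2) z + 2 * 0 * ?E (j + 1) z + ?E j z))"
    proof cases
      case 1
      then show ?thesis using solves_M_taylor_0[of 0] by simp
    next
      case 2
      then show ?thesis using solves_zero by simp
    next
      case 3
      then show ?thesis
        by (intro solves_cong[OF solves_cmult[OF solves_M_taylor_1[of 0], of "- 1"]]) (auto simp: fun_eq_iff)
    qed
  next
    fix j :: nat assume "j \<le> 1"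
    then consider "j = 0" | "j = 1" by linarith
    then show "?d j = 0" using c d by cases simp_all
  next
    show "?d (Suc 1) \<noteq> 0"
      using c d(3) unfolding Suc_1 by simp
  qed simp_all
  then show ?thesis by simp
qed

lemma alg_mult_zero_quadruple:
  assumes "\<beta> \<noteq> 0"
    and c: "char_coeff \<beta> \<alpha> 0 0 = 0" "char_coeff \<beta> \<alpha> 0 1 = 0" "char_coeff \<beta> \<alpha> 0 2 \<noteq> 0"
  shows "alg_mult (L_graph a \<beta> \<alpha>) 0 = 4"
proof -
  let ?E = "\<lambda>j. [\<lambda>_. 0, \<lambda>_. 0, M_taylor 0 0, \<lambda>_. 0, \<lambda>z. - 1 * M_taylor 0 1 z, \<lambda>_. 0, M_taylor 0 2] ! j"
  let ?P = "\<lambda>j. [N_taylor 0 0, \<lambda>_. 0, \<lambda>z. - 1 * N_taylor 0 1 z, \<lambda>_. 0, N_taylor 0 2] ! j"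
  let ?d = "\<lambda>j. ?P j 1 - of_real \<alpha> * ?E (j + 2) 1
      + of_real \<beta> * (0\<^sup>2 * ?E (j + 2) 1 + 2 * 0 * ?E (j + 1) 1 + ?E j 1)"
  \<comment> \<open>The second Taylor coefficient in x first shows up at h^4, with factor
    one.\<close>
  have d: "?d 0 = char_coeff \<beta> \<alpha> 0 0" "?d 1 = 0" "?d 2 = - char_coeff \<beta> \<alpha> 0 1" "?d 3 = 0"
    "?d 4 = char_coeff \<beta> \<alpha> 0 2"
    by (simp_all add: char_coeff_def algebra_simps)
  have "alg_mult (L_graph a \<beta> \<alpha>) 0 = Suc 3"
  proof (rule alg_mult_chain[where E = ?E and P = ?P, OF assms(1) _ _ _ _ refl])
    fix j :: nat assume "j \<le> Suc 3"
    then consider "j = 0" | "j = 1" | "j = 2" | "j = 3" | "j = 4" by linarith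
    then show "solves (?E (j + 2)) (?P j) (\<lambda>z. - (0\<^sup>2 * ?E (j + 2) z + 2 * 0 * ?E (j + 1) z + ?E j z))"
    proof cases
      case 1
      then show ?thesis using solves_M_taylor_0[of 0] by simp
    next
      case 2
      then show ?thesis using solves_zero by simp
    next
      case 3
      then show ?thesis
        by (intro solves_cong[OF solves_cmult[OF solves_M_taylor_1[of 0], of "- 1"]]) (auto simp: fun_eq_iff)
    next
      case 4
      then show ?thesis using solves_zero by simp
    next
      case 5
      then show ?thesis using solves_M_taylor_2[of 0] by simp
    qed
  next
    fix j :: nat assume "j \<le> 3"
    then consider "j = 0" | "j = 1" | "j = 2" | "j = 3" by linarith
    then show "?d j = 0" using c d by cases simp_all
  next
    show "?d (Suc 3) \<noteq> 0"
      using c d(5) by (simp add: eval_nat_numeral)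
  qed simp_all
  then show ?thesis by simp
qed

section \<open>The function B near the origin\<close>

lemma M_coeff_pos: "0 < z \<Longrightarrow> z \<le> 1 \<Longrightarrow> M_coeff 0 z > 0"
  unfolding M_coeff_def N_coeff.simps(1)
proof (rule integral_pos_if_continuous[of _ _ _ 0])
  assume z: "0 < z" "z \<le> 1"
  show "continuous_on {0..z} (\<lambda>t. 1 / a t ^ 3 * 1)"
    using z by (intro continuous_on_subset[OF continuous_on_mult_right[OF cont_inv_a3]]) auto
  show "0 \<le> 1 / a x ^ 3 * 1" if "x \<in> {0..z}" for x
    using a_pos[of x] that z by simp
qed (use a_pos[of 0] in auto)

lemma N_coeff_1_pos: "N_coeff 1 1 > 0"
  unfolding One_nat_def N_coeff_Suc
proof (rule integral_pos_if_continuous[of _ _ _ 1])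
  show "continuous_on {0..1} (\<lambda>s. a s * M_coeff 0 s)"
    by (intro continuous_intros cont_a cont_M_coeff)
  show "0 \<le> a x * M_coeff 0 x" if "x \<in> {0..1}" for x
    using a_pos[OF that] coeff_nonneg(2)[OF that] by (simp add: less_imp_le)
qed (use a_pos[of 1] M_coeff_pos[of 1] in auto)

text \<open>The difference of the two sides is the integral of a^(-3) times
  \<open>N_coeff 1 1 - N_coeff 1 t\<close>, and \<open>N_coeff 1\<close> increases from 0 to a
  positive value. The difference is also the numerator of \<open>B_ext1 0\<close>, so the critical
  surface tension is positive.\<close>

lemma M_coeff_1_less: "M_coeff 1 1 < N_coeff 1 1 * M_coeff 0 1"
proof -
  let ?f = "\<lambda>t. 1 / a t ^ 3 * (N_coeff 1 1 - N_coeff 1 t)"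
  have m: "N_coeff 1 t \<le> N_coeff 1 1" if t: "t \<in> {0..1}" for t
  proof -
    have i: "(\<lambda>s. a s * M_coeff 0 s) integrable_on {u..v}" if "0 \<le> u" "v \<le> 1" for u v
      using that by (intro integrable_on_01 continuous_intros cont_a cont_M_coeff)
    have "integral {0..t} (\<lambda>s. a s * M_coeff 0 s) \<le> integral {0..1} (\<lambda>s. a s * M_coeff 0 s)"
      using t a_pos coeff_nonneg(2)
      by (intro integral_subset_le i) (auto simp: less_imp_le)
    then show ?thesis unfolding One_nat_def N_coeff_Suc .
  qed
  have c: "continuous_on {0..1} ?f"
    by (intro continuous_on_mult cont_inv_a3 continuous_on_diff cont_N_coeff continuous_on_const)
  have "0 < integral {0..1} ?f"
  proof (rule integral_pos_if_continuous[OF c, of 0])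
    show "0 \<le> ?f t" if "t \<in> {0..1}" for t
      using a_pos[OF that] m[OF that] by simp
    have "N_coeff 1 0 = 0" unfolding One_nat_def N_coeff_Suc by simp
    then show "0 < ?f 0" using a_pos[of 0] N_coeff_1_pos by simp
  qed simp_all
  also have "integral {0..1} ?f = integral {0..1} (\<lambda>t. N_coeff 1 1 * (1 / a t ^ 3 * N_coeff 0 t) - 1 / a t ^ 3 * N_coeff 1 t)"
    by (simp add: algebra_simps)
  also have "\<dots> = N_coeff 1 1 * M_coeff 0 1 - M_coeff 1 1"
  proof -
    have i: "(\<lambda>t. 1 / a t ^ 3 * N_coeff j t) integrable_on {0..1}" for j
      by (intro integrable_on_01 continuous_on_mult cont_inv_a3 cont_N_coeff) simp_all
    show ?thesis
      unfolding M_coeff_def Henstock_Kurzweil_Integration.integral_diff[OF integrable_on_mult_right[OF i] i]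
        Henstock_Kurzweil_Integration.integral_mult_right ..
  qed
  finally show ?thesis by simp
qed

lemma taylor_at_origin: "M_taylor 0 j z = of_real (M_coeff j z)" "N_taylor 0 j z = of_real (N_coeff j z)"
proof -
  \<comment> \<open>Only k = j survives, through 0 ^ 0 = 1.\<close>
  have t: "pow_taylor 0 j k = (if k = j then 1 else 0)" for k
    by (cases "j \<le> k") (auto simp: pow_taylor_def binomial_eq_0)
  have "(\<lambda>k. pow_taylor 0 j k * of_real (M_coeff k z)) sums of_real (M_coeff j z)"
    "(\<lambda>k. pow_taylor 0 j k * of_real (N_coeff k z)) sums of_real (N_coeff j z)"
    using sums_single[of j "\<lambda>k. complex_of_real (M_coeff k z)"] sums_single[of j "\<lambda>k. complex_of_real (N_coeff k z)"]
    by (simp_all add: t if_distrib[of "\<lambda>x. x * _"] cong: if_cong)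
  then show "M_taylor 0 j z = of_real (M_coeff j z)" "N_taylor 0 j z = of_real (N_coeff j z)"
    by (simp_all add: M_taylor_def N_taylor_def M_series_def N_series_def sums_iff)
qed

text \<open>\<open>B_ext x\<close> continues \<open>frakB\<close> at \<open>\<nu> = - x\<close>; \<open>B_ext1\<close> and \<open>B_ext2\<close> are its derivatives in \<open>x\<close>.\<close>

definition B_ext :: "complex \<Rightarrow> complex" where
  "B_ext x = N_taylor x 0 1 / M_taylor x 0 1"

definition B_ext1 :: "complex \<Rightarrow> complex" where
  "B_ext1 x = (N_taylor x 1 1 - B_ext x * M_taylor x 1 1) / M_taylor x 0 1"

definition B_ext2 :: "complex \<Rightarrow> complex" where
  "B_ext2 x = 2 * (N_taylor x 2 1 - B_ext1 x * M_taylor x 1 1 - B_ext x * M_taylor x 2 1) / M_taylor x 0 1"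

lemma B_ext_deriv:
  assumes "M_taylor x 0 1 \<noteq> 0"
  shows "(B_ext has_field_derivative B_ext1 x) (at x)"
  unfolding B_ext_def[abs_def] using assms M_taylor_param_deriv[of 1 0 x] N_taylor_param_deriv[of 1 0 x]
  by (auto intro!: derivative_eq_intros simp: B_ext1_def B_ext_def divide_simps)

lemma B_ext1_deriv:
  assumes "M_taylor x 0 1 \<noteq> 0"
  shows "(B_ext1 has_field_derivative B_ext2 x) (at x)"
  unfolding B_ext1_def[abs_def]
  using assms M_taylor_param_deriv[of 1 0 x] M_taylor_param_deriv[of 1 1 x] N_taylor_param_deriv[of 1 1 x] B_ext_deriv[OF assms]
  by (auto intro!: derivative_eq_intros simp: B_ext2_def B_ext1_def divide_simps numeral_2_eq_2[symmetric])

text \<open>The characteristic function factors as M(1) times (B - \<alpha> - \<beta> x). The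
  identities are this factorization and the Leibniz rule for its first two derivatives; the doubled
  left side of the last one undoes the normalization by 2!.\<close>

lemma char_coeff_B_ext:
  assumes "M_taylor x 0 1 \<noteq> 0"
  shows "char_coeff \<beta> \<alpha> x 0 = M_taylor x 0 1 * (B_ext x - of_real \<alpha> - of_real \<beta> * x)"
    and "char_coeff \<beta> \<alpha> x 1 = M_taylor x 0 1 * (B_ext1 x - of_real \<beta>) + M_taylor x 1 1 * (B_ext x - of_real \<alpha> - of_real \<beta> * x)"
    and "2 * char_coeff \<beta> \<alpha> x 2 = M_taylor x 0 1 * B_ext2 x + 2 * M_taylor x 1 1 * (B_ext1 x - of_real \<beta>)
      + 2 * M_taylor x 2 1 * (B_ext x - of_real \<alpha> - of_real \<beta> * x)"
proof -
  have 0: "N_taylor x 0 1 = M_taylor x 0 1 * B_ext x"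
    using assms by (simp add: B_ext_def)
  have "M_taylor x 0 1 * B_ext1 x = N_taylor x 1 1 - B_ext x * M_taylor x 1 1"
    using assms by (simp add: B_ext1_def)
  then have 1: "N_taylor x 1 1 = M_taylor x 0 1 * B_ext1 x + B_ext x * M_taylor x 1 1"
    by simp
  have "M_taylor x 0 1 * B_ext2 x = 2 * (N_taylor x 2 1 - B_ext1 x * M_taylor x 1 1 - B_ext x * M_taylor x 2 1)"
    using assms by (simp add: B_ext2_def)
  then have 2: "2 * N_taylor x 2 1 = M_taylor x 0 1 * B_ext2 x + 2 * B_ext1 x * M_taylor x 1 1 + 2 * B_ext x * M_taylor x 2 1"
    by (simp add: algebra_simps)
  show "char_coeff \<beta> \<alpha> x 0 = M_taylor x 0 1 * (B_ext x - of_real \<alpha> - of_real \<beta> * x)"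
    by (simp add: char_coeff_def 0 algebra_simps)
  show "char_coeff \<beta> \<alpha> x 1 = M_taylor x 0 1 * (B_ext1 x - of_real \<beta>) + M_taylor x 1 1 * (B_ext x - of_real \<alpha> - of_real \<beta> * x)"
    by (simp add: char_coeff_def 1[unfolded One_nat_def] algebra_simps)
  have "2 * char_coeff \<beta> \<alpha> x 2
     = 2 * N_taylor x 2 1 - 2 * (of_real \<alpha> + of_real \<beta> * x) * M_taylor x 2 1 - 2 * of_real \<beta> * M_taylor x 1 1"
    by (simp add: char_coeff_def algebra_simps)
  then show "2 * char_coeff \<beta> \<alpha> x 2 = M_taylor x 0 1 * B_ext2 x + 2 * M_taylor x 1 1 * (B_ext1 x - of_real \<beta>)
      + 2 * M_taylor x 2 1 * (B_ext x - of_real \<alpha> - of_real \<beta> * x)"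
    unfolding 2 by (simp add: algebra_simps)
qed

text \<open>The real shooting solutions are given rather than constructed. Uniqueness of the initial
  value problem identifies them with the series, and thereby \<open>frakB\<close> with
  \<open>B_ext\<close> on the real axis.\<close>

lemma shoots_M_taylor:
  assumes "shoots a \<nu> f"
  shows "of_real (f 1) = M_taylor (of_real (- \<nu>)) 0 1"
    and "of_real (a 1 ^ 3 * vector_derivative f (at 1 within {0..1})) = N_taylor (of_real (- \<nu>)) 0 1"
proof -
  obtain f' where f': "\<And>z. z \<in> {0..1} \<Longrightarrow> (f has_real_derivative f' z) (at z within {0..1})"
    "\<And>z. z \<in> {0..1} \<Longrightarrow> ((\<lambda>s. a s ^ 3 * f' s) has_real_derivative - \<nu> * a z * f z) (at z within {0..1})"
    and i: "f 0 = 0" "f' 0 = 1 / a 0 ^ 3"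
    using assms unfolding shoots_def by blast
  have R: "((\<lambda>z. complex_of_real (g z)) has_vector_derivative of_real g') (at z within S)"
    if "(g has_real_derivative g') (at z within S)" for g g' z S
    using that unfolding has_real_derivative_iff_has_vector_derivative
    by (rule bounded_linear.has_vector_derivative[OF bounded_linear_of_real])
  have "of_real (f z) = of_real (a 0 ^ 3 * f' 0) * M_taylor (of_real (- \<nu>)) 0 z \<and>
      of_real (a z ^ 3 * f' z) = of_real (a 0 ^ 3 * f' 0) * N_taylor (of_real (- \<nu>)) 0 z"
    if "z \<in> {0..1}" for z
  proof (rule ivp_solution[OF _ _ _ that, of "\<lambda>z. of_real (f z)" "\<lambda>z. of_real (a z ^ 3 * f' z)"])
    fix t :: real assume t: "t \<in> {0..1}"
    show "((\<lambda>z. complex_of_real (f z)) has_vector_derivative (1 / a t ^ 3) *\<^sub>R of_real (a t ^ 3 * f' t)) (at t within {0..1})"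
      using R[OF f'(1)[OF t]] a_pos[OF t]
      by (simp add: scaleR_conv_of_real)
    show "((\<lambda>z. complex_of_real (a z ^ 3 * f' z)) has_vector_derivative
        a t *\<^sub>R (of_real (- \<nu>) * of_real (f t))) (at t within {0..1})"
      using R[OF f'(2)[OF t]]
      by (simp add: scaleR_conv_of_real mult_ac)
  qed (simp add: i)
  from this[of 1] have *: "of_real (f 1) = M_taylor (of_real (- \<nu>)) 0 1"
    "of_real (a 1 ^ 3 * f' 1) = N_taylor (of_real (- \<nu>)) 0 1"
    using i a_pos[of 0] by auto
  have "vector_derivative f (at 1 within {0..1}) = f' 1"
    using f'(1)[of 1] by (intro vector_derivative_within_closed_interval)
      (auto simp: has_real_derivative_iff_has_vector_derivative)
  with * show "of_real (f 1) = M_taylor (of_real (- \<nu>)) 0 1"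
    "of_real (a 1 ^ 3 * vector_derivative f (at 1 within {0..1})) = N_taylor (of_real (- \<nu>)) 0 1"
    by simp_all
qed

lemma frakB_eq_B_ext:
  assumes "shoots a \<nu> (M \<nu>)"
  shows "of_real (frakB a M \<nu>) = B_ext (of_real (- \<nu>))"
  using shoots_M_taylor[OF assms] unfolding frakB_def B_ext_def of_real_divide by simp

lemma M_taylor_origin_nonzero: "M_taylor 0 0 1 \<noteq> 0"
  using M_coeff_pos[of 1] by (simp add: taylor_at_origin)

lemma eventually_M_taylor_nonzero: "\<forall>\<^sub>F x in nhds 0. M_taylor x 0 1 \<noteq> 0"
proof -
  have "isCont (\<lambda>x. M_taylor x 0 1) 0"
    using M_taylor_param_deriv[of 1 0 0] DERIV_isCont by auto
  then have "\<forall>\<^sub>F x in at 0. M_taylor x 0 1 \<noteq> 0"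
    unfolding isCont_def using M_taylor_origin_nonzero by (intro tendsto_imp_eventually_ne)
  then show ?thesis
    using M_taylor_origin_nonzero by (simp add: eventually_nhds_conv_at)
qed

lemma B_ext_origin: "B_ext 0 = of_real (1 / M_coeff 0 1)"
  by (simp add: B_ext_def taylor_at_origin)

lemma B_ext1_origin: "B_ext1 0 = of_real ((N_coeff 1 1 * M_coeff 0 1 - M_coeff 1 1) / (M_coeff 0 1)\<^sup>2)"
  using M_coeff_pos[of 1] by (simp add: B_ext1_def B_ext_origin taylor_at_origin field_simps power2_eq_square)

lemma eventually_nhds_of_real:
  assumes "\<forall>\<^sub>F x in nhds 0. P x"
  shows "\<forall>\<^sub>F t in nhds 0. P (complex_of_real t)" "\<forall>\<^sub>F t in nhds 0. P (complex_of_real (- t))"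
proof -
  have "filterlim complex_of_real (nhds 0) (nhds 0)" "filterlim (\<lambda>t. complex_of_real (- t)) (nhds 0) (nhds 0)"
    using tendsto_of_real[OF filterlim_ident[of "nhds (0::real)"], where ?'a = complex]
      tendsto_of_real[OF tendsto_minus[OF filterlim_ident[of "nhds (0::real)"]], where ?'a = complex]
    by simp_all
  then show "\<forall>\<^sub>F t in nhds 0. P (complex_of_real t)" "\<forall>\<^sub>F t in nhds 0. P (complex_of_real (- t))"
    using assms by (auto simp: filterlim_iff)
qed

text \<open>The substitution \<nu> = - x reverses the sign of the first derivative and keeps that of
  the second.\<close>

lemma frakB_derivs:
  assumes "\<forall>\<^sub>F \<nu> in nhds 0. shoots a \<nu> (M \<nu>)"
  shows "\<forall>\<^sub>F \<nu> in nhds 0. (frakB a M has_real_derivative - Re (B_ext1 (of_real (- \<nu>)))) (at \<nu>)"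
    and "deriv (deriv (frakB a M)) 0 = Re (B_ext2 0)"
proof -
  have nz: "\<forall>\<^sub>F \<nu> in nhds 0. M_taylor (of_real (- \<nu>)) 0 1 \<noteq> 0"
    by (rule eventually_nhds_of_real(2)[OF eventually_M_taylor_nonzero])
  have d: "((\<lambda>s. Re (f (of_real (- s)))) has_real_derivative - Re f') (at \<nu>)"
    if "(f has_field_derivative f') (at (of_real (- \<nu>)))" for f f' \<nu>
    using DERIV_chain2[OF real_axis_derivative(1)[OF that] DERIV_minus[OF DERIV_ident]] by simp
  have "\<forall>\<^sub>F \<nu> in nhds 0. frakB a M \<nu> = Re (B_ext (of_real (- \<nu>)))"
    using assms by eventually_elim (metis Re_complex_of_real frakB_eq_B_ext)
  \<comment> \<open>Differentiating at \<nu> needs the identity on a neighbourhood of \<nu>, not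
    just at \<nu>.\<close>
  then have "\<forall>\<^sub>F \<nu> in nhds 0. \<forall>\<^sub>F \<mu> in nhds \<nu>. frakB a M \<mu> = Re (B_ext (of_real (- \<mu>)))"
    by (simp add: eventually_eventually)
  with nz show 1: "\<forall>\<^sub>F \<nu> in nhds 0. (frakB a M has_real_derivative - Re (B_ext1 (of_real (- \<nu>)))) (at \<nu>)"
  proof eventually_elim
    case (elim \<nu>)
    then show ?case
      using d[OF B_ext_deriv[OF elim(1)]] DERIV_cong_ev[OF refl elim(2) refl] by blast
  qed
  have "\<forall>\<^sub>F \<nu> in nhds 0. deriv (frakB a M) \<nu> = - Re (B_ext1 (of_real (- \<nu>)))"
    using 1 by eventually_elim (rule DERIV_imp_deriv)
  then have "deriv (deriv (frakB a M)) 0 = deriv (\<lambda>\<nu>. - Re (B_ext1 (of_real (- \<nu>)))) 0"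
    by (intro deriv_cong_ev) auto
  also have "\<dots> = Re (B_ext2 0)"
    using DERIV_minus[OF d[of B_ext1 "B_ext2 0" 0]] B_ext1_deriv[OF M_taylor_origin_nonzero]
    by (intro DERIV_imp_deriv) simp
  finally show "deriv (deriv (frakB a M)) 0 = Re (B_ext2 0)" .
qed

text \<open>On the real axis \<open>B_ext\<close> agrees with the real function
  \<open>frakB\<close>. Its imaginary part vanishes on an interval, and so does the derivative of
  that part.\<close>

lemma B_ext_real:
  assumes "\<forall>\<^sub>F \<nu> in nhds 0. shoots a \<nu> (M \<nu>)"
  shows "\<forall>\<^sub>F t in nhds 0. Im (B_ext (of_real t)) = 0 \<and> Im (B_ext1 (of_real t)) = 0"
proof -
  have "filterlim uminus (nhds 0) (nhds (0::real))"
    using tendsto_minus[OF filterlim_ident[of "nhds (0::real)"]] by simp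
  then have "\<forall>\<^sub>F t in nhds 0. shoots a (- t) (M (- t))"
    using assms by (auto simp: filterlim_iff)
  then have 0: "\<forall>\<^sub>F t in nhds 0. Im (B_ext (of_real t)) = 0"
    by eventually_elim (metis Im_complex_of_real add.inverse_inverse frakB_eq_B_ext)
  then have "\<forall>\<^sub>F t in nhds 0. \<forall>\<^sub>F s in nhds t. Im (B_ext (of_real s)) = 0"
    by (simp add: eventually_eventually)
  with 0 eventually_nhds_of_real(1)[OF eventually_M_taylor_nonzero] show ?thesis
  proof eventually_elim
    case (elim t)
    have "((\<lambda>s. Im (B_ext (of_real s))) has_real_derivative Im (B_ext1 (of_real t))) (at t)"
      by (rule real_axis_derivative(2)[OF B_ext_deriv[OF elim(2)]])
    then have "((\<lambda>_. 0) has_real_derivative Im (B_ext1 (of_real t))) (at t)"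
      using DERIV_cong_ev[OF refl elim(3) refl] by blast
    then show ?case
      using elim(1) DERIV_unique[OF _ DERIV_const] by blast
  qed
qed

section \<open>Resonances as double roots of the characteristic function\<close>

lemma double_root_iff:
  assumes "M_taylor x 0 1 \<noteq> 0" "Im (B_ext x) = 0" "Im (B_ext1 x) = 0" "Im x = 0"
  shows "char_coeff \<beta> \<alpha> x 0 = 0 \<and> char_coeff \<beta> \<alpha> x 1 = 0
    \<longleftrightarrow> \<beta> = Re (B_ext1 x) \<and> \<alpha> = Re (B_ext x) - Re x * Re (B_ext1 x)"
proof -
  have "char_coeff \<beta> \<alpha> x 0 = 0 \<and> char_coeff \<beta> \<alpha> x 1 = 0
    \<longleftrightarrow> B_ext x - of_real \<alpha> - of_real \<beta> * x = 0 \<and> B_ext1 x - of_real \<beta> = 0"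
    using char_coeff_B_ext(1,2)[OF assms(1), of \<beta> \<alpha>] assms(1) by auto
  also have "\<dots> \<longleftrightarrow> Re (B_ext x) - \<alpha> - \<beta> * Re x = 0 \<and> Re (B_ext1 x) - \<beta> = 0"
    using assms by (simp add: complex_eq_iff)
  finally show ?thesis by (auto simp: algebra_simps)
qed

text \<open>At a double root the lower terms of the Leibniz expansion drop out and leave M(1) B'' /
  2. This is where the nondegeneracy condition acts.\<close>

lemma double_root_third_coeff:
  assumes "M_taylor x 0 1 \<noteq> 0" "B_ext2 x \<noteq> 0" "char_coeff \<beta> \<alpha> x 0 = 0" "char_coeff \<beta> \<alpha> x 1 = 0"
  shows "char_coeff \<beta> \<alpha> x 2 \<noteq> 0"
proof -
  have "B_ext x - of_real \<alpha> - of_real \<beta> * x = 0"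
    using assms char_coeff_B_ext(1)[of x] by simp
  moreover from this have "B_ext1 x - of_real \<beta> = 0"
    using assms char_coeff_B_ext(2)[of x \<beta> \<alpha>] by simp
  ultimately show ?thesis
    using assms char_coeff_B_ext(3)[of x \<beta> \<alpha>] by auto
qed

text \<open>Multiplicity two is separated from both sides: a simple root gives multiplicity one, and
  the nonzero second derivative of B stops the chain after two links.\<close>

lemma hamiltonian_hopf_iff:
  assumes x: "x = of_real (q\<^sup>2)" and q: "q \<noteq> 0" and \<beta>: "\<beta> \<noteq> 0"
    and nz: "M_taylor x 0 1 \<noteq> 0" "B_ext2 x \<noteq> 0"
  shows "hamiltonian_hopf a \<beta> \<alpha> q \<longleftrightarrow> char_coeff \<beta> \<alpha> x 0 = 0 \<and> char_coeff \<beta> \<alpha> x 1 = 0"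
proof -
  have "is_eigenvalue (L_graph a \<beta> \<alpha>) \<kappa> \<and> alg_mult (L_graph a \<beta> \<alpha>) \<kappa> = 2
      \<longleftrightarrow> char_coeff \<beta> \<alpha> x 0 = 0 \<and> char_coeff \<beta> \<alpha> x 1 = 0"
    if k: "\<kappa> \<in> {\<i> * of_real q, - \<i> * of_real q}" for \<kappa>
  proof -
    have k0: "\<kappa> \<noteq> 0" and kx: "- \<kappa>\<^sup>2 = x"
      using k q by (auto simp: x power_mult_distrib)
    show ?thesis
      using eigenvalue_iff[OF \<beta>, of \<alpha> \<kappa>] alg_mult_nonzero_simple[OF \<beta> k0, of \<alpha>]
        alg_mult_nonzero_double[OF \<beta> k0, of \<alpha>] double_root_third_coeff[OF nz, of \<beta> \<alpha>]
      unfolding kx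
      by (cases "char_coeff \<beta> \<alpha> x 0 = 0"; cases "char_coeff \<beta> \<alpha> x 1 = 0") simp_all
  qed
  then show ?thesis
    unfolding hamiltonian_hopf_def by blast
qed

text \<open>With B'' nonzero, a root at x = 0 gives multiplicity two if simple and four if double,
  so four characterizes the double root.\<close>

lemma zero4_resonance_iff:
  assumes \<beta>: "\<beta> \<noteq> 0" and nz: "B_ext2 0 \<noteq> 0"
  shows "zero4_resonance a \<beta> \<alpha> \<longleftrightarrow> char_coeff \<beta> \<alpha> 0 0 = 0 \<and> char_coeff \<beta> \<alpha> 0 1 = 0"
  unfolding zero4_resonance_def
  using eigenvalue_iff[OF \<beta>, of \<alpha> 0] alg_mult_zero_double[OF \<beta>, of \<alpha>]
    alg_mult_zero_quadruple[OF \<beta>, of \<alpha>] double_root_third_coeff[OF M_taylor_origin_nonzero nz, of \<beta> \<alpha>]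
  by (cases "char_coeff \<beta> \<alpha> 0 0 = 0"; cases "char_coeff \<beta> \<alpha> 0 1 = 0") simp_all

text \<open>One radius is needed for two kinds of facts: those about the series hold on a complex
  neighbourhood of 0, those that refer to \<open>M\<close> on a real one.\<close>

lemma resonances_near_origin:
  assumes M: "\<forall>\<^sub>F \<nu> in nhds 0. shoots a \<nu> (M \<nu>)"
    and nondeg: "deriv (deriv (frakB a M)) 0 < 0"
  obtains r \<epsilon> where "r > 0" "\<epsilon> > 0" "B_ext holomorphic_on ball 0 r" "B_ext1 holomorphic_on ball 0 r"
    "\<And>x. x \<in> ball 0 r \<Longrightarrow> Re (B_ext1 x) > 0"
    "\<And>t. \<bar>t\<bar> < r \<Longrightarrow> Re (B_ext (of_real t)) - t * Re (B_ext1 (of_real t)) > \<epsilon>"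
    "\<And>t \<beta> \<alpha>. \<bar>t\<bar> < r \<Longrightarrow> line_tangent (frakB a M) \<beta> \<alpha> (- t)
      \<longleftrightarrow> \<beta> = Re (B_ext1 (of_real t)) \<and> \<alpha> = Re (B_ext (of_real t)) - t * Re (B_ext1 (of_real t))"
    "\<And>q \<beta> \<alpha>. q \<noteq> 0 \<Longrightarrow> q\<^sup>2 < r \<Longrightarrow> \<beta> \<noteq> 0 \<Longrightarrow> hamiltonian_hopf a \<beta> \<alpha> q
      \<longleftrightarrow> line_tangent (frakB a M) \<beta> \<alpha> (- (q\<^sup>2))"
    "\<And>\<beta> \<alpha>. \<beta> \<noteq> 0 \<Longrightarrow> zero4_resonance a \<beta> \<alpha> \<longleftrightarrow> line_tangent (frakB a M) \<beta> \<alpha> 0"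
proof -
  have C2: "B_ext2 0 \<noteq> 0"
    using nondeg frakB_derivs(2)[OF M] by auto
  \<comment> \<open>Half of B(0), the value of \<alpha> at the point of tangency for \<nu> = 0; by
    continuity \<alpha> stays above it nearby.\<close>
  define \<epsilon> where "\<epsilon> = 1 / M_coeff 0 1 / 2"
  have \<epsilon>: "\<epsilon> > 0" using M_coeff_pos[of 1] by (simp add: \<epsilon>_def)
  have cont: "isCont B_ext 0" "isCont B_ext1 0" "isCont B_ext2 0"
  proof -
    show "isCont B_ext 0" "isCont B_ext1 0"
      using B_ext_deriv[OF M_taylor_origin_nonzero] B_ext1_deriv[OF M_taylor_origin_nonzero] DERIV_isCont by blast+
    then show "isCont B_ext2 0"
      unfolding B_ext2_def[abs_def]
      using M_taylor_param_deriv[of 1 _ 0, THEN DERIV_isCont] N_taylor_param_deriv[of 1 _ 0, THEN DERIV_isCont]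
      by (intro continuous_intros) (auto simp: M_taylor_origin_nonzero)
  qed
  have near: "\<forall>\<^sub>F x in nhds 0. g x > e" if "isCont g 0" "g 0 > e" for g :: "complex \<Rightarrow> real" and e
    using that order_tendstoD(1)[of g "g 0" "at 0" e]
    by (auto simp: isCont_def eventually_nhds_conv_at)
  have "\<forall>\<^sub>F x in nhds 0. M_taylor x 0 1 \<noteq> 0 \<and> norm (B_ext2 x) > 0 \<and> Re (B_ext1 x) > 0 \<and>
      Re (B_ext x) - Re x * Re (B_ext1 x) > \<epsilon>"
  proof (intro eventually_conj eventually_M_taylor_nonzero near continuous_Re continuous_norm
      continuous_diff continuous_mult continuous_ident cont)
    have "\<epsilon> < 1 / M_coeff 0 1"
      using M_coeff_pos[of 1] by (simp add: \<epsilon>_def field_simps)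
    then show "\<epsilon> < Re (B_ext 0) - Re 0 * Re (B_ext1 0)"
      by (simp add: B_ext_origin)
  qed (use C2 M_coeff_pos[of 1] M_coeff_1_less in \<open>simp_all add: B_ext1_origin\<close>)
  then obtain r1 where r1: "r1 > 0" "\<And>x. x \<in> ball 0 r1 \<Longrightarrow> M_taylor x 0 1 \<noteq> 0 \<and> norm (B_ext2 x) > 0 \<and>
      Re (B_ext1 x) > 0 \<and> Re (B_ext x) - Re x * Re (B_ext1 x) > \<epsilon>"
    unfolding eventually_nhds_metric by (auto simp: dist_commute)
  have "filterlim uminus (nhds 0) (nhds (0::real))"
    using tendsto_minus[OF filterlim_ident[of "nhds (0::real)"]] by simp
  moreover have "\<forall>\<^sub>F \<nu> in nhds 0. shoots a \<nu> (M \<nu>) \<and>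
      (frakB a M has_real_derivative - Re (B_ext1 (of_real (- \<nu>)))) (at \<nu>)"
    by (intro eventually_conj M frakB_derivs(1))
  ultimately have "\<forall>\<^sub>F t in nhds 0. shoots a (- t) (M (- t)) \<and>
      (frakB a M has_real_derivative - Re (B_ext1 (of_real (- (- t))))) (at (- t))"
    unfolding filterlim_iff by blast
  with B_ext_real[OF M] have "\<forall>\<^sub>F t in nhds 0. (Im (B_ext (of_real t)) = 0 \<and> Im (B_ext1 (of_real t)) = 0) \<and>
      (shoots a (- t) (M (- t)) \<and> (frakB a M has_real_derivative - Re (B_ext1 (of_real t))) (at (- t)))"
    unfolding minus_minus by (rule eventually_conj)
  then obtain r2 where r2: "r2 > 0" "\<And>t. \<bar>t\<bar> < r2 \<Longrightarrow> Im (B_ext (of_real t)) = 0 \<and> Im (B_ext1 (of_real t)) = 0 \<and>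
      shoots a (- t) (M (- t)) \<and> (frakB a M has_real_derivative - Re (B_ext1 (of_real t))) (at (- t))"
    unfolding eventually_nhds_metric by (auto simp: dist_real_def)
  define r where "r = min r1 r2"
  have R1: "x \<in> ball 0 r1" if "x \<in> ball 0 r" for x :: complex using that by (simp add: r_def)
  have B: "complex_of_real t \<in> ball 0 r1" "\<bar>t\<bar> < r2" if "\<bar>t\<bar> < r" for t
    using that by (simp_all add: r_def)
  have tangent: "line_tangent (frakB a M) \<beta> \<alpha> (- t)
      \<longleftrightarrow> \<beta> = Re (B_ext1 (of_real t)) \<and> \<alpha> = Re (B_ext (of_real t)) - t * Re (B_ext1 (of_real t))"
    if t: "\<bar>t\<bar> < r" for t \<beta> \<alpha>
  proof -
    have s: "shoots a (- t) (M (- t))"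
      and d: "(frakB a M has_real_derivative - Re (B_ext1 (of_real t))) (at (- t))"
      using r2(2)[OF B(2)[OF t]] by auto
    have "frakB a M (- t) = Re (B_ext (of_real t))"
      using frakB_eq_B_ext[of "- t" M, OF s] by (metis Re_complex_of_real minus_minus)
    moreover have "(frakB a M has_real_derivative - \<beta>) (at (- t)) \<longleftrightarrow> \<beta> = Re (B_ext1 (of_real t))"
      using d DERIV_unique by fastforce
    ultimately show ?thesis
      by (auto simp: line_tangent_def algebra_simps)
  qed
  have double: "char_coeff \<beta> \<alpha> (of_real t) 0 = 0 \<and> char_coeff \<beta> \<alpha> (of_real t) 1 = 0
      \<longleftrightarrow> line_tangent (frakB a M) \<beta> \<alpha> (- t)" if t: "\<bar>t\<bar> < r" for t \<beta> \<alpha>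
    using double_root_iff[of "of_real t" \<beta> \<alpha>] r1(2)[OF B(1)[OF t]] r2(2)[OF B(2)[OF t]] tangent[OF t]
    by simp
  have r0: "r > 0" using r1(1) r2(1) by (simp add: r_def)
  show ?thesis
  proof (rule that[OF r0 \<epsilon>])
    show "B_ext holomorphic_on ball 0 r" "B_ext1 holomorphic_on ball 0 r"
      unfolding holomorphic_on_open[OF open_ball] using r1(2)[OF R1] B_ext_deriv B_ext1_deriv by blast+
    show "Re (B_ext1 x) > 0" if "x \<in> ball 0 r" for x
      using r1(2)[OF R1[OF that]] by simp
    show "Re (B_ext (of_real t)) - t * Re (B_ext1 (of_real t)) > \<epsilon>" if "\<bar>t\<bar> < r" for t
      using r1(2)[OF B(1)[OF that]] by simp
    show "line_tangent (frakB a M) \<beta> \<alpha> (- t)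
      \<longleftrightarrow> \<beta> = Re (B_ext1 (of_real t)) \<and> \<alpha> = Re (B_ext (of_real t)) - t * Re (B_ext1 (of_real t))"
      if "\<bar>t\<bar> < r" for t \<beta> \<alpha> by (rule tangent[OF that])
    show "hamiltonian_hopf a \<beta> \<alpha> q \<longleftrightarrow> line_tangent (frakB a M) \<beta> \<alpha> (- (q\<^sup>2))"
      if "q \<noteq> 0" "q\<^sup>2 < r" "\<beta> \<noteq> 0" for q \<beta> \<alpha>
    proof -
      have q: "\<bar>q\<^sup>2\<bar> < r" using that by simp
      show ?thesis
        using hamiltonian_hopf_iff[OF refl that(1,3), of \<alpha>] r1(2)[OF B(1)[OF q]] double[OF q, of \<beta> \<alpha>]
        by simp
    qed
    show "zero4_resonance a \<beta> \<alpha> \<longleftrightarrow> line_tangent (frakB a M) \<beta> \<alpha> 0" if "\<beta> \<noteq> 0" for \<beta> \<alpha>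
      using zero4_resonance_iff[OF that C2, of \<alpha>] double[of 0 \<beta> \<alpha>] r0 by simp
  qed
qed

end

section \<open>From the laminar flow to the physical parameters\<close>

lemma profile_laminar_a:
  assumes "nonstagnant_laminar_flow \<gamma> lam"
  shows "profile (laminar_a \<gamma> lam)"
proof
  obtain m where m: "m > 0" "\<And>z. z \<in> {0..1} \<Longrightarrow> m \<le> laminar_a \<gamma> lam z" and L: "L2 \<gamma>"
    using assms by (auto simp: nonstagnant_laminar_flow_def)
  show pos: "laminar_a \<gamma> lam z > 0" if "z \<in> {0..1}" for z
    using m(1) m(2)[OF that] by simp
  define h where "h z = lam + 2 * laminar_Gamma \<gamma> z" for z
  have h: "H1_deriv h (\<lambda>z. 2 *\<^sub>R \<gamma> z)"
    unfolding H1_deriv_def using L2_bounded_scaleR[OF L continuous_on_const, of 2]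
    by (simp add: h_def laminar_Gamma_def)
  have "H1_deriv (\<lambda>z. sqrt (h z)) (\<lambda>z. (inverse (sqrt (h z)) / 2) *\<^sub>R (2 *\<^sub>R \<gamma> z))"
  proof (rule H1_deriv_compose_C1[OF h, where \<Phi> = sqrt and \<Phi>' = "\<lambda>u. inverse (sqrt u) / 2"])
    \<comment> \<open>The real square root is odd here, so its positivity forces the radicand to be
      positive.\<close>
    show "h z > 0" if "z \<in> {0..1}" for z
      using pos[OF that] by (simp add: laminar_a_def h_def)
    show "continuous_on {0<..} (\<lambda>u. inverse (sqrt u) / 2 :: real)"
      by (auto intro!: continuous_intros)
  qed (rule DERIV_real_sqrt)
  then show "H1 (laminar_a \<gamma> lam)"
    unfolding H1_def laminar_a_def[abs_def] h_def by blast
qed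

theorem theorem1p6:
  fixes \<gamma> :: "real \<Rightarrow> real" and lam d m :: real and M :: "real \<Rightarrow> real \<Rightarrow> real"
  defines "a \<equiv> laminar_a \<gamma> lam"
  assumes flow: "nonstagnant_laminar_flow \<gamma> lam"
    and depth: "d > 0" and flux: "m < 0"
    and M: "\<forall>\<^sub>F \<nu> in nhds 0. shoots a \<nu> (M \<nu>)"
    and nondeg: "deriv (deriv (frakB a M)) 0 < 0"
  shows "\<exists>\<sigma>\<^sub>H g\<^sub>H q0 S G.
    \<comment> \<open>(1) the point of \<open>0\<^sup>4\<close> resonance, and the resonance curve emanating from it\<close>
    \<sigma>\<^sub>H > 0 \<and> q0 > 0 \<and>
    (\<forall>\<sigma> g \<Omega> c. \<sigma> > 0 \<longrightarrow>
       (let \<beta> = beta_par d m \<sigma>; \<alpha> = alpha_par d m (effective_gravity g \<Omega> c) in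
         (zero4_resonance a \<beta> \<alpha> \<longleftrightarrow> line_tangent (frakB a M) \<beta> \<alpha> 0) \<and>
         (zero4_resonance a \<beta> \<alpha> \<longleftrightarrow> \<sigma> = \<sigma>\<^sub>H \<and> effective_gravity g \<Omega> c = g\<^sub>H))) \<and>
    smooth_on_open {-q0<..<q0} S \<and> smooth_on_open {-q0<..<q0} G \<and>
    (\<forall>q\<in>{0<..<q0}. S q > 0) \<and>
    (\<forall>q\<in>{0<..<q0}. \<forall>\<sigma> g \<Omega> c. \<sigma> > 0 \<longrightarrow>
       (let \<beta> = beta_par d m \<sigma>; \<alpha> = alpha_par d m (effective_gravity g \<Omega> c) in
         (hamiltonian_hopf a \<beta> \<alpha> q \<longleftrightarrow> line_tangent (frakB a M) \<beta> \<alpha> (- (q\<^sup>2))) \<and>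
         (hamiltonian_hopf a \<beta> \<alpha> q \<longleftrightarrow> \<sigma> = S q \<and> effective_gravity g \<Omega> c = G q))) \<and>
    S 0 = \<sigma>\<^sub>H \<and> G 0 = g\<^sub>H \<and>
    \<comment> \<open>(2) separation from the regime of weak effective gravity\<close>
    g\<^sub>H > 0 \<and>
    (\<exists>\<epsilon>>0. \<exists>q1\<in>{0<..q0}. \<forall>q\<in>{0<..<q1}. \<forall>\<sigma> g \<Omega> c. \<sigma> > 0 \<longrightarrow>
       hamiltonian_hopf a (beta_par d m \<sigma>) (alpha_par d m (effective_gravity g \<Omega> c)) q \<longrightarrow>
       effective_gravity g \<Omega> c \<ge> \<epsilon>)"
proof -
  interpret profile a
    unfolding a_def by (rule profile_laminar_a[OF flow])
  obtain r \<epsilon> where r: "r > 0" and \<epsilon>: "\<epsilon> > 0"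
    and hol: "B_ext holomorphic_on ball 0 r" "B_ext1 holomorphic_on ball 0 r"
    and pos: "\<And>x. x \<in> ball 0 r \<Longrightarrow> Re (B_ext1 x) > 0"
    and sep: "\<And>t. \<bar>t\<bar> < r \<Longrightarrow> Re (B_ext (of_real t)) - t * Re (B_ext1 (of_real t)) > \<epsilon>"
    and tangent: "\<And>t \<beta> \<alpha>. \<bar>t\<bar> < r \<Longrightarrow> line_tangent (frakB a M) \<beta> \<alpha> (- t)
      \<longleftrightarrow> \<beta> = Re (B_ext1 (of_real t)) \<and> \<alpha> = Re (B_ext (of_real t)) - t * Re (B_ext1 (of_real t))"
    and hopf: "\<And>q \<beta> \<alpha>. q \<noteq> 0 \<Longrightarrow> q\<^sup>2 < r \<Longrightarrow> \<beta> \<noteq> 0 \<Longrightarrow> hamiltonian_hopf a \<beta> \<alpha> q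
      \<longleftrightarrow> line_tangent (frakB a M) \<beta> \<alpha> (- (q\<^sup>2))"
    and zero4: "\<And>\<beta> \<alpha>. \<beta> \<noteq> 0 \<Longrightarrow> zero4_resonance a \<beta> \<alpha> \<longleftrightarrow> line_tangent (frakB a M) \<beta> \<alpha> 0"
    by (rule resonances_near_origin[OF M nondeg]) blast
  \<comment> \<open>The tangency values of \<beta> and \<alpha> at x = z^2, rescaled by the inverses
    of \<open>beta_par\<close> and \<open>alpha_par\<close>. As functions of complex z they are
    holomorphic across 0.\<close>
  define fS where "fS z = of_real (m\<^sup>2 / d) * B_ext1 (z\<^sup>2)" for z
  define fG where "fG z = of_real (m\<^sup>2 / d ^ 3) * (B_ext (z\<^sup>2) - z\<^sup>2 * B_ext1 (z\<^sup>2))" for z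
  define S where "S q = Re (fS (of_real q))" for q
  define G where "G q = Re (fG (of_real q))" for q
  \<comment> \<open>|q| < q0 corresponds to q^2 < r. The interval of smoothness is symmetric, so
    smoothness at q = 0 is two-sided although the resonances are parametrized by q > 0.\<close>
  define q0 where "q0 = sqrt r"
  have q0: "q0 > 0" using r by (simp add: q0_def)
  have q2: "q\<^sup>2 < r" if "\<bar>q\<bar> < q0" for q
    using that r by (simp add: q0_def real_less_rsqrt) (metis abs_ge_zero abs_of_pos real_sqrt_abs real_sqrt_less_iff)
  have S: "S q = m\<^sup>2 / d * Re (B_ext1 (of_real (q\<^sup>2)))" for q
    by (simp add: S_def fS_def)
  have G: "G q = m\<^sup>2 / d ^ 3 * (Re (B_ext (of_real (q\<^sup>2))) - q\<^sup>2 * Re (B_ext1 (of_real (q\<^sup>2))))" for q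
    by (simp add: G_def fG_def)
  have sq: "(\<lambda>z :: complex. z\<^sup>2) ` ball 0 q0 \<subseteq> ball 0 r"
    using q2[of "norm _"] by (auto simp: norm_power dist_norm)
  have "(\<lambda>z. f (z\<^sup>2)) holomorphic_on ball 0 q0" if "f holomorphic_on ball 0 r" for f
    using holomorphic_on_compose_gen[OF _ that sq] by (simp add: comp_def holomorphic_intros)
  then have hS: "fS holomorphic_on ball 0 q0" and hG: "fG holomorphic_on ball 0 q0"
    unfolding fS_def[abs_def] fG_def[abs_def] using hol by (auto intro!: holomorphic_intros)
  have scale: "line_tangent (frakB a M) (beta_par d m \<sigma>) (alpha_par d m g) (- (q\<^sup>2)) \<longleftrightarrow> \<sigma> = S q \<and> g = G q"
    if "\<bar>q\<bar> < q0" for \<sigma> g q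
  proof -
    have "\<bar>q\<^sup>2\<bar> < r" using q2[OF that] by simp
    moreover have "beta_par d m \<sigma> = X \<longleftrightarrow> \<sigma> = m\<^sup>2 / d * X" "alpha_par d m g = X \<longleftrightarrow> g = m\<^sup>2 / d ^ 3 * X" for X
      using depth flux by (auto simp: beta_par_def alpha_par_def field_simps)
    ultimately show ?thesis
      by (simp add: tangent S G)
  qed
  have \<beta>: "beta_par d m \<sigma> \<noteq> 0" if "\<sigma> > 0" for \<sigma>
    using that depth flux by (simp add: beta_par_def)
  have Spos: "S q > 0" if "\<bar>q\<bar> < q0" for q
    unfolding S using depth flux q2[OF that] by (intro mult_pos_pos pos) (auto simp: norm_power)
  \<comment> \<open>The lower bound for \<alpha> translated into effective gravity. It holds along
    the curve up to q0, which therefore serves as q1 at the end.\<close>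
  define e where "e = m\<^sup>2 / d ^ 3 * \<epsilon>"
  have e: "e > 0" using depth flux \<epsilon> by (simp add: e_def)
  have Gpos: "G q > e" if "\<bar>q\<bar> < q0" for q
    unfolding G e_def using depth flux q2[OF that] by (intro mult_strict_left_mono sep) auto
  have z: "zero4_resonance a (beta_par d m \<sigma>) (alpha_par d m g) \<longleftrightarrow>
      line_tangent (frakB a M) (beta_par d m \<sigma>) (alpha_par d m g) 0"
    "line_tangent (frakB a M) (beta_par d m \<sigma>) (alpha_par d m g) 0 \<longleftrightarrow> \<sigma> = S 0 \<and> g = G 0"
    if "\<sigma> > 0" for \<sigma> g
    using zero4[OF \<beta>[OF that]] scale[of 0] q0 by auto
  have h: "hamiltonian_hopf a (beta_par d m \<sigma>) (alpha_par d m g) q \<longleftrightarrow>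
      line_tangent (frakB a M) (beta_par d m \<sigma>) (alpha_par d m g) (- (q\<^sup>2))"
    "line_tangent (frakB a M) (beta_par d m \<sigma>) (alpha_par d m g) (- (q\<^sup>2)) \<longleftrightarrow> \<sigma> = S q \<and> g = G q"
    if "q \<in> {0<..<q0}" "\<sigma> > 0" for q \<sigma> g
    using hopf[OF _ q2 \<beta>[OF that(2)]] scale[of q] that(1) by auto
  show ?thesis
  proof (rule exI[of _ "S 0"], rule exI[of _ "G 0"], rule exI[of _ q0], rule exI[of _ S],
      rule exI[of _ G], intro conjI)
    show "S 0 > 0" "G 0 > 0" using Spos[of 0] Gpos[of 0] q0 e by auto
    show "smooth_on_open {-q0<..<q0} S" "smooth_on_open {-q0<..<q0} G"
      unfolding S_def[abs_def] G_def[abs_def] by (rule smooth_on_open_Re_holomorphic, fact)+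
    show "\<forall>q\<in>{0<..<q0}. S q > 0" using Spos by simp
    show "\<exists>\<epsilon>>0. \<exists>q1\<in>{0<..q0}. \<forall>q\<in>{0<..<q1}. \<forall>\<sigma> g \<Omega> c. \<sigma> > 0 \<longrightarrow>
       hamiltonian_hopf a (beta_par d m \<sigma>) (alpha_par d m (effective_gravity g \<Omega> c)) q \<longrightarrow>
       effective_gravity g \<Omega> c \<ge> \<epsilon>"
    proof (intro exI[of _ e] conjI bexI[of _ q0] ballI allI impI e)
      fix q \<sigma> g \<Omega> c :: real
      assume q: "q \<in> {0<..<q0}" and \<sigma>: "\<sigma> > 0"
        and "hamiltonian_hopf a (beta_par d m \<sigma>) (alpha_par d m (effective_gravity g \<Omega> c)) q"
      then have "effective_gravity g \<Omega> c = G q" using h[OF q \<sigma>] by simp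
      then show "effective_gravity g \<Omega> c \<ge> e" using Gpos[of q] q by simp
    qed (use q0 in simp)
  qed (use q0 z h in \<open>simp_all add: Let_def\<close>)
qed

end
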